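(* Let $\mathbf d_q:\mathcal V(\theta_q)\to\mathcal V(\theta_{q-1})$ ($q\ge1$) be the $\mathfrak g$-module homomorphism with $\mathbf d_q(y_n\otimes(e^*_{m+n})^q\otimes1_{\mathcal E})=1\otimes(e^*_{m+n})^{q-1}\otimes1_{\mathcal E}$, and $\mathbf d_0=0$. Then $\mathbf d_q\circ\mathbf d_{q+1}=0$ for all $q\ge0$, and: (1) $\mathcal V(\theta_q)$ is reducible for every $q\ge1$; (2) $\operatorname{Im}\mathbf d_{q+1}\cong L(\theta_q)$ for all $q\ge0$; (3) $\ker\mathbf d_q=\operatorname{Im}\mathbf d_{q+1}$ for all $q\ge0$ with $q\ne m$; (4) $\ker\mathbf d_m/\operatorname{Im}\mathbf d_{m+1}$ is the one-dimensional trivial $\mathfrak g$-module (spanned by the class of $y_1\cdots y_n\otimes e_1^*\cdots e_m^*\otimes1_{\mathcal E}$).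
   Context: $\mathbb F$ algebraically closed of characteristic $0$, $m,n\ge1$. $\mathcal R=\mathbb F[x_1,\dots,x_m]\otimes\Lambda(y_1,\dots,y_n)$ ($x_i$ even, $y_s$ odd). $\mathfrak g=W(m,n)$ the Lie superalgebra of superderivations of $\mathcal R$, free over $\mathcal R$ on even $\partial_i$ and odd $D_t$, with $\mathfrak g_0\cong\mathfrak{gl}(m|n)$ via $x_i\partial_j\mapsto E_{ij}$, $x_iD_s\mapsto E_{i,m+s}$, $y_r\partial_j\mapsto E_{m+r,j}$, $y_rD_s\mapsto E_{m+r,m+s}$. $\mathcal E=\sum_{i=1}^m\epsilon_i-\sum_{j=1}^n\delta_j$, $\theta_q=\mathcal E-q\delta_n$. $L^0(\theta_q)$ is realized as $\Omega^q(V^* )\otimes\mathbb F_{\mathcal E}$, where $V^*$ is the dual of the natural module $\mathbb F^{m|n}$ with dual basis $e_i^*$ ($e^*_i$ even iff $i\le m$), $\Omega^q(V^* )$ its $q$-th super-Grassmann power (even vectors anticommute, odd vectors commute; products written by juxtaposition), and $\mathbb F_{\mathcal E}=\mathbb F1_{\mathcal E}$ the one-dimensional module of weight $\mathcal E$. For dominant integral $\lambda$, $\mathcal V(\lambda)=\mathcal R\otimes L^0(\lambda)$ is the mixed-product module (homogeneous $f,g$, $\xi$ the $\mathfrak g_0$-action: $f\partial_i.(g\otimes v)=f\partial_i(g)\otimes v+\sum_j\partial_j(f)g\otimes\xi(x_j\partial_i)v+(-1)^{\wp(f)+\wp(g)+1}\sum_jD_j(f)g\otimes\xi(y_j\partial_i)v$,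 $fD_i.(g\otimes v)=fD_i(g)\otimes v+(-1)^{\wp(g)}\sum_j\partial_j(f)g\otimes\xi(x_jD_i)v+(-1)^{\wp(f)+1}\sum_jD_j(f)g\otimes\xi(y_jD_i)v$), and $L(\lambda)$ is its unique simple submodule $U(\mathfrak g)(1\otimes L^0(\lambda))$. The vector $y_n\otimes(e^*_{m+n})^q\otimes1_{\mathcal E}$ generates $\mathcal V(\theta_q)$. *)

theory Defs
  imports "HOL-Computational_Algebra.Polynomial"
begin

(* Conventions (0-based indices):
   x_1..x_m  ~ x 0 .. x (m-1);  y_1..y_n ~ y 0 .. y (n-1);
   e*_1..e*_{m+n} ~ indices 0..m+n-1 (index p is odd iff m <= p).
   A monomial of R is (a, S): a :: nat => nat exponents of the x's, S a strictly
   increasing list of y-indices (the product y_{S!0} y_{S!1} ...).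
   A monomial of Omega(V* ) is a nondecreasing word w of e*-indices (the product
   e*_{w!0} e*_{w!1} ...), with no repeated even index.
   V(lambda) elements are finitely supported coefficient functions on pairs
   (R-monomial, Omega-monomial); W(m,n) elements are finitely supported
   coefficient functions on pairs (f, i) with f an R-monomial and i < m+n,
   (f, i) meaning f \<partial>_i for i < m and f D_(i-m) for i >= m. *)

definition alg_closed :: "'k::field itself \<Rightarrow> bool" where
  "alg_closed _ \<longleftrightarrow> (\<forall>p :: 'k poly. 1 \<le> degree p \<longrightarrow> (\<exists>x. poly p x = 0))"

type_synonym rmon = "(nat \<Rightarrow> nat) \<times> nat list"
type_synonym omon = "nat list"
type_synonym vbas = "rmon \<times> omon"
type_synonym gbas = "rmon \<times> nat"

definition inv_pairs :: "nat list \<Rightarrow> (nat \<times> nat) set" where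
  "inv_pairs w = {(r, s). r < s \<and> s < length w \<and> w ! s < w ! r}"

(* sign of sorting a word of anticommuting odd generators y (0 if a repeat) *)
definition ysign :: "nat list \<Rightarrow> int" where
  "ysign w = (if distinct w then (-1) ^ card (inv_pairs w) else 0)"

definition rmul :: "rmon \<Rightarrow> rmon \<Rightarrow> int \<times> rmon" where
  "rmul f g = (ysign (snd f @ snd g), (\<lambda>i. fst f i + fst g i, sort (snd f @ snd g)))"

(* \<partial>_j and D_j (left derivative) of an R-monomial *)
definition rdx :: "nat \<Rightarrow> rmon \<Rightarrow> int \<times> rmon" where
  "rdx j f = (int (fst f j), ((fst f)(j := fst f j - 1), snd f))"

definition rdy :: "nat \<Rightarrow> rmon \<Rightarrow> int \<times> rmon" where
  "rdy j f = (if j \<in> set (snd f) then (-1) ^ length (takeWhile (\<lambda>s. s \<noteq> j) (snd f)) else 0,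
              (fst f, remove1 j (snd f)))"

(* Koszul sign of sorting a word in the super-Grassmann algebra Omega(V* ):
   u v = - (-1)^(|u||v|) v u; 0 if an even vector repeats *)
definition osign :: "nat \<Rightarrow> nat list \<Rightarrow> int" where
  "osign m w = (if \<not> distinct (filter (\<lambda>p. p < m) w) then 0
     else (\<Prod>(r, s) \<in> inv_pairs w. (if m \<le> w ! r \<and> m \<le> w ! s then 1 else -1)))"

definition ipar :: "nat \<Rightarrow> nat \<Rightarrow> nat" where
  "ipar m p = (if m \<le> p then 1 else 0)"

(* xi(E_kl) acting on the basis vector w \<otimes> 1_E of Omega^q(V* ) \<otimes> F_E,
   returned as a coefficient function on Omega-monomials.
   E_kl . e*_p = - (-1)^((|k|+|l|)|k|) delta_pk e*_l  (super dual of the natural module),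
   extended as a super derivation, plus the weight E(E_kl). *)
definition xi :: "nat \<Rightarrow> nat \<Rightarrow> nat \<Rightarrow> omon \<Rightarrow> omon \<Rightarrow> 'k::field" where
  "xi m k l w w' =
     (\<Sum>r<length w. if w ! r = k then
        of_int ((-1) ^ ((ipar m k + ipar m l) * length (filter (\<lambda>p. m \<le> p) (take r w)))
                * (- ((-1) ^ ((ipar m k + ipar m l) * ipar m k)))
                * osign m (w[r := l]))
        * (if w' = sort (w[r := l]) then 1 else 0)
      else 0)
     + (if k = l \<and> w' = w then (if k < m then 1 else -1) else 0)"

definition act_basis :: "nat \<Rightarrow> nat \<Rightarrow> gbas \<Rightarrow> vbas \<Rightarrow> vbas \<Rightarrow> 'k::field" where
  "act_basis m n X v b =
     (let f = fst X; i = snd X; g = fst v; w = snd v;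
          pf = length (snd f); pg = length (snd g);
          dg = (if i < m then rdx i g else rdy (i - m) g);
          t1 = rmul f (snd dg);
          s2 = (if i < m then (1::int) else (-1) ^ pg);
          s3 = (if i < m then (-1) ^ (pf + pg + 1) else (-1) ^ (pf + 1)::int)
      in of_int (fst dg * fst t1) * (if b = (snd t1, w) then 1 else 0)
       + (\<Sum>j<m. of_int (s2 * fst (rdx j f) * fst (rmul (snd (rdx j f)) g))
            * (if fst b = snd (rmul (snd (rdx j f)) g) then xi m j i w (snd b) else 0))
       + (\<Sum>j<n. of_int (s3 * fst (rdy j f) * fst (rmul (snd (rdy j f)) g))
            * (if fst b = snd (rmul (snd (rdy j f)) g) then xi m (m + j) i w (snd b) else 0)))"

definition act :: "nat \<Rightarrow> nat \<Rightarrow> (gbas \<Rightarrow> 'k::field) \<Rightarrow> (vbas \<Rightarrow> 'k) \<Rightarrow> vbas \<Rightarrow> 'k" where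
  "act m n X v b = (\<Sum>gb\<in>{gb. X gb \<noteq> 0}. \<Sum>vb\<in>{vb. v vb \<noteq> 0}. X gb * v vb * act_basis m n gb vb b)"

definition valid_rmon :: "nat \<Rightarrow> nat \<Rightarrow> rmon \<Rightarrow> bool" where
  "valid_rmon m n f \<longleftrightarrow> (\<forall>i. m \<le> i \<longrightarrow> fst f i = 0) \<and> sorted_wrt (<) (snd f) \<and> (\<forall>s\<in>set (snd f). s < n)"

definition valid_omon :: "nat \<Rightarrow> nat \<Rightarrow> nat \<Rightarrow> omon \<Rightarrow> bool" where
  "valid_omon m n q w \<longleftrightarrow> length w = q \<and> sorted w \<and> (\<forall>p\<in>set w. p < m + n)
      \<and> distinct (filter (\<lambda>p. p < m) w)"

(* the mixed product module V(theta_q) = R \<otimes> Omega^q(V* ) \<otimes> F_E *)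
definition Vq :: "nat \<Rightarrow> nat \<Rightarrow> nat \<Rightarrow> (vbas \<Rightarrow> 'k::field) set" where
  "Vq m n q = {v. finite {b. v b \<noteq> 0} \<and>
      (\<forall>b. v b \<noteq> 0 \<longrightarrow> valid_rmon m n (fst b) \<and> valid_omon m n q (snd b))}"

definition Gcar :: "nat \<Rightarrow> nat \<Rightarrow> (gbas \<Rightarrow> 'k::field) set" where
  "Gcar m n = {X. finite {g. X g \<noteq> 0} \<and> (\<forall>g. X g \<noteq> 0 \<longrightarrow> valid_rmon m n (fst g) \<and> snd g < m + n)}"

definition vzero :: "vbas \<Rightarrow> 'k::field" where "vzero = (\<lambda>_. 0)"

definition single :: "vbas \<Rightarrow> vbas \<Rightarrow> 'k::field" where
  "single b = (\<lambda>b'. if b' = b then 1 else 0)"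

definition submodule :: "nat \<Rightarrow> nat \<Rightarrow> nat \<Rightarrow> (vbas \<Rightarrow> 'k::field) set \<Rightarrow> bool" where
  "submodule m n q W \<longleftrightarrow> W \<subseteq> Vq m n q \<and> vzero \<in> W
     \<and> (\<forall>u\<in>W. \<forall>v\<in>W. (\<lambda>b. u b + v b) \<in> W)
     \<and> (\<forall>c u. u \<in> W \<longrightarrow> (\<lambda>b. c * u b) \<in> W)
     \<and> (\<forall>X\<in>Gcar m n. \<forall>u\<in>W. act m n X u \<in> W)"

(* even g-module map between submodules A and B *)
definition gmap :: "nat \<Rightarrow> nat \<Rightarrow> (vbas \<Rightarrow> 'k::field) set \<Rightarrow> (vbas \<Rightarrow> 'k) set
      \<Rightarrow> ((vbas \<Rightarrow> 'k) \<Rightarrow> (vbas \<Rightarrow> 'k)) \<Rightarrow> bool" where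
  "gmap m n A B \<phi> \<longleftrightarrow> (\<forall>u\<in>A. \<phi> u \<in> B)
     \<and> (\<forall>u\<in>A. \<forall>v\<in>A. \<phi> (\<lambda>b. u b + v b) = (\<lambda>b. \<phi> u b + \<phi> v b))
     \<and> (\<forall>c. \<forall>u\<in>A. \<phi> (\<lambda>b. c * u b) = (\<lambda>b. c * \<phi> u b))
     \<and> (\<forall>X\<in>Gcar m n. \<forall>u\<in>A. \<phi> (act m n X u) = act m n X (\<phi> u))"

definition gmod_iso :: "nat \<Rightarrow> nat \<Rightarrow> (vbas \<Rightarrow> 'k::field) set \<Rightarrow> (vbas \<Rightarrow> 'k) set \<Rightarrow> bool" where
  "gmod_iso m n A B \<longleftrightarrow> (\<exists>\<phi>. gmap m n A B \<phi> \<and> bij_betw \<phi> A B)"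

(* L(theta_q) = U(g)(1 \<otimes> L^0(theta_q)): the submodule generated by 1 \<otimes> Omega^q \<otimes> 1_E *)
definition Lmod :: "nat \<Rightarrow> nat \<Rightarrow> nat \<Rightarrow> (vbas \<Rightarrow> 'k::field) set" where
  "Lmod m n q = \<Inter>{W. submodule m n q W \<and>
      (\<forall>w. valid_omon m n q w \<longrightarrow> single ((\<lambda>_. 0, []), w) \<in> W)}"

definition gen_vec :: "nat \<Rightarrow> nat \<Rightarrow> nat \<Rightarrow> vbas \<Rightarrow> 'k::field" where
  "gen_vec m n q = single ((\<lambda>_. 0, [n - 1]), replicate q (m + n - 1))"

definition gen_img :: "nat \<Rightarrow> nat \<Rightarrow> nat \<Rightarrow> vbas \<Rightarrow> 'k::field" where
  "gen_img m n q = single ((\<lambda>_. 0, []), replicate (q - 1) (m + n - 1))"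

definition dprops :: "nat \<Rightarrow> nat \<Rightarrow> (nat \<Rightarrow> (vbas \<Rightarrow> 'k::field) \<Rightarrow> (vbas \<Rightarrow> 'k)) \<Rightarrow> bool" where
  "dprops m n d \<longleftrightarrow> (\<forall>v. d 0 v = vzero)
     \<and> (\<forall>q\<ge>1. gmap m n (Vq m n q) (Vq m n (q - 1)) (d q) \<and> d q (gen_vec m n q) = gen_img m n q)"

end

theory Submission
  imports Defs
begin

text \<open>
  Identify \<open>\<R> \<otimes> \<Omega>(V\<^sup>*)\<close> with a Fock space having one boson and one fermion for each index
  \<open>p < m + n\<close>: for \<open>p < m\<close> the boson is \<open>x\<^sub>p\<close> and the fermion is \<open>e\<^sup>*\<^sub>p\<close>, for \<open>p \<ge> m\<close> the boson is \<open>e\<^sup>*\<^sub>p\<close>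
  and the fermion is \<open>y\<close> with index \<open>p - m\<close>.  Up to parity signs the differential is
  \<open>d = \<Sum>\<^sub>p \<delta>\<^sub>p \<iota>\<^sub>p\<close>, where \<open>\<delta>\<^sub>p\<close> differentiates \<open>\<R>\<close> and \<open>\<iota>\<^sub>p\<close> contracts \<open>\<Omega>(V\<^sup>*)\<close>; on \<open>\<V>(\<theta>\<^sub>q)\<close> one has
  \<open>d\<^sub>q = - d / q\<close>.  With \<open>K\<^sub>p = [\<delta>\<^sub>p, f]\<close>, the action of \<open>f \<partial>\<^sub>i\<close> is, up to parity signs,
  \<open>f \<delta>\<^sub>i - \<Sum>\<^sub>p K\<^sub>p e\<^sub>i \<iota>\<^sub>p + K\<^sub>i\<close>, and the canonical (anti)commutation relations show that it commutes with \<open>d\<close>.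
  The operator \<open>h = \<Sum>\<^sub>p\<close> (multiplication by the \<open>p\<close>-th variable of \<open>\<R>\<close>) \<open>e\<^sub>p\<close> satisfies \<open>d h + h d = N\<close>, where \<open>N\<close> is diagonal
  and counts bosons plus missing fermions.  Hence the cohomology is the kernel of \<open>N\<close>, which is spanned by the
  state \<open>y\<^sub>1\<cdots>y\<^sub>n \<otimes> e\<^sup>*\<^sub>1\<cdots>e\<^sup>*\<^sub>m\<close> without bosons and with all fermions.

  For \<open>q \<ge> 1\<close> the vector \<open>y\<^sub>n \<otimes> (e\<^sup>*\<^sub>m\<^sub>+\<^sub>n)\<^sup>q\<close> generates: the fields \<open>f D\<^sub>n\<close> send it to nonzero multiples of all
  \<open>f \<otimes> (e\<^sup>*\<^sub>m\<^sub>+\<^sub>n)\<^sup>q\<close>, and then \<open>y\<^sub>n \<partial>\<^sub>l\<close>, \<open>y\<^sub>n D\<^sub>l\<close> replace factors \<open>e\<^sup>*\<^sub>m\<^sub>+\<^sub>n\<close> one at a time.  This makes \<open>d\<^sub>q\<close> unique and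
  identifies its image with \<open>L(\<theta>\<^sub>q\<^sub>-\<^sub>1)\<close>.
\<close>

section \<open>Linear operators on function spaces\<close>

text \<open>Bundled as a type, linear maps form a \<open>ring_1\<close> with composition as product,
  so operator identities become ring algebra by \<open>algebra_simps\<close>,
  \<open>mult.assoc\<close> and \<open>sum_product\<close>.\<close>

typedef (overloaded) ('b, 'k::field) linop =
  "{T :: ('b \<Rightarrow> 'k) \<Rightarrow> 'b \<Rightarrow> 'k.
     (\<forall>u v. T (\<lambda>b. u b + v b) = (\<lambda>b. T u b + T v b)) \<and> (\<forall>c u. T (\<lambda>b. c * u b) = (\<lambda>b. c * T u b))}"
  morphisms app Linop
  by (rule exI[of _ "\<lambda>v. v"]) auto

setup_lifting type_definition_linop

instantiation linop :: (type, field) ring_1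
begin

lift_definition zero_linop :: "('a, 'b) linop" is "\<lambda>v b. 0" by auto
lift_definition one_linop :: "('a, 'b) linop" is "\<lambda>v. v" by auto
lift_definition plus_linop :: "('a, 'b) linop \<Rightarrow> ('a, 'b) linop \<Rightarrow> ('a, 'b) linop"
  is "\<lambda>S T v b. S v b + T v b" by (auto simp: algebra_simps)
lift_definition minus_linop :: "('a, 'b) linop \<Rightarrow> ('a, 'b) linop \<Rightarrow> ('a, 'b) linop"
  is "\<lambda>S T v b. S v b - T v b" by (auto simp: algebra_simps)
lift_definition uminus_linop :: "('a, 'b) linop \<Rightarrow> ('a, 'b) linop"
  is "\<lambda>S v b. - S v b" by auto
lift_definition times_linop :: "('a, 'b) linop \<Rightarrow> ('a, 'b) linop \<Rightarrow> ('a, 'b) linop"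
  is "\<lambda>S T v. S (T v)" by auto

instance
proof
  show "(0::('a, 'b) linop) \<noteq> 1"
    by transfer (metis zero_neq_one)
  fix a b c :: "('a, 'b) linop"
  show "(a + b) * c = a * c + b * c" by transfer auto
  show "a * (b + c) = a * b + a * c" by transfer auto
qed (transfer; auto simp: algebra_simps)+

end

lemma linop_eqI: "(\<And>v b. app S v b = app T v b) \<Longrightarrow> S = T"
  by (metis app_inject ext)

lemma app_simps [simp]:
  "app 0 v b = 0" "app 1 v = v" "app (S + T) v b = app S v b + app T v b"
  "app (S - T) v b = app S v b - app T v b" "app (- S) v b = - app S v b" "app (S * T) v = app S (app T v)"
  by (transfer, simp)+

lemma app_add: "app T (\<lambda>b. u b + v b) = (\<lambda>b. app T u b + app T v b)"
  and app_scale: "app T (\<lambda>b. c * u b) = (\<lambda>b. c * app T u b)"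
  by (transfer, blast)+

lemma app_zero: "app T (\<lambda>b. 0) = (\<lambda>b. 0)"
  using app_scale[of T 0 "\<lambda>_. 0"] by simp

lemma app_sum: "app T (\<lambda>b. \<Sum>i\<in>I. f i b) = (\<lambda>b. \<Sum>i\<in>I. app T (f i) b)"
  by (induction I rule: infinite_finite_induct) (simp_all add: app_zero app_add)

lemma app_of_nat [simp]: "app (of_nat k) v b = of_nat k * v b"
  by (induction k) (simp_all add: algebra_simps)

lemma app_of_int [simp]: "app (of_int k) v b = of_int k * v b"
  by (cases k rule: int_cases2) simp_all

lemma app_sum_left [simp]: "app (\<Sum>i\<in>I. T i) v b = (\<Sum>i\<in>I. app (T i) v b)"
  by (induction I rule: infinite_finite_induct) simp_all

definition pull :: "('b \<Rightarrow> 'k) \<Rightarrow> ('b \<Rightarrow> 'b) \<Rightarrow> ('b, 'k::field) linop" where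
  "pull c t = Linop (\<lambda>v b. c b * v (t b))"

lemma app_pull [simp]: "app (pull c t) v b = c b * v (t b)"
  unfolding pull_def by (subst Linop_inverse) (auto simp: algebra_simps)

section \<open>Bosonic and fermionic operators\<close>

text \<open>\<open>(\<beta>, F)\<close> is the state with \<open>\<beta> p\<close> bosons of index \<open>p\<close> and the fermions in \<open>F\<close>.  All operators are given as
  pullbacks of coefficient functions, so they act on arbitrary functions and no finiteness is needed for the
  relations; e.g. \<open>an\<close>, a derivative, reads off the coefficient of the state with one more boson.\<close>
type_synonym fock = "(nat \<Rightarrow> nat) \<times> nat set"

definition an :: "nat \<Rightarrow> (fock, 'k::field) linop" where
  "an p = pull (\<lambda>(\<beta>, F). of_nat (Suc (\<beta> p))) (\<lambda>(\<beta>, F). (\<beta>(p := Suc (\<beta> p)), F))"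

text \<open>Multiplication by the monomial with exponent function \<open>f\<close>; the guard
  excludes the states where the subtraction would be truncated.\<close>

definition shift_up :: "(nat \<Rightarrow> nat) \<Rightarrow> (fock, 'k::field) linop" where
  "shift_up f = pull (\<lambda>(\<beta>, F). if \<forall>i. f i \<le> \<beta> i then 1 else 0) (\<lambda>(\<beta>, F). (\<lambda>i. \<beta> i - f i, F))"

definition cr :: "nat \<Rightarrow> (fock, 'k::field) linop" where
  "cr p = pull (\<lambda>(\<beta>, F). if \<beta> p = 0 then 0 else 1) (\<lambda>(\<beta>, F). (\<beta>(p := \<beta> p - 1), F))"

text \<open>The Jordan-Wigner sign: a fermionic operator at \<open>p\<close> has to pass the
  fermions of smaller index.\<close>

definition sgn_below :: "nat \<Rightarrow> nat set \<Rightarrow> 'k::field" where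
  "sgn_below p F = (-1) ^ card (F \<inter> {..<p})"

definition fan :: "nat \<Rightarrow> (fock, 'k::field) linop" where
  "fan p = pull (\<lambda>(\<beta>, F). if p \<in> F then 0 else sgn_below p F) (\<lambda>(\<beta>, F). (\<beta>, insert p F))"

definition fcr :: "nat \<Rightarrow> (fock, 'k::field) linop" where
  "fcr p = pull (\<lambda>(\<beta>, F). if p \<in> F then sgn_below p F else 0) (\<lambda>(\<beta>, F). (\<beta>, F - {p}))"

definition fpar :: "nat set \<Rightarrow> (fock, 'k::field) linop" where
  "fpar J = pull (\<lambda>(\<beta>, F). (-1) ^ card (F \<inter> J)) (\<lambda>\<phi>. \<phi>)"

definition bpar :: "nat set \<Rightarrow> (fock, 'k::field) linop" where
  "bpar J = pull (\<lambda>(\<beta>, F). (-1) ^ (\<Sum>p\<in>J. \<beta> p)) (\<lambda>\<phi>. \<phi>)"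

lemma an_an: "an p * an q = an q * (an p :: (fock, 'k::field) linop)"
  by (rule linop_eqI) (auto simp: an_def fun_upd_twist)

lemma cr_cr: "cr p * cr q = cr q * (cr p :: (fock, 'k::field) linop)"
  by (rule linop_eqI) (auto simp: cr_def fun_upd_twist)

lemma an_cr: "an p * cr q = (if p = q then 1 else 0) + cr q * (an p :: (fock, 'k::field) linop)"
  by (rule linop_eqI) (auto simp: an_def cr_def fun_upd_twist algebra_simps split: if_splits)

lemma sgn_below_insert:
  "sgn_below q (insert p F) = (if p < q \<and> p \<notin> F then - sgn_below q F else (sgn_below q F :: 'k::field))"
proof -
  have "insert p F \<inter> {..<q} = (if p < q then insert p (F \<inter> {..<q}) else F \<inter> {..<q})" by auto
  then show ?thesis by (auto simp: sgn_below_def insert_absorb)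
qed

lemma sgn_below_remove:
  "sgn_below q (F - {p}) = (if p < q \<and> p \<in> F then - sgn_below q F else (sgn_below q F :: 'k::field))"
proof (cases "p \<in> F")
  case True
  then show ?thesis using sgn_below_insert[of q p "F - {p}", where 'k='k] by (simp add: insert_absorb)
qed simp

lemma sgn_below_square [simp]: "sgn_below p F * sgn_below p F = (1 :: 'k::field)"
  by (simp add: sgn_below_def flip: power_add)

lemma sgn_below_square' [simp]: "sgn_below p F * (sgn_below p F * x) = (x :: 'k::field)"
  by (simp flip: mult.assoc)

text \<open>For \<open>p < q\<close> the presence of \<open>p\<close> is seen by the sign at
  \<open>q\<close> but not conversely, which leaves one minus sign; for \<open>p = q\<close> both
  products vanish.\<close>

lemma fan_fan: "fan p * fan q = - (fan q * (fan p :: (fock, 'k::field) linop))"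
  by (rule linop_eqI) (auto simp: fan_def sgn_below_insert insert_commute)

lemma fcr_fcr: "fcr p * fcr q = - (fcr q * (fcr p :: (fock, 'k::field) linop))"
proof (rule linop_eqI)
  fix v :: "fock \<Rightarrow> 'k" and b :: fock
  obtain \<beta> F where b: "b = (\<beta>, F)" by fastforce
  have "F - {p} - {q} = F - {q} - {p}" by auto
  then show "app (fcr p * fcr q) v b = app (- (fcr q * fcr p)) v b"
    by (auto simp: b fcr_def sgn_below_remove)
qed

text \<open>The canonical anticommutation relation. For \<open>p = q\<close> exactly one of the two
  products survives on a given state and its two signs square to 1; for distinct indices the
  argument is that of \<open>fan_fan\<close>.\<close>

lemma fan_fcr: "fan p * fcr q = (if p = q then 1 else 0) - fcr q * (fan p :: (fock, 'k::field) linop)"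
proof (rule linop_eqI)
  fix v :: "fock \<Rightarrow> 'k" and b :: fock
  obtain \<beta> F where b: "b = (\<beta>, F)" by fastforce
  have "p \<noteq> q \<Longrightarrow> insert p F - {q} = insert p (F - {q})" by auto
  moreover have "p \<notin> F \<Longrightarrow> insert p F - {p} = F" by auto
  ultimately show "app (fan p * fcr q) v b = app ((if p = q then 1 else 0) - fcr q * fan p) v b"
    by (auto simp: b fan_def fcr_def sgn_below_remove sgn_below_insert insert_absorb)
qed

lemma boson_fermion:
  "an p * fan q = fan q * (an p :: (fock, 'k::field) linop)"
  "an p * fcr q = fcr q * (an p :: (fock, 'k::field) linop)"
  "cr p * fan q = fan q * (cr p :: (fock, 'k::field) linop)"
  "cr p * fcr q = fcr q * (cr p :: (fock, 'k::field) linop)"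
  by (rule linop_eqI, auto simp: an_def cr_def fan_def fcr_def)+

lemma fpar_card_insert:
  assumes "finite J" "p \<notin> F"
  shows "(-1) ^ card (insert p F \<inter> J) = (if p \<in> J then - ((-1) ^ card (F \<inter> J)) else ((-1) ^ card (F \<inter> J) :: 'k::field))"
  using assms by (auto simp: Int_insert_left)

lemma fpar_card_remove:
  assumes "finite J" "p \<in> F"
  shows "(-1) ^ card ((F - {p}) \<inter> J) = (if p \<in> J then - ((-1) ^ card (F \<inter> J)) else ((-1) ^ card (F \<inter> J) :: 'k::field))"
  using fpar_card_insert[of J p "F - {p}", where 'k='k] assms by (simp add: insert_absorb)

lemma fpar_fan: "finite J \<Longrightarrow> fpar J * fan p = (if p \<in> J then - (fan p * fpar J) else fan p * (fpar J :: (fock, 'k::field) linop))"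
  by (rule linop_eqI) (auto simp: fpar_def fan_def fpar_card_insert)

lemma fpar_fcr: "finite J \<Longrightarrow> fpar J * fcr p = (if p \<in> J then - (fcr p * fpar J) else fcr p * (fpar J :: (fock, 'k::field) linop))"
  by (rule linop_eqI) (auto simp: fpar_def fcr_def fpar_card_remove split: if_splits)

lemma fpar_boson:
  "fpar J * an p = an p * (fpar J :: (fock, 'k::field) linop)"
  "fpar J * cr p = cr p * (fpar J :: (fock, 'k::field) linop)"
  by (rule linop_eqI, auto simp: an_def cr_def fpar_def)+

lemma fpar_fpar: "fpar J * fpar J' = fpar J' * (fpar J :: (fock, 'k::field) linop)"
  by (rule linop_eqI) (auto simp: fpar_def)

lemma fpar_square: "fpar J * fpar J = (1 :: (fock, 'k::field) linop)"
  by (rule linop_eqI) (auto simp: fpar_def simp flip: power_add mult.assoc)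

lemma sum_fun_upd_notin: "p \<notin> J \<Longrightarrow> sum (\<beta>(p := x)) J = sum \<beta> J"
  by (rule sum.cong) auto

lemma bpar_an: "finite J \<Longrightarrow> bpar J * an p = (if p \<in> J then - (an p * bpar J) else an p * (bpar J :: (fock, 'k::field) linop))"
  by (rule linop_eqI) (auto simp: bpar_def an_def sum.remove[of J p] sum_fun_upd_notin simp del: fun_upd_apply, simp)

lemma bpar_cr: "finite J \<Longrightarrow> bpar J * cr p = (if p \<in> J then - (cr p * bpar J) else cr p * (bpar J :: (fock, 'k::field) linop))"
proof (rule linop_eqI)
  fix v :: "fock \<Rightarrow> 'k" and b :: fock
  assume J: "finite J"
  obtain \<beta> F where b: "b = (\<beta>, F)" by fastforce
  show "app (bpar J * cr p) v b = app (if p \<in> J then - (cr p * bpar J) else cr p * bpar J) v b"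
  proof (cases "p \<in> J \<and> \<beta> p \<noteq> 0")
    case True
    then obtain k where "\<beta> p = Suc k" using not0_implies_Suc by blast
    with True J show ?thesis
      by (auto simp: b bpar_def cr_def sum.remove[of J p] sum_fun_upd_notin simp del: fun_upd_apply) simp
  qed (auto simp: b bpar_def cr_def sum_fun_upd_notin simp del: fun_upd_apply)
qed

lemma bpar_fermion:
  "bpar J * fan p = fan p * (bpar J :: (fock, 'k::field) linop)"
  "bpar J * fcr p = fcr p * (bpar J :: (fock, 'k::field) linop)"
  "bpar J * fpar J' = fpar J' * (bpar J :: (fock, 'k::field) linop)"
  by (rule linop_eqI, auto simp: bpar_def fan_def fcr_def fpar_def)+

lemma bpar_square: "bpar J * bpar J = (1 :: (fock, 'k::field) linop)"
  by (rule linop_eqI) (auto simp: bpar_def simp flip: power_add mult.assoc)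

lemma shift_up_commute:
  "shift_up f * fan p = fan p * (shift_up f :: (fock, 'k::field) linop)"
  "shift_up f * fcr p = fcr p * (shift_up f :: (fock, 'k::field) linop)"
  "shift_up f * fpar J = fpar J * (shift_up f :: (fock, 'k::field) linop)"
  by (rule linop_eqI, auto simp: shift_up_def fan_def fcr_def fpar_def)+

text \<open>The Leibniz rule for a monomial times a function. On coefficients it says that \<beta> p
  + 1 splits as f p plus \<beta> p + 1 - f p. For \<open>f p = 0\<close> the truncated exponent
  \<open>f p - 1\<close> is harmless, since its coefficient is zero.\<close>

lemma an_shift_up:
  "an p * shift_up f = of_nat (f p) * shift_up (f(p := f p - 1)) + shift_up f * (an p :: (fock, 'k::field) linop)"
proof (rule linop_eqI)
  fix v :: "fock \<Rightarrow> 'k" and b :: fock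
  obtain \<beta> F where b: "b = (\<beta>, F)" by fastforce
  show "app (an p * shift_up f) v b = app (of_nat (f p) * shift_up (f(p := f p - 1)) + shift_up f * an p) v b"
  proof (cases "\<forall>i. i \<noteq> p \<longrightarrow> f i \<le> \<beta> i")
    case True
    have fun_eq: "(\<lambda>i. (\<beta>(p := Suc (\<beta> p))) i - f i) = (\<lambda>i. \<beta> i - f i)(p := Suc (\<beta> p) - f p)"
      "(\<lambda>i. \<beta> i - (f(p := f p - 1)) i) = (\<lambda>i. \<beta> i - f i)(p := \<beta> p - (f p - 1))" by auto
    have le: "(\<forall>i. f i \<le> (\<beta>(p := Suc (\<beta> p))) i) \<longleftrightarrow> f p \<le> Suc (\<beta> p)"
      "(\<forall>i. (f(p := f p - 1)) i \<le> \<beta> i) \<longleftrightarrow> f p - 1 \<le> \<beta> p" "(\<forall>i. f i \<le> \<beta> i) \<longleftrightarrow> f p \<le> \<beta> p"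
      using True by auto
    \<comment> \<open>With no \<open>x_p\<close> in the monomial there is no derivative term; for
      \<open>k < \<beta> p\<close> both terms on the right survive, for \<open>k = \<beta> p\<close>
      only the derivative term, and beyond that everything is zero.\<close>
    consider "f p = 0" | k where "f p = Suc k" "k < \<beta> p" | k where "f p = Suc k" "k = \<beta> p"
      | k where "f p = Suc k" "k > \<beta> p" using not0_implies_Suc linorder_neqE_nat by metis
    then show ?thesis
    proof cases
      case 2
      then have "of_nat (Suc (\<beta> p)) = (of_nat (Suc k) + of_nat (Suc (\<beta> p - Suc k)) :: 'k)"
        by (simp flip: of_nat_add)
      then have "of_nat (Suc (\<beta> p)) * x = of_nat (Suc k) * x + of_nat (Suc (\<beta> p - Suc k)) * x" for x :: 'k
        by (simp only: distrib_right)
      moreover have "\<forall>i. (f(p := k)) i \<le> \<beta> i"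
        "(\<lambda>i. \<beta> i - (f(p := k)) i) = (\<lambda>i. \<beta> i - f i)(p := \<beta> p - k)" using True 2 by auto
      moreover have "Suc (\<beta> p) - Suc k = \<beta> p - k" "Suc (\<beta> p - Suc k) = \<beta> p - k" using 2 by auto
      ultimately show ?thesis using 2
        by (simp add: b an_def shift_up_def fun_eq le del: of_nat_Suc fun_upd_apply)
    next
      case 3
      then have "\<forall>i. (f(p := \<beta> p)) i \<le> \<beta> i"
        "(\<lambda>i. \<beta> i - (f(p := \<beta> p)) i) = (\<lambda>i. \<beta> i - f i)(p := 0)" using True by auto
      then show ?thesis using 3
        by (simp add: b an_def shift_up_def fun_eq le del: fun_upd_apply) (simp add: algebra_simps)
    next
      case 4
      then have "(\<forall>i. (f(p := k)) i \<le> \<beta> i) = False" by (metis fun_upd_same not_le)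
      note simps = this
      show ?thesis using 4
        by (simp add: b an_def shift_up_def fun_eq le simps del: fun_upd_apply)
    qed (simp add: b an_def shift_up_def fun_eq le del: fun_upd_apply)
  next
    case False
    then have "(\<forall>i. f i \<le> (\<beta>(p := Suc (\<beta> p))) i) = False" "(\<forall>i. (f(p := f p - Suc 0)) i \<le> \<beta> i) = False"
      "(\<forall>i. f i \<le> \<beta> i) = False"
      by auto
    note simps = this
    show ?thesis by (simp add: b an_def shift_up_def simps del: fun_upd_apply)
  qed
qed

lemma cr_shift_up: "cr p * shift_up f = shift_up f * (cr p :: (fock, 'k::field) linop)" if "f p = 0"
proof (rule linop_eqI)
  fix v :: "fock \<Rightarrow> 'k" and b :: fock
  obtain \<beta> F where b: "b = (\<beta>, F)" by fastforce
  have "(\<forall>i. f i \<le> (\<beta>(p := \<beta> p - 1)) i) \<longleftrightarrow> (\<forall>i. f i \<le> \<beta> i)"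
    "(\<lambda>i. (\<beta>(p := \<beta> p - 1)) i - f i) = (\<lambda>i. \<beta> i - f i)(p := \<beta> p - 1)"
    using that by (auto, metis le0)
  then show "app (cr p * shift_up f) v b = app (shift_up f * cr p) v b"
    using that by (simp add: b cr_def shift_up_def del: fun_upd_apply)
qed

section \<open>Invariance of a Koszul-type differential, in an abstract ring\<close>

lemma commute_left: "x * y = y * x \<Longrightarrow> x * (y * z) = y * (x * (z :: 'r::semigroup_mult))"
  by (metis mult.assoc)

text \<open>Moving the differential through the three summands leaves error terms (facts
  \<open>A\<close>, \<open>B\<close>, \<open>C\<close>). The first leaves K_r \<delta>_i \<tau>
  \<iota>_r with the sign \<sigma>. The second leaves the same terms, the second commutators L_ip
  \<tau> \<iota>_p, and a double sum \<open>S\<close> that is zero by symmetry. The third leaves the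
  L_ir \<tau> \<iota>_r. With the signs of the three summands all of this cancels.\<close>

lemma koszul_operator_commute:
  fixes \<delta> \<iota> :: "nat \<Rightarrow> 'r::ring_1" and \<sigma> :: "nat \<Rightarrow> nat \<Rightarrow> 'r"
  assumes fin: "finite I" and i: "i \<in> I"
    and two: "\<And>z :: 'r. z + z = 0 \<Longrightarrow> z = 0"
    and \<sigma>: "\<And>r p. \<sigma> r p = 1 \<or> \<sigma> r p = - 1"
    and \<sigma>_sym: "\<And>r p. \<sigma> r p = \<sigma> p r"
    and \<delta>\<delta>: "\<And>r p. r \<in> I \<Longrightarrow> p \<in> I \<Longrightarrow> \<delta> r * \<delta> p = \<sigma> r p * (\<delta> p * \<delta> r)"
    and \<iota>\<iota>: "\<And>r p. r \<in> I \<Longrightarrow> p \<in> I \<Longrightarrow> \<iota> r * \<iota> p = - (\<sigma> r p * (\<iota> p * \<iota> r))"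
    and \<iota>\<delta>: "\<And>r p. r \<in> I \<Longrightarrow> p \<in> I \<Longrightarrow> \<iota> r * \<delta> p = \<delta> p * \<iota> r"
    and \<iota>M: "\<And>r. r \<in> I \<Longrightarrow> \<iota> r * M = M * \<iota> r"
    and e\<delta>: "\<And>p. p \<in> I \<Longrightarrow> e * \<delta> p = \<delta> p * e" and eM: "e * M = M * e"
    and \<tau>\<delta>: "\<And>p. p \<in> I \<Longrightarrow> \<tau> * \<delta> p = \<delta> p * \<tau>" and \<tau>M: "\<tau> * M = M * \<tau>"
    and \<iota>e: "\<And>r. r \<in> I \<Longrightarrow> \<iota> r * e = (if r = i then \<tau> else 0) - e * \<iota> r"
    and \<iota>\<tau>: "\<And>r. r \<in> I \<Longrightarrow> \<iota> r * \<tau> = \<sigma> r i * (\<tau> * \<iota> r)"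
    and K: "\<And>p. p \<in> I \<Longrightarrow> K p = \<delta> p * M - M * \<delta> p"
  shows "(\<Sum>r\<in>I. \<delta> r * \<iota> r) * (M * \<delta> i * \<tau> - (\<Sum>p\<in>I. K p * (e * \<iota> p)) + K i * \<tau>)
       = (M * \<delta> i * \<tau> - (\<Sum>p\<in>I. K p * (e * \<iota> p)) + K i * \<tau>) * (\<Sum>r\<in>I. \<delta> r * \<iota> r)"
proof -
  \<comment> \<open>The graded second commutator of \<open>M\<close> with two of the \<delta>'s;
    \<open>L_sym\<close> is the symmetry of mixed second derivatives.\<close>
  define L where "L r p = \<delta> r * K p - \<sigma> r p * (K p * \<delta> r)" for r p
  have \<delta>M: "\<delta> r * M = K r + M * \<delta> r" if "r \<in> I" for r using that by (simp add: K)
  have \<delta>K: "\<delta> r * K p = L r p + \<sigma> r p * (K p * \<delta> r)" for r p by (simp add: L_def)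
  have L_sym: "L r p = \<sigma> r p * L p r" if "r \<in> I" "p \<in> I" for r p
  proof -
    have "\<delta> r * (\<delta> p * M) = \<sigma> r p * (\<delta> p * (\<delta> r * M))"
      using arg_cong[OF \<delta>\<delta>[OF that], of "\<lambda>z. z * M"] by (simp only: mult.assoc)
    then show ?thesis
      using \<delta>\<delta>[OF that] \<sigma>[of r p] \<sigma>_sym[of p r] by (auto simp: L_def K[OF that(1)] K[OF that(2)] algebra_simps)
  qed
  have \<iota>K: "\<iota> r * K p = K p * \<iota> r" if "r \<in> I" "p \<in> I" for r p
    unfolding K[OF that(2)] by (simp add: algebra_simps \<iota>\<delta>[OF that] \<iota>M[OF that(1)] commute_left[OF \<iota>\<delta>[OF that]] commute_left[OF \<iota>M[OF that(1)]])
  let ?d = "\<Sum>r\<in>I. \<delta> r * \<iota> r"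
  have A: "?d * (M * \<delta> i * \<tau>) = (\<Sum>r\<in>I. \<sigma> r i * (K r * \<delta> i * \<tau> * \<iota> r)) + M * \<delta> i * \<tau> * ?d"
  proof -
    have "\<delta> r * \<iota> r * (M * \<delta> i * \<tau>) = \<sigma> r i * (K r * \<delta> i * \<tau> * \<iota> r) + M * \<delta> i * \<tau> * (\<delta> r * \<iota> r)"
      if r: "r \<in> I" for r
    proof -
      have "\<delta> r * \<iota> r * (M * \<delta> i * \<tau>) = \<delta> r * M * \<delta> i * (\<iota> r * \<tau>)"
        by (simp add: mult.assoc commute_left[OF \<iota>M[OF r]] commute_left[OF \<iota>\<delta>[OF r i]])
      also have "\<dots> = \<sigma> r i * (K r * \<delta> i * \<tau> * \<iota> r) + M * (\<delta> r * \<delta> i) * (\<sigma> r i * (\<tau> * \<iota> r))"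
        using \<sigma>[of r i] by (auto simp: \<delta>M[OF r] \<iota>\<tau>[OF r] algebra_simps)
      also have "M * (\<delta> r * \<delta> i) * (\<sigma> r i * (\<tau> * \<iota> r)) = M * \<delta> i * (\<delta> r * \<tau>) * \<iota> r"
        using \<sigma>[of r i] by (auto simp: \<delta>\<delta>[OF r i] mult.assoc)
      also have "\<dots> = M * \<delta> i * \<tau> * (\<delta> r * \<iota> r)"
        by (simp add: \<tau>\<delta>[OF r, symmetric] mult.assoc)
      finally show ?thesis .
    qed
    then show ?thesis by (simp add: sum_distrib_right sum_distrib_left sum.distrib)
  qed
  \<comment> \<open>\<open>L\<close> is symmetric and the product of two \<iota>'s antisymmetric up
    to the same sign \<sigma>, so exchanging the summation indices turns \<open>S\<close> into
    \<open>- S\<close>.\<close>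
  define S where "S = (\<Sum>r\<in>I. \<Sum>p\<in>I. \<sigma> r p * (L r p * (e * (\<iota> p * \<iota> r))))"
  have "S = (\<Sum>r\<in>I. \<Sum>p\<in>I. \<sigma> p r * (L p r * (e * (\<iota> r * \<iota> p))))"
    unfolding S_def by (rule sum.swap)
  also have "\<dots> = (\<Sum>r\<in>I. \<Sum>p\<in>I. - (\<sigma> r p * (L r p * (e * (\<iota> p * \<iota> r)))))"
  proof (intro sum.cong refl)
    fix r p assume "r \<in> I" "p \<in> I"
    then show "\<sigma> p r * (L p r * (e * (\<iota> r * \<iota> p))) = - (\<sigma> r p * (L r p * (e * (\<iota> p * \<iota> r))))"
      using L_sym[of r p] \<iota>\<iota>[of r p] \<sigma>[of r p] \<sigma>_sym[of p r] by auto
  qed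
  also have "\<dots> = - S" by (simp add: S_def sum_negf)
  finally have "S = 0" using two by (metis add.left_inverse)
  have B: "?d * (\<Sum>p\<in>I. K p * (e * \<iota> p)) = (\<Sum>p\<in>I. L i p * \<tau> * \<iota> p + \<sigma> i p * (K p * \<delta> i * \<tau> * \<iota> p))
      + (\<Sum>p\<in>I. K p * (e * \<iota> p)) * ?d"
  proof -
    have "\<delta> r * \<iota> r * (K p * (e * \<iota> p)) =
        (if r = i then L i p * \<tau> * \<iota> p + \<sigma> i p * (K p * \<delta> i * \<tau> * \<iota> p) else 0)
        + \<sigma> r p * (L r p * (e * (\<iota> p * \<iota> r))) + K p * (e * \<iota> p) * (\<delta> r * \<iota> r)"
      if r: "r \<in> I" and p: "p \<in> I" for r p
    proof -
      have "\<delta> r * \<iota> r * (K p * (e * \<iota> p)) = \<delta> r * K p * (\<iota> r * e * \<iota> p)"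
        by (simp add: mult.assoc commute_left[OF \<iota>K[OF r p]])
      also have "\<iota> r * e * \<iota> p = (if r = i then \<tau> * \<iota> p else 0) - e * (\<iota> r * \<iota> p)"
        by (simp add: \<iota>e[OF r] left_diff_distrib mult.assoc)
      also have "\<iota> r * \<iota> p = - (\<sigma> r p * (\<iota> p * \<iota> r))" by (rule \<iota>\<iota>[OF r p])
      also have "\<delta> r * K p * ((if r = i then \<tau> * \<iota> p else 0) - e * - (\<sigma> r p * (\<iota> p * \<iota> r)))
        = (if r = i then L i p * \<tau> * \<iota> p + \<sigma> i p * (K p * \<delta> i * \<tau> * \<iota> p) else 0)
        + \<sigma> r p * (L r p * (e * (\<iota> p * \<iota> r))) + K p * (\<delta> r * e) * (\<iota> p * \<iota> r)"
        using \<sigma>[of r p] by (auto simp: \<delta>K algebra_simps)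
      also have "K p * (\<delta> r * e) * (\<iota> p * \<iota> r) = K p * (e * \<iota> p) * (\<delta> r * \<iota> r)"
        by (simp add: mult.assoc commute_left[OF e\<delta>[OF r]] commute_left[OF \<iota>\<delta>[OF p r]])
      finally show ?thesis .
    qed
    then have "?d * (\<Sum>p\<in>I. K p * (e * \<iota> p)) = (\<Sum>r\<in>I. \<Sum>p\<in>I.
        (if r = i then L i p * \<tau> * \<iota> p + \<sigma> i p * (K p * \<delta> i * \<tau> * \<iota> p) else 0)
        + \<sigma> r p * (L r p * (e * (\<iota> p * \<iota> r))) + K p * (e * \<iota> p) * (\<delta> r * \<iota> r))"
      by (simp add: sum_product)
    also have "\<dots> = (\<Sum>r\<in>I. if r = i then (\<Sum>p\<in>I. L i p * \<tau> * \<iota> p + \<sigma> i p * (K p * \<delta> i * \<tau> * \<iota> p)) else 0)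
       + S + (\<Sum>r\<in>I. \<Sum>p\<in>I. K p * (e * \<iota> p) * (\<delta> r * \<iota> r))"
      unfolding S_def sum.distrib by (intro arg_cong2[of _ _ _ _ "(+)"] sum.cong refl) (auto simp: sum.distrib)
    also have "(\<Sum>r\<in>I. \<Sum>p\<in>I. K p * (e * \<iota> p) * (\<delta> r * \<iota> r)) = (\<Sum>p\<in>I. K p * (e * \<iota> p)) * ?d"
      by (subst sum.swap) (simp add: sum_product)
    finally show ?thesis using fin i \<open>S = 0\<close> by simp
  qed
  have C: "?d * (K i * \<tau>) = (\<Sum>r\<in>I. L i r * \<tau> * \<iota> r) + K i * \<tau> * ?d"
  proof -
    have "\<delta> r * \<iota> r * (K i * \<tau>) = L i r * \<tau> * \<iota> r + K i * \<tau> * (\<delta> r * \<iota> r)" if r: "r \<in> I" for r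
    proof -
      have "\<delta> r * \<iota> r * (K i * \<tau>) = \<delta> r * K i * (\<iota> r * \<tau>)" by (simp add: mult.assoc commute_left[OF \<iota>K[OF r i]])
      also have "\<dots> = \<sigma> r i * L r i * \<tau> * \<iota> r + K i * (\<delta> r * \<tau>) * \<iota> r"
        using \<sigma>[of r i] by (auto simp: \<delta>K \<iota>\<tau>[OF r] algebra_simps)
      also have "\<dots> = L i r * \<tau> * \<iota> r + K i * \<tau> * (\<delta> r * \<iota> r)"
        by (simp add: L_sym[OF i r] \<sigma>_sym[of r i] \<tau>\<delta>[OF r, symmetric] mult.assoc)
      finally show ?thesis .
    qed
    then show ?thesis by (simp add: sum_distrib_right sum_distrib_left sum.distrib)
  qed
  show ?thesis
    unfolding distrib_left distrib_right right_diff_distrib left_diff_distrib A B C sum.distrib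
    by (simp add: \<sigma>_sym)
qed

lemma anticommute_left: "x * y = - (y * x) \<Longrightarrow> x * (y * z) = - (y * (x * (z :: 'r::ring)))"
  by (simp flip: mult.assoc)

lemma linop_two: "z + z = 0 \<Longrightarrow> z = 0" for z :: "('b, 'k::field_char_0) linop"
proof (rule linop_eqI)
  fix v b assume "z + z = 0"
  then have "app (z + z) v b = 0" by simp
  then have "2 * app z v b = 0" by (simp only: app_simps mult_2)
  then show "app z v b = app 0 v b" by simp
qed

section \<open>The differential and its homotopy\<close>

locale witt = fixes m n :: nat
begin

text \<open>\<open>eps\<close>, \<open>yp\<close>, \<open>tau\<close> are the parities of the numbers of \<open>e\<^sup>*\<^sub>p\<close> with \<open>p < m\<close>, of \<open>y\<close>'s, and of \<open>e\<^sup>*\<^sub>p\<close> with \<open>p \<ge> m\<close>.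
  They are inserted so that operators on \<open>\<R>\<close> commute with operators on \<open>\<Omega>(V\<^sup>*)\<close>, and so that \<open>dl p\<close> has an
  ordinary (not super) commutator with multiplication by an element of \<open>\<R>\<close>.\<close>
definition eps :: "(fock, 'k::field) linop" where "eps = fpar {..<m}"
definition yp :: "(fock, 'k::field) linop" where "yp = fpar {m..<m+n}"
definition tau :: "(fock, 'k::field) linop" where "tau = bpar {m..<m+n}"

definition dl :: "nat \<Rightarrow> (fock, 'k::field) linop" where
  "dl p = (if p < m then an p else fan p * eps * yp)"
text \<open>For \<open>p \<ge> m\<close> the minus sign makes up for moving \<open>yp\<close> past
  \<open>fcr p\<close>, so that the relation \<open>dl_hp\<close> has the constant term +1 for every
  index.\<close>

definition hp :: "nat \<Rightarrow> (fock, 'k::field) linop" where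
  "hp p = (if p < m then cr p else - (fcr p * eps * yp))"
definition io :: "nat \<Rightarrow> (fock, 'k::field) linop" where
  "io p = (if p < m then fan p else an p * eps)"
definition ec :: "nat \<Rightarrow> (fock, 'k::field) linop" where
  "ec p = (if p < m then fcr p else cr p * eps)"
text \<open>Multiplication by y_s; the factor \<open>eps\<close> cancels the Jordan-Wigner sign
  caused by the fermions below \<open>m\<close>, which belong to \<Omega> and not to the ring. The
  same holds for the left derivative \<open>yd\<close>.\<close>

definition ym :: "nat \<Rightarrow> (fock, 'k::field) linop" where "ym s = fcr (m + s) * eps"
definition yd :: "nat \<Rightarrow> (fock, 'k::field) linop" where "yd s = fan (m + s) * eps"

definition diff :: "(fock, 'k::field) linop" where "diff = (\<Sum>p<m+n. dl p * io p)"
definition hom :: "(fock, 'k::field) linop" where "hom = (\<Sum>p<m+n. hp p * ec p)"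

text \<open>The super sign of two indices, as a scalar operator.\<close>

definition sig :: "nat \<Rightarrow> nat \<Rightarrow> (fock, 'k::field) linop" where
  "sig r p = (if m \<le> r \<and> m \<le> p then - 1 else 1)"

lemma par_square:
  "eps * eps = (1 :: (fock, 'k::field) linop)" "yp * yp = (1 :: (fock, 'k::field) linop)"
  "tau * tau = (1 :: (fock, 'k::field) linop)"
  by (simp_all add: eps_def yp_def tau_def fpar_square bpar_square)

lemma par_par:
  "yp * eps = eps * (yp :: (fock, 'k::field) linop)" "tau * eps = eps * (tau :: (fock, 'k::field) linop)"
  "tau * yp = yp * (tau :: (fock, 'k::field) linop)"
  by (simp_all add: eps_def yp_def tau_def fpar_fpar bpar_fermion)

lemma eps_normal:
  "eps * an p = an p * (eps :: (fock, 'k::field) linop)" "eps * cr p = cr p * (eps :: (fock, 'k::field) linop)"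
  "m \<le> p \<Longrightarrow> eps * fan p = fan p * (eps :: (fock, 'k::field) linop)"
  "m \<le> p \<Longrightarrow> eps * fcr p = fcr p * (eps :: (fock, 'k::field) linop)"
  by (simp_all add: eps_def fpar_fan fpar_fcr fpar_boson)

lemma eps_anti:
  "p < m \<Longrightarrow> eps * fan p = - (fan p * (eps :: (fock, 'k::field) linop))"
  "p < m \<Longrightarrow> eps * fcr p = - (fcr p * (eps :: (fock, 'k::field) linop))"
  by (simp_all add: eps_def fpar_fan fpar_fcr fpar_boson)

lemma yp_normal:
  "yp * an p = an p * (yp :: (fock, 'k::field) linop)" "yp * cr p = cr p * (yp :: (fock, 'k::field) linop)"
  "p < m \<Longrightarrow> yp * fan p = fan p * (yp :: (fock, 'k::field) linop)"
  "p < m \<Longrightarrow> yp * fcr p = fcr p * (yp :: (fock, 'k::field) linop)"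
  by (simp_all add: yp_def fpar_fan fpar_fcr fpar_boson)

lemma yp_anti:
  "m \<le> p \<Longrightarrow> p < m + n \<Longrightarrow> yp * fan p = - (fan p * (yp :: (fock, 'k::field) linop))"
  "m \<le> p \<Longrightarrow> p < m + n \<Longrightarrow> yp * fcr p = - (fcr p * (yp :: (fock, 'k::field) linop))"
  by (simp_all add: yp_def fpar_fan fpar_fcr fpar_boson)

lemma tau_normal:
  "tau * fan p = fan p * (tau :: (fock, 'k::field) linop)" "tau * fcr p = fcr p * (tau :: (fock, 'k::field) linop)"
  "p < m \<Longrightarrow> tau * an p = an p * (tau :: (fock, 'k::field) linop)"
  "p < m \<Longrightarrow> tau * cr p = cr p * (tau :: (fock, 'k::field) linop)"
  by (simp_all add: tau_def bpar_an bpar_cr bpar_fermion)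

lemma tau_anti:
  "m \<le> p \<Longrightarrow> p < m + n \<Longrightarrow> tau * an p = - (an p * (tau :: (fock, 'k::field) linop))"
  "m \<le> p \<Longrightarrow> p < m + n \<Longrightarrow> tau * cr p = - (cr p * (tau :: (fock, 'k::field) linop))"
  by (simp_all add: tau_def bpar_an bpar_cr)

lemma par_cancel:
  "eps * (eps * z) = (z :: (fock, 'k::field) linop)" "yp * (yp * z) = (z :: (fock, 'k::field) linop)"
  "tau * (tau * z) = (z :: (fock, 'k::field) linop)"
  by (simp_all add: par_square flip: mult.assoc)

lemmas boson_left = boson_fermion[symmetric]

lemmas commuting = par_par eps_normal yp_normal tau_normal boson_left
lemmas anticommuting = eps_anti yp_anti tau_anti

text \<open>Rewriting to a normal form: bosons, then fermions, then \<open>eps\<close>,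
  \<open>yp\<close>, \<open>tau\<close>, with squares of parities cancelled. Reorderings within one
  kind are supplied separately, since they would loop.\<close>

lemmas normal = par_square par_cancel commuting commuting[THEN commute_left]
  anticommuting anticommuting[THEN anticommute_left] mult.assoc

lemma dl_dl: "r < m + n \<Longrightarrow> p < m + n \<Longrightarrow> dl r * dl p = sig r p * (dl p * (dl r :: (fock, 'k::field) linop))"
  by (cases "r < m"; cases "p < m") (simp_all add: dl_def sig_def normal an_an[of r p] fan_fan[of r p] commute_left[OF an_an[of r p]] anticommute_left[OF fan_fan[of r p]])

text \<open>A fermionic and a bosonic contraction anticommute because of the factor
  \<open>eps\<close>; between two bosonic ones the two factors \<open>eps\<close> cancel and leave
  commuting derivatives.\<close>

lemma io_io: "r < m + n \<Longrightarrow> p < m + n \<Longrightarrow> io r * io p = - (sig r p * (io p * (io r :: (fock, 'k::field) linop)))"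
  by (cases "r < m"; cases "p < m") (simp_all add: io_def sig_def normal an_an[of r p] fan_fan[of r p] commute_left[OF an_an[of r p]] anticommute_left[OF fan_fan[of r p]])

lemma io_dl: "r < m + n \<Longrightarrow> p < m + n \<Longrightarrow> io r * dl p = dl p * (io r :: (fock, 'k::field) linop)"
  by (cases "r < m"; cases "p < m") (simp_all add: io_def dl_def normal an_an[of r p] fan_fan[of r p] commute_left[OF an_an[of r p]] anticommute_left[OF fan_fan[of r p]])

lemma fan_fcr_ne: "p \<noteq> q \<Longrightarrow> fan p * fcr q = - (fcr q * (fan p :: (fock, 'k::field) linop))"
  by (simp add: fan_fcr)
lemma an_cr_ne: "p \<noteq> q \<Longrightarrow> an p * cr q = cr q * (an p :: (fock, 'k::field) linop)"
  by (simp add: an_cr)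

lemmas ne_normal = fan_fcr_ne an_cr_ne fan_fcr_ne[THEN anticommute_left] an_cr_ne[THEN commute_left]

lemma io_hp: "r < m + n \<Longrightarrow> p < m + n \<Longrightarrow> io r * hp p = hp p * (io r :: (fock, 'k::field) linop)"
  by (cases "r < m"; cases "p < m") (simp_all add: io_def hp_def normal ne_normal)

lemma ec_dl: "r < m + n \<Longrightarrow> p < m + n \<Longrightarrow> ec r * dl p = dl p * (ec r :: (fock, 'k::field) linop)"
  by (cases "r < m"; cases "p < m") (simp_all add: ec_def dl_def normal ne_normal)

lemma fan_fcr_left: "fan p * (fcr q * z) = (if p = q then z else 0) - fcr q * (fan p * (z :: (fock, 'k::field) linop))"
  by (simp add: fan_fcr left_diff_distrib flip: mult.assoc)
lemma an_cr_left: "an p * (cr q * z) = (if p = q then z else 0) + cr q * (an p * (z :: (fock, 'k::field) linop))"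
  by (simp add: an_cr distrib_right flip: mult.assoc)

lemma dl_hp: "r < m + n \<Longrightarrow> p < m + n \<Longrightarrow>
    dl r * hp p = (if r = p then 1 else 0) + sig r p * (hp p * (dl r :: (fock, 'k::field) linop))"
  by (cases "r < m"; cases "p < m")
    (auto simp: hp_def dl_def sig_def normal fan_fcr an_cr fan_fcr_left an_cr_left)

lemma io_ec: "r < m + n \<Longrightarrow> p < m + n \<Longrightarrow>
    io r * ec p = (if r = p then 1 else 0) - sig r p * (ec p * (io r :: (fock, 'k::field) linop))"
  by (cases "r < m"; cases "p < m")
    (auto simp: io_def ec_def sig_def normal fan_fcr an_cr fan_fcr_left an_cr_left)

text \<open>The \<open>dl\<close> commute and the \<open>io\<close> anticommute up to the same sign
  \<open>sig\<close>, so the double sum for the square equals its own negative.\<close>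

lemma diff_diff: "diff * diff = (0 :: (fock, 'k::field_char_0) linop)"
proof (rule linop_two)
  define S :: "(fock, 'k) linop" where "S = (\<Sum>r<m+n. \<Sum>p<m+n. dl r * dl p * (io r * io p))"
  have "diff * diff = (\<Sum>r<m+n. \<Sum>p<m+n. dl r * io r * (dl p * (io p :: (fock, 'k) linop)))"
    by (simp add: diff_def sum_product)
  also have "\<dots> = S" unfolding S_def
    by (intro sum.cong refl) (simp add: mult.assoc commute_left[OF io_dl])
  finally have S: "diff * diff = S" .
  have "S = (\<Sum>r<m+n. \<Sum>p<m+n. dl p * dl r * (io p * io r))"
    unfolding S_def by (rule sum.swap)
  also have "\<dots> = (\<Sum>r<m+n. \<Sum>p<m+n. - (dl r * dl p * (io r * io p)))"
  proof (intro sum.cong refl)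
    fix r p assume "r \<in> {..<m+n}" "p \<in> {..<m+n}"
    then show "dl p * dl r * (io p * io r) = - (dl r * dl p * (io r * (io p :: (fock, 'k) linop)))"
      using dl_dl[of p r, where 'k='k] io_io[of p r, where 'k='k] by (auto simp: sig_def split: if_splits)
  qed
  also have "\<dots> = - S" by (simp add: S_def sum_negf)
  finally show "diff * diff + diff * diff = (0 :: (fock, 'k) linop)" unfolding S by (simp add: eq_neg_iff_add_eq_0)
qed

definition numop :: "(fock, 'k::field) linop" where
  "numop = pull (\<lambda>(\<beta>, F). \<Sum>p<m+n. of_nat (\<beta> p) + (if p \<in> F then 0 else 1)) (\<lambda>\<phi>. \<phi>)"

text \<open>By \<open>io_hp\<close> and \<open>ec_dl\<close> the products regroup so that all terms
  with \<open>r \<noteq> p\<close> cancel. On the diagonal, an index \<open>r < m\<close>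
  contributes 1 for a missing fermion plus the boson number. An index \<open>r \<ge> m\<close>
  contributes the boson number plus 1 from \<open>io r * ec r\<close>, minus 1 if the fermion is
  present.\<close>

lemma homotopy: "diff * hom + hom * diff = (numop :: (fock, 'k::field) linop)"
proof -
  have eq: "dl r * io r * (hp p * ec p) + hp p * ec p * (dl r * io r) =
      (if r = p then io r * ec r + sig r r * (hp r * dl r) else (0 :: (fock, 'k) linop))"
    if "r < m + n" "p < m + n" for r p
  proof -
    have "dl r * io r * (hp p * ec p) = dl r * hp p * (io r * (ec p :: (fock, 'k) linop))"
      using that by (simp add: mult.assoc commute_left[OF io_hp])
    moreover have "hp p * ec p * (dl r * io r) = hp p * dl r * (ec p * (io r :: (fock, 'k) linop))"
      using that by (simp add: mult.assoc commute_left[OF ec_dl])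
    \<comment> \<open>The ring identity behind the cancellation; \<open>c\<close> stands for the
      Kronecker delta, \<open>s\<close> for the super sign, \<open>x\<close> for
      \<open>hp p * dl r\<close>, and \<open>z\<close>, \<open>y\<close> for the two orders of
      \<open>io r\<close> and \<open>ec p\<close>.\<close>
    moreover have "(c + s * x) * z + x * y = c * z + s * (x * c)" if "z = c - s * y" "s = 1 \<or> s = -1"
      for c s x y z :: "(fock, 'k) linop"
      using that by (auto simp: algebra_simps)
    note this[OF io_ec[OF that], of "hp p * dl r"]
    ultimately show ?thesis
      unfolding dl_hp[OF that, where 'k='k] by (auto simp: sig_def)
  qed
  have "diff * hom + hom * diff = (\<Sum>r<m+n. \<Sum>p<m+n. dl r * io r * (hp p * ec p) + hp p * ec p * (dl r * (io r :: (fock, 'k) linop)))"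
    unfolding diff_def hom_def sum_product sum.distrib by (subst (2) sum.swap) simp
  also have "\<dots> = (\<Sum>r<m+n. io r * ec r + sig r r * (hp r * (dl r :: (fock, 'k) linop)))"
    by (simp add: eq)
  also have "\<dots> = (\<Sum>r<m+n. pull (\<lambda>(\<beta>, F). of_nat (\<beta> r) + (if r \<in> F then 0 else 1)) (\<lambda>\<phi>. \<phi>))"
  proof (intro sum.cong refl)
    fix r assume "r \<in> {..<m+n}"
    then show "io r * ec r + sig r r * (hp r * dl r) =
        (pull (\<lambda>(\<beta>, F). of_nat (\<beta> r) + (if r \<in> F then 0 else 1)) (\<lambda>\<phi>. \<phi>) :: (fock, 'k) linop)"
    proof (cases "r < m")
      case True
      then show ?thesis
        by (intro linop_eqI) (auto simp: io_def ec_def hp_def dl_def sig_def an_def cr_def fan_def fcr_def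
            sgn_below_insert sgn_below_remove insert_absorb algebra_simps)
    next
      case False
      with \<open>r \<in> {..<m+n}\<close> show ?thesis
        by (simp add: io_def ec_def hp_def dl_def sig_def normal)
          (intro linop_eqI, auto simp: an_def cr_def fan_def fcr_def
            sgn_below_insert sgn_below_remove insert_absorb algebra_simps)
    qed
  qed
  also have "\<dots> = numop" by (rule linop_eqI) (auto simp: numop_def sum_distrib_right)
  finally show ?thesis .
qed

end

lemma sum_lessThan_add: "(\<Sum>p<m+n::nat. g p) = (\<Sum>p<m. g p) + (\<Sum>j<n. g (m + j) :: 'a::comm_monoid_add)"
  by (induction n) (simp_all add: add.assoc)

lemma of_int_left: "x * (of_int k * y) = of_int k * (x * (y :: 'r::ring_1))"
  by (metis mult.assoc mult_of_int_commute)

lemma minus_one_left: "x * ((-1) ^ k * y) = (-1) ^ k * (x * (y :: 'r::ring_1))"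
  by (cases "even k") simp_all

section \<open>Vector fields as operators commuting with the differential\<close>

context witt
begin

definition tau_at :: "nat \<Rightarrow> (fock, 'k::field) linop" where "tau_at i = (if i < m then 1 else tau)"

definition ywd :: "nat list \<Rightarrow> (fock, 'k::field) linop" where "ywd S = prod_list (map ym S)"

definition mul :: "rmon \<Rightarrow> (fock, 'k::field) linop" where "mul f = shift_up (fst f) * ywd (snd f)"

definition mon_ok :: "rmon \<Rightarrow> bool" where
  "mon_ok f \<longleftrightarrow> (\<forall>i\<ge>m. fst f i = 0) \<and> (\<forall>s\<in>set (snd f). s < n) \<and> distinct (snd f)"

text \<open>The operator of \<xi>(E_kl): replace a factor e*_k by e*_l with the sign of the super
  dual, and add the weight of the one-dimensional factor on the diagonal.\<close>

definition xio :: "nat \<Rightarrow> nat \<Rightarrow> (fock, 'k::field) linop" where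
  "xio k l = of_int (- ((-1) ^ ((ipar m k + ipar m l) * ipar m k))) * (ec l * io k)
     + (if k = l then if k < m then 1 else - 1 else 0)"

text \<open>The mixed-product formula with the sign given by the parity of \<open>g\<close>
  expressed through \<open>yp\<close>. This makes it a single operator, applied before the
  multiplication by a derivative of \<open>f\<close>.\<close>

definition witt_op :: "rmon \<Rightarrow> nat \<Rightarrow> (fock, 'k::field) linop" where
  "witt_op f i = mul f * (if i < m then an i else yd (i - m))
     + (\<Sum>j<m. of_int (fst (rdx j f)) * (mul (snd (rdx j f)) * ((if i < m then 1 else yp) * xio j i)))
     + (\<Sum>j<n. of_int ((-1) ^ (length (snd f) + 1) * fst (rdy j f)) * (mul (snd (rdy j f)) * ((if i < m then yp else 1) * xio (m + j) i)))"

text \<open>The commutator of \<open>dl p\<close> with \<open>mul f\<close>, as shown in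
  \<open>dl_mul\<close>; it is the operator K of the overview.\<close>

definition dmul :: "rmon \<Rightarrow> nat \<Rightarrow> (fock, 'k::field) linop" where
  "dmul f p = (if p < m then of_int (fst (rdx p f)) * mul (snd (rdx p f))
     else of_int ((-1) ^ length (snd f) * fst (rdy (p - m) f)) * (mul (snd (rdy (p - m) f)) * yp))"

lemma ym_commute:
  "s < n \<Longrightarrow> r < m + n \<Longrightarrow> io r * ym s = ym s * (io r :: (fock, 'k::field) linop)"
  "s < n \<Longrightarrow> r < m + n \<Longrightarrow> ec r * ym s = ym s * (ec r :: (fock, 'k::field) linop)"
  "tau * ym s = ym s * (tau :: (fock, 'k::field) linop)"
  "eps * ym s = ym s * (eps :: (fock, 'k::field) linop)"
  "an p * ym s = ym s * (an p :: (fock, 'k::field) linop)"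
  "cr p * ym s = ym s * (cr p :: (fock, 'k::field) linop)"
  by (auto simp: io_def ec_def ym_def normal ne_normal fcr_fcr[of "m + s"] fcr_fcr[of "m + s", THEN anticommute_left])

lemma yp_ym: "s < n \<Longrightarrow> yp * ym s = - (ym s * (yp :: (fock, 'k::field) linop))"
  by (simp add: ym_def normal)

lemma yd_ym: "yd j * ym s = (if j = s then 1 else 0) - ym s * (yd j :: (fock, 'k::field) linop)"
  by (simp add: yd_def ym_def normal fan_fcr fan_fcr_left)

lemma ywd_simps [simp]: "ywd [] = (1 :: (fock, 'k::field) linop)"
  "ywd (s # S) = ym s * (ywd S :: (fock, 'k::field) linop)"
  by (simp_all add: ywd_def)

lemma ywd_commute: "(\<And>s. s \<in> set S \<Longrightarrow> x * ym s = ym s * x) \<Longrightarrow> x * ywd S = ywd S * (x :: (fock, 'k::field) linop)"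
proof (induction S)
  case (Cons s S)
  then show ?case using commute_left[of x "ym s" "ywd S"] by (simp add: mult.assoc)
qed simp

lemma yp_ywd: "\<forall>s\<in>set S. s < n \<Longrightarrow> yp * ywd S = of_int ((-1) ^ length S) * (ywd S * (yp :: (fock, 'k::field) linop))"
  by (induction S) (simp_all add: mult.assoc anticommute_left[OF yp_ym] minus_one_left)

text \<open>The graded Leibniz rule along a word: each letter passed costs a minus sign, and meeting
  \<open>j\<close> deletes it. Distinctness ensures that no further \<open>j\<close> contributes.
  The exponents \<open>a\<close> only fill the argument of \<open>rdy\<close>.\<close>

lemma yd_ywd: "distinct S \<Longrightarrow> yd j * ywd S = of_int (fst (rdy j (a, S))) * ywd (remove1 j S)
    + of_int ((-1) ^ length S) * (ywd S * (yd j :: (fock, 'k::field) linop))"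
proof (induction S)
  case (Cons s S)
  have "yd j * (ym s * ywd S) = (if j = s then ywd S else 0) - ym s * (yd j * (ywd S :: (fock, 'k) linop))"
    by (simp add: yd_ym left_diff_distrib flip: mult.assoc)
  also have "ym s * (yd j * ywd S) = of_int (fst (rdy j (a, S))) * (ym s * ywd (remove1 j S))
    + of_int ((-1) ^ length S) * (ym s * (ywd S * (yd j :: (fock, 'k) linop)))"
    unfolding Cons.IH[OF distinct.simps(2)[THEN iffD1, THEN conjunct2, OF Cons.prems]] by (simp add: distrib_left of_int_left minus_one_left)
  finally have *: "yd j * ywd (s # S) = (if j = s then ywd S else 0) - (of_int (fst (rdy j (a, S))) * (ym s * ywd (remove1 j S))
    + of_int ((-1) ^ length S) * (ywd (s # S) * (yd j :: (fock, 'k) linop)))"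
    by (simp add: mult.assoc)
  show ?case
  proof (cases "j = s")
    case True
    with Cons.prems show ?thesis unfolding * by (simp add: rdy_def)
  next
    case False
    then have "fst (rdy j (a, s # S)) = - fst (rdy j (a, S))" "remove1 j (s # S) = s # remove1 j S"
      by (auto simp: rdy_def)
    with False show ?thesis unfolding * by simp
  qed
qed (simp add: rdy_def)

text \<open>A monomial has exponent zero at all indices from \<open>m\<close> on, where the bosons
  are e*'s, so the shift does not interfere with bosonic operators there. For the letters y the
  parities built into \<open>io\<close> and \<open>ec\<close> remove the signs.\<close>

lemma mul_commute:
  assumes "mon_ok f"
  shows "r < m + n \<Longrightarrow> io r * mul f = mul f * (io r :: (fock, 'k::field) linop)"
    "r < m + n \<Longrightarrow> ec r * mul f = mul f * (ec r :: (fock, 'k::field) linop)"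
    "tau * mul f = mul f * (tau :: (fock, 'k::field) linop)"
proof -
  have S: "\<And>s. s \<in> set (snd f) \<Longrightarrow> s < n" and f0: "m \<le> r \<Longrightarrow> fst f r = 0" using assms by (auto simp: mon_ok_def)
  have an: "an r * shift_up (fst f) = shift_up (fst f) * (an r :: (fock, 'k) linop)" if "m \<le> r"
    using f0[OF that] by (simp add: an_shift_up)
  have cr: "cr r * shift_up (fst f) = shift_up (fst f) * (cr r :: (fock, 'k) linop)" if "m \<le> r"
    using f0[OF that] by (simp add: cr_shift_up)
  have tau: "tau * shift_up (fst f) = shift_up (fst f) * (tau :: (fock, 'k) linop)"
  proof (rule linop_eqI)
    fix v :: "fock \<Rightarrow> 'k" and b :: fock
    obtain \<beta> F where b: "b = (\<beta>, F)" by fastforce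
    have "(\<Sum>p\<in>{m..<m+n}. \<beta> p - fst f p) = sum \<beta> {m..<m+n}"
      by (rule sum.cong) (use assms in \<open>auto simp: mon_ok_def\<close>)
    then show "app (tau * shift_up (fst f)) v b = app (shift_up (fst f) * tau) v b"
      by (simp add: b tau_def bpar_def shift_up_def)
  qed
  show "tau * mul f = mul f * (tau :: (fock, 'k) linop)"
    using ywd_commute[of "snd f" "tau :: (fock, 'k) linop", OF ym_commute(3)]
    by (simp add: mul_def commute_left[OF tau] mult.assoc)
  assume r: "r < m + n"
  have "io r * shift_up (fst f) = shift_up (fst f) * (io r :: (fock, 'k) linop)"
    using an by (auto simp: io_def shift_up_commute mult.assoc) (simp add: shift_up_commute(3)[symmetric] eps_def flip: mult.assoc)
  from commute_left[OF this] show "io r * mul f = mul f * (io r :: (fock, 'k) linop)"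
    using ywd_commute[of "snd f" "io r :: (fock, 'k) linop", OF ym_commute(1)[OF S r]]
    by (simp add: mul_def mult.assoc)
  have "ec r * shift_up (fst f) = shift_up (fst f) * (ec r :: (fock, 'k) linop)"
    using cr by (auto simp: ec_def shift_up_commute mult.assoc) (simp add: shift_up_commute(3)[symmetric] eps_def flip: mult.assoc)
  from commute_left[OF this] show "ec r * mul f = mul f * (ec r :: (fock, 'k) linop)"
    using ywd_commute[of "snd f" "ec r :: (fock, 'k) linop", OF ym_commute(2)[OF S r]]
    by (simp add: mul_def mult.assoc)
qed

text \<open>For odd \<open>p\<close>, passing \<open>yp\<close> through the word of y's gives a sign
  that cancels the one of the graded Leibniz rule, so an ordinary commutator remains.\<close>

lemma dl_mul:
  assumes "mon_ok f" "p < m + n"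
  shows "dl p * mul f = dmul f p + mul f * (dl p :: (fock, 'k::field) linop)"
proof (cases "p < m")
  case True
  have "an p * ywd (snd f) = ywd (snd f) * (an p :: (fock, 'k) linop)"
    by (rule ywd_commute) (simp add: ym_commute)
  moreover have "an p * mul f = an p * shift_up (fst f) * (ywd (snd f) :: (fock, 'k) linop)"
    by (simp add: mul_def mult.assoc)
  ultimately have "an p * mul f = of_nat (fst f p) * mul (snd (rdx p f)) + mul f * (an p :: (fock, 'k) linop)"
    by (simp add: mul_def rdx_def mult.assoc distrib_right an_shift_up)
  then show ?thesis using True by (simp add: dl_def dmul_def rdx_def)
next
  case False
  define j where "j = p - m"
  have dist: "distinct (snd f)" using assms by (simp add: mon_ok_def)
  have p: "p = m + j" using False by (simp add: j_def)
  have dlp: "dl p = yd j * (yp :: (fock, 'k) linop)" by (simp add: dl_def yd_def p)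
  have comm: "yp * shift_up (fst f) = shift_up (fst f) * (yp :: (fock, 'k) linop)"
    "yd j * shift_up (fst f) = shift_up (fst f) * (yd j :: (fock, 'k) linop)"
    by (simp_all add: yp_def yd_def eps_def shift_up_commute commute_left[OF shift_up_commute(1)] mult.assoc)
  have sq: "of_int ((-1) ^ length (snd f)) * (of_int ((-1) ^ length (snd f)) * z) = (z :: (fock, 'k) linop)" for z
    by (cases "even (length (snd f))") simp_all
  have "dl p * mul f = shift_up (fst f) * (yd j * (yp * ywd (snd f)) :: (fock, 'k) linop)"
    unfolding dlp mul_def by (simp add: mult.assoc commute_left[OF comm(1)] commute_left[OF comm(2)])
  also have "yp * ywd (snd f) = of_int ((-1) ^ length (snd f)) * (ywd (snd f) * (yp :: (fock, 'k) linop))"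
    using assms by (intro yp_ywd) (simp add: mon_ok_def)
  also have "yd j * (of_int ((-1) ^ length (snd f)) * (ywd (snd f) * (yp :: (fock, 'k) linop)))
     = of_int ((-1) ^ length (snd f)) * (yd j * ywd (snd f) * yp)"
    by (simp only: of_int_left mult.assoc)
  also have "\<dots> = of_int ((-1) ^ length (snd f) * fst (rdy j f)) * (ywd (remove1 j (snd f)) * yp)
      + ywd (snd f) * yd j * yp"
    unfolding yd_ywd[OF dist, of j "fst f"] distrib_left distrib_right of_int_mult mult.assoc sq by simp
  finally show ?thesis
    by (simp add: dlp[unfolded p] dmul_def mul_def p rdy_def distrib_left of_int_left[of "shift_up (fst f)"] mult.assoc
         del: of_int_mult of_int_power)
qed

text \<open>For odd \<open>i\<close> the operator of \<open>f D\<^sub>i\<close> is odd; composing it with the total parity \<open>yp * tau\<close>, which commutes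
  with \<open>diff\<close>, gives it the same shape as for even \<open>i\<close>.\<close>
lemma witt_op_normal_form:
  assumes "mon_ok f" and i: "i < m + n"
  shows "witt_op f i * (if i < m then 1 else yp * tau) =
    mul f * dl i * tau_at i - (\<Sum>p<m+n. dmul f p * (ec i * tau_at i * io p)) + dmul f i * (tau_at i :: (fock, 'k::field) linop)"
proof -
  define Q :: "(fock, 'k) linop" where "Q = (if i < m then 1 else yp * tau)"
  define T :: "nat \<Rightarrow> (fock, 'k) linop" where
    \<comment> \<open>The total contribution of the index \<open>p\<close> to the two correction
      sums of \<open>witt_op\<close>; \<open>A\<close> and \<open>B\<close> confirm it for even and
      for odd \<open>p\<close>.\<close>
    "T p = - (dmul f p * (ec i * tau_at i * io p)) + (if p = i then dmul f p * tau_at i else 0)" for p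
  have first: "mul f * (if i < m then an i else yd (i - m)) * Q = mul f * dl i * (tau_at i :: (fock, 'k) linop)"
    by (simp add: Q_def dl_def tau_at_def yd_def mult.assoc)
  have A: "of_int (fst (rdx j f)) * (mul (snd (rdx j f)) * ((if i < m then 1 else yp) * xio j i)) * Q = T j"
    if j: "j < m" for j
  proof (cases "i < m")
    case True
    then show ?thesis using j by (simp add: Q_def T_def dmul_def tau_at_def xio_def ipar_def algebra_simps)
  next
    case False
    have "yp * xio j i * Q = - (ec i * tau_at i * (io j :: (fock, 'k) linop))"
      using False j i by (simp add: Q_def xio_def ipar_def tau_at_def ec_def io_def normal)
    then have "mul (snd (rdx j f)) * (yp * xio j i) * Q = - (mul (snd (rdx j f)) * (ec i * tau_at i * (io j :: (fock, 'k) linop)))"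
      by (simp add: mult.assoc)
    then show ?thesis using False j by (simp add: T_def dmul_def mult.assoc)
  qed
  have B: "of_int ((-1) ^ (length (snd f) + 1) * fst (rdy j f)) * (mul (snd (rdy j f)) * ((if i < m then yp else 1) * xio (m + j) i)) * Q
      = T (m + j)" if j: "j < n" for j
  proof (cases "i < m")
    case True
    then show ?thesis using j by (simp add: Q_def T_def dmul_def tau_at_def xio_def ipar_def mult.assoc)
  next
    case False
    have "xio (m + j) i * Q = - (yp * (- (ec i * tau_at i * io (m + j)) + (if m + j = i then tau_at i else 0)))"
      using False j i by (auto simp: Q_def xio_def ipar_def tau_at_def ec_def io_def normal distrib_left distrib_right left_diff_distrib)
    then have "mul (snd (rdy j f)) * xio (m + j) i * Q = - (mul (snd (rdy j f)) * (yp * (- (ec i * tau_at i * io (m + j)) + (if m + j = i then tau_at i else 0))))"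
      by (simp add: mult.assoc)
    then show ?thesis using False j
      by (auto simp: T_def dmul_def mult.assoc distrib_left right_diff_distrib)
  qed
  have "witt_op f i * Q = mul f * dl i * tau_at i + (\<Sum>p<m+n. T p)"
    unfolding witt_op_def distrib_right sum_distrib_right first sum_lessThan_add add.assoc
    by (intro arg_cong2[of _ _ _ _ "(+)"] sum.cong refl) (simp_all only: A B lessThan_iff)
  also have "(\<Sum>p<m+n. T p) = - (\<Sum>p<m+n. dmul f p * (ec i * tau_at i * io p)) + dmul f i * tau_at i"
    using i by (simp add: T_def sum_subtractf)
  finally show ?thesis by (simp add: Q_def)
qed

text \<open>For \<open>p \<ge> m\<close> the differential removes one y and one odd e*, so the two
  parities change together; for \<open>p < m\<close> neither changes.\<close>

lemma diff_par: "diff * (yp * tau) = yp * tau * (diff :: (fock, 'k::field) linop)"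
proof -
  have "dl p * io p * (yp * tau) = yp * tau * (dl p * (io p :: (fock, 'k) linop))" if "p < m + n" for p
    using that by (cases "p < m") (simp_all add: dl_def io_def normal)
  then show ?thesis by (simp add: diff_def sum_distrib_left sum_distrib_right)
qed

lemma tau_at_commute:
  "p < m + n \<Longrightarrow> tau_at i * dl p = dl p * (tau_at i :: (fock, 'k::field) linop)"
  "r < m + n \<Longrightarrow> io r * tau_at i = sig r i * (tau_at i * (io r :: (fock, 'k::field) linop))"
  "mon_ok f \<Longrightarrow> tau_at i * mul f = mul f * (tau_at i :: (fock, 'k::field) linop)"
  by (auto simp: tau_at_def dl_def io_def sig_def normal mul_commute)

text \<open>The abstract invariance applies to \<open>witt_op f i * Q\<close>, after which the
  involution \<open>Q\<close> is cancelled. Attaching \<open>tau_at i\<close> to \<open>ec i\<close>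
  removes the super sign from \<open>io_ec\<close>, as the abstract lemma demands.\<close>

lemma diff_witt_op:
  assumes f: "mon_ok f" and i: "i < m + n"
  shows "diff * witt_op f i = witt_op f i * (diff :: (fock, 'k::field_char_0) linop)"
proof -
  define Q :: "(fock, 'k) linop" where "Q = (if i < m then 1 else yp * tau)"
  have Q: "Q * Q = 1" by (simp add: Q_def normal)
  have dQ: "diff * Q = Q * diff" by (simp add: Q_def diff_par)
  have comm: "diff * (witt_op f i * Q) = witt_op f i * Q * (diff :: (fock, 'k) linop)"
    unfolding Q_def witt_op_normal_form[OF assms] diff_def
  proof (rule koszul_operator_commute[where \<sigma> = sig and \<delta> = dl and \<iota> = io and M = "mul f"
      and \<tau> = "tau_at i" and e = "ec i * tau_at i" and K = "dmul f" and i = i and I = "{..<m+n}"])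
    show "io r * (ec i * tau_at i) = (if r = i then tau_at i else 0) - ec i * tau_at i * (io r :: (fock, 'k) linop)"
      if "r \<in> {..<m+n}" for r
    proof -
      have r: "r < m + n" using that by simp
      have "io r * (ec i * tau_at i) = (if r = i then tau_at i else 0) - sig r i * (ec i * (io r * (tau_at i :: (fock, 'k) linop)))"
        by (simp add: io_ec[OF r i] left_diff_distrib flip: mult.assoc)
      then show ?thesis by (simp add: tau_at_commute(2)[OF r] sig_def mult.assoc)
    qed
    show "ec i * tau_at i * dl p = dl p * (ec i * (tau_at i :: (fock, 'k) linop))" if "p \<in> {..<m+n}" for p
      using that by (simp add: mult.assoc tau_at_commute commute_left[OF ec_dl[OF i]])
    show "ec i * tau_at i * mul f = mul f * (ec i * (tau_at i :: (fock, 'k) linop))"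
      by (simp add: mult.assoc tau_at_commute f commute_left[OF mul_commute(2)[OF f i]])
    show "z = 0" if "z + z = 0" for z :: "(fock, 'k) linop" using that by (rule linop_two)
    show "dl r * dl p = sig r p * (dl p * (dl r :: (fock, 'k) linop))" if "r \<in> {..<m+n}" "p \<in> {..<m+n}" for r p
      using that by (intro dl_dl) simp_all
    show "io r * io p = - (sig r p * (io p * (io r :: (fock, 'k) linop)))" if "r \<in> {..<m+n}" "p \<in> {..<m+n}" for r p
      using that by (intro io_io) simp_all
    show "dmul f p = dl p * mul f - mul f * (dl p :: (fock, 'k) linop)" if "p \<in> {..<m+n}" for p
      using that by (simp add: dl_mul[OF f])
    show "io r * dl p = dl p * (io r :: (fock, 'k) linop)" if "r \<in> {..<m+n}" "p \<in> {..<m+n}" for r p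
      using that by (simp add: io_dl)
    show "io r * mul f = mul f * (io r :: (fock, 'k) linop)" if "r \<in> {..<m+n}" for r
      using that by (simp add: mul_commute f)
    show "io r * tau_at i = sig r i * (tau_at i * (io r :: (fock, 'k) linop))" if "r \<in> {..<m+n}" for r
      using that by (simp add: tau_at_commute)
    show "tau_at i * dl p = dl p * (tau_at i :: (fock, 'k) linop)" if "p \<in> {..<m+n}" for p
      using that by (simp add: tau_at_commute(1))
    show "tau_at i * mul f = mul f * (tau_at i :: (fock, 'k) linop)" by (rule tau_at_commute(3)[OF f])
    show "sig r p = (sig p r :: (fock, 'k) linop)" for r p by (auto simp: sig_def)
    show "sig r p = (1 :: (fock, 'k) linop) \<or> sig r p = (- 1 :: (fock, 'k) linop)" for r p by (simp add: sig_def)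
  qed (use i in simp_all)
  have "diff * witt_op f i = diff * (witt_op f i * Q) * Q" by (simp add: mult.assoc Q)
  also have "\<dots> = witt_op f i * (Q * Q) * diff" unfolding comm by (simp add: mult.assoc dQ)
  finally show ?thesis by (simp add: Q)
qed

end

lemma app_neg_one_power [simp]: "app ((-1) ^ k) v b = (-1) ^ k * v b"
  by (cases "even k") simp_all

section \<open>Basis states\<close>

definition ket :: "'b \<Rightarrow> 'b \<Rightarrow> 'k::field" where "ket \<phi> = (\<lambda>\<psi>. if \<psi> = \<phi> then 1 else 0)"

text \<open>On basis states the pullback becomes the usual derivative. Without a boson at
  \<open>p\<close> the truncated subtraction is harmless, because the coefficient is zero.\<close>

lemma an_ket: "app (an p) (ket (\<beta>, F)) = (\<lambda>\<psi>. of_nat (\<beta> p) * ket (\<beta>(p := \<beta> p - 1), F) \<psi> :: 'k::field)"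
proof
  fix \<psi> :: fock
  obtain \<gamma> G where \<psi>: "\<psi> = (\<gamma>, G)" by fastforce
  have "\<gamma>(p := Suc (\<gamma> p)) = \<beta> \<longleftrightarrow> \<beta> p \<noteq> 0 \<and> \<gamma> = \<beta>(p := \<beta> p - 1)"
    by (auto simp: fun_eq_iff)
  then show "app (an p) (ket (\<beta>, F)) \<psi> = (of_nat (\<beta> p) * ket (\<beta>(p := \<beta> p - 1), F) \<psi> :: 'k)"
    by (auto simp: \<psi> an_def ket_def)
qed

lemma cr_ket: "app (cr p) (ket (\<beta>, F)) = (ket (\<beta>(p := Suc (\<beta> p)), F) :: fock \<Rightarrow> 'k::field)"
proof
  fix \<psi> :: fock
  obtain \<gamma> G where \<psi>: "\<psi> = (\<gamma>, G)" by fastforce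
  have "\<gamma> p \<noteq> 0 \<and> \<gamma>(p := \<gamma> p - 1) = \<beta> \<longleftrightarrow> \<gamma> = \<beta>(p := Suc (\<beta> p))"
    by (auto simp: fun_eq_iff)
  then show "app (cr p) (ket (\<beta>, F)) \<psi> = (ket (\<beta>(p := Suc (\<beta> p)), F) \<psi> :: 'k)"
    by (auto simp: \<psi> cr_def ket_def)
qed

lemma shift_up_ket: "app (shift_up f) (ket (\<beta>, F)) = (ket (\<lambda>i. f i + \<beta> i, F) :: fock \<Rightarrow> 'k::field)"
proof
  fix \<psi> :: fock
  obtain \<gamma> G where \<psi>: "\<psi> = (\<gamma>, G)" by fastforce
  have "(\<forall>i. f i \<le> \<gamma> i) \<and> (\<lambda>i. \<gamma> i - f i) = \<beta> \<longleftrightarrow> \<gamma> = (\<lambda>i. f i + \<beta> i)"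
    by (auto simp: fun_eq_iff) (metis le_add_diff_inverse)
  then show "app (shift_up f) (ket (\<beta>, F)) \<psi> = (ket (\<lambda>i. f i + \<beta> i, F) \<psi> :: 'k)"
    by (auto simp: \<psi> shift_up_def ket_def)
qed

lemma fan_ket: "app (fan p) (ket (\<beta>, F)) = (\<lambda>\<psi>. (if p \<in> F then sgn_below p F else 0) * ket (\<beta>, F - {p}) \<psi> :: 'k::field)"
proof
  fix \<psi> :: fock
  obtain \<gamma> G where \<psi>: "\<psi> = (\<gamma>, G)" by fastforce
  have "p \<notin> G \<and> insert p G = F \<longleftrightarrow> p \<in> F \<and> G = F - {p}" by auto
  then show "app (fan p) (ket (\<beta>, F)) \<psi> = ((if p \<in> F then sgn_below p F else 0) * ket (\<beta>, F - {p}) \<psi> :: 'k)"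
    by (auto simp: \<psi> fan_def ket_def sgn_below_remove)
qed

lemma fcr_ket: "app (fcr p) (ket (\<beta>, F)) = (\<lambda>\<psi>. (if p \<in> F then 0 else sgn_below p F) * ket (\<beta>, insert p F) \<psi> :: 'k::field)"
proof
  fix \<psi> :: fock
  obtain \<gamma> G where \<psi>: "\<psi> = (\<gamma>, G)" by fastforce
  have "p \<in> G \<and> G - {p} = F \<longleftrightarrow> p \<notin> F \<and> G = insert p F" by auto
  then show "app (fcr p) (ket (\<beta>, F)) \<psi> = ((if p \<in> F then 0 else sgn_below p F) * ket (\<beta>, insert p F) \<psi> :: 'k)"
    by (auto simp: \<psi> fcr_def ket_def sgn_below_insert)
qed

lemma fpar_ket: "app (fpar J) (ket (\<beta>, F)) = (\<lambda>\<psi>. (-1) ^ card (F \<inter> J) * ket (\<beta>, F) \<psi> :: 'k::field)"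
  by (auto simp: fpar_def ket_def fun_eq_iff)

lemma bpar_ket: "app (bpar J) (ket (\<beta>, F)) = (\<lambda>\<psi>. (-1) ^ (\<Sum>p\<in>J. \<beta> p) * ket (\<beta>, F) \<psi> :: 'k::field)"
  by (rule ext) (auto simp: bpar_def ket_def)

section \<open>Signs of sorting words\<close>

lemma finite_inv_pairs: "finite (inv_pairs w)"
  by (rule finite_subset[of _ "{..<length w} \<times> {..<length w}"]) (auto simp: inv_pairs_def)

lemma inv_pairs_Cons:
  "inv_pairs (p # w) = (\<lambda>s. (0, Suc s)) ` {s. s < length w \<and> w ! s < p} \<union> map_prod Suc Suc ` inv_pairs w"
proof (intro set_eqI iffI)
  fix x assume "x \<in> inv_pairs (p # w)"
  then obtain r s where x: "x = (r, s)" "r < s" "s < Suc (length w)" "(p # w) ! s < (p # w) ! r"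
    by (auto simp: inv_pairs_def)
  then obtain s' where s: "s = Suc s'" using not0_implies_Suc by (metis less_nat_zero_code)
  show "x \<in> (\<lambda>s. (0, Suc s)) ` {s. s < length w \<and> w ! s < p} \<union> map_prod Suc Suc ` inv_pairs w"
  proof (cases r)
    case 0
    then show ?thesis using x s by auto
  next
    case (Suc r')
    then have "(r', s') \<in> inv_pairs w" using x s by (auto simp: inv_pairs_def)
    then show ?thesis using x s Suc by force
  qed
qed (auto simp: inv_pairs_def)

text \<open>The sign of moving \<open>e\<^sup>*\<^sub>p\<close> from the front of \<open>e\<^sup>*\<^sub>p w\<close> to its place in the sorted word.\<close>
definition front_sign :: "nat \<Rightarrow> nat \<Rightarrow> nat list \<Rightarrow> int" where
  "front_sign m p w = (if p < m \<and> p \<in> set w then 0 else (-1) ^ length (filter (\<lambda>b. b < (if p < m then p else m)) w))"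

text \<open>The first letter forms an inversion with every smaller letter, and an inversion of two
  odd letters costs nothing. Hence an even letter counts the letters below it, an odd letter counts
  the even ones.\<close>

lemma osign_Cons: "osign m (p # w) = front_sign m p w * osign m w"
proof (cases "distinct (filter (\<lambda>p. p < m) (p # w))")
  case False
  then show ?thesis by (auto simp: osign_def front_sign_def split: if_splits)
next
  case True
  let ?g = "\<lambda>w (r, s). if m \<le> w ! r \<and> m \<le> w ! s then 1 else -1 :: int"
  let ?A = "{s. s < length w \<and> w ! s < p}"
  have "prod (?g (p # w)) (inv_pairs (p # w)) = prod (?g (p # w)) ((\<lambda>s. (0, Suc s)) ` ?A) * prod (?g (p # w)) (map_prod Suc Suc ` inv_pairs w)"
    unfolding inv_pairs_Cons by (intro prod.union_disjoint) (auto simp: finite_inv_pairs)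
  also have "prod (?g (p # w)) (map_prod Suc Suc ` inv_pairs w) = prod (?g w) (inv_pairs w)"
    by (subst prod.reindex) (auto simp: inj_on_def intro!: prod.cong)
  also have "prod (?g (p # w)) ((\<lambda>s. (0, Suc s)) ` ?A) = (\<Prod>s\<in>?A. if m \<le> p \<and> m \<le> w ! s then 1 else -1)"
    by (subst prod.reindex) (auto simp: inj_on_def intro!: prod.cong)
  also have "\<dots> = (-1) ^ card {s. s < length w \<and> w ! s < (if p < m then p else m)}"
  proof -
    have "{s \<in> ?A. \<not> (m \<le> p \<and> m \<le> w ! s)} = {s. s < length w \<and> w ! s < (if p < m then p else m)}" by auto
    then show ?thesis by (subst prod.If_cases) (auto simp: Int_def)
  qed
  also have "card {s. s < length w \<and> w ! s < (if p < m then p else m)} = length (filter (\<lambda>b. b < (if p < m then p else m)) w)"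
    by (simp add: length_filter_conv_card)
  finally show ?thesis using True by (auto simp: osign_def front_sign_def split: if_splits)
qed

text \<open>If all letters count as even, the super-Grassmann sign is the sign of an exterior
  product, so the recursion for \<open>osign\<close> carries over to \<open>ysign\<close>.\<close>

lemma ysign_osign: "\<forall>s\<in>set S. s < M \<Longrightarrow> ysign S = osign M S"
proof -
  assume *: "\<forall>s\<in>set S. s < M"
  then have "filter (\<lambda>p. p < M) S = S" by simp
  moreover have "(\<Prod>(r, s)\<in>inv_pairs S. if M \<le> S ! r \<and> M \<le> S ! s then 1 else - 1) = (\<Prod>_\<in>inv_pairs S. -1 :: int)"
    using * by (intro prod.cong) (auto simp: inv_pairs_def not_le[symmetric])
  ultimately show ?thesis by (simp add: ysign_def osign_def)
qed

lemma ysign_Cons: "ysign (s # S) = (if s \<in> set S then 0 else (-1) ^ length (filter (\<lambda>b. b < s) S)) * ysign S"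
proof -
  obtain M where "\<forall>t\<in>set (s # S). t < M" by (metis List.finite_set bounded_nat_set_is_finite finite_nat_set_iff_bounded)
  then show ?thesis using ysign_osign[of "s # S" M] ysign_osign[of S M] by (auto simp: osign_Cons front_sign_def)
qed

lemma sorted_inv_pairs: "sorted w \<Longrightarrow> inv_pairs w = {}"
  by (auto simp: inv_pairs_def sorted_iff_nth_mono_less) (meson dual_order.strict_trans leD)

lemma osign_sorted: "sorted w \<Longrightarrow> distinct (filter (\<lambda>p. p < m) w) \<Longrightarrow> osign m w = 1"
  by (simp add: osign_def sorted_inv_pairs)

lemma ysign_sorted: "sorted_wrt (<) S \<Longrightarrow> ysign S = 1"
  by (simp add: ysign_def sorted_inv_pairs strict_sorted_iff)

section \<open>Monomials as Fock states\<close>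

context witt
begin

text \<open>The order of letters is forgotten, so the unsorted words that arise from putting a
  letter in front have a code too; the signs of sorting are carried separately by
  \<open>osign\<close> and \<open>ysign\<close>.\<close>

definition enc :: "vbas \<Rightarrow> fock" where
  "enc b = (\<lambda>p. if p < m then fst (fst b) p else count_list (snd b) p,
     {p \<in> set (snd b). p < m} \<union> (+) m ` set (snd (fst b)))"

abbreviation kb :: "vbas \<Rightarrow> fock \<Rightarrow> 'k::field" where "kb b \<equiv> ket (enc b)"

lemma enc_sort: "enc ((a, sort S), w) = enc ((a, S), w)" "enc (g, sort w) = enc (g, w)"
proof -
  have "count_list (sort w) p = count_list w p" for p by (metis count_mset mset_sort)
  then show "enc (g, sort w) = enc (g, w)" by (simp add: enc_def cong: if_cong)
qed (simp add: enc_def cong: if_cong)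

lemma enc_below: "snd (enc (g, w)) \<inter> {..<m} = {p \<in> set w. p < m}"
  by (auto simp: enc_def)

text \<open>For \<open>p < m\<close> the Jordan-Wigner sign counts the letters of \<open>w\<close>
  below \<open>p\<close>; for \<open>p \<ge> m\<close> the factor \<open>eps\<close> counts all even
  letters. In both cases this is \<open>front_sign\<close>.\<close>

lemma ec_kb:
  assumes "distinct (filter (\<lambda>p. p < m) w)"
  shows "app (ec p) (kb (g, w)) = (\<lambda>\<psi>. of_int (front_sign m p w) * kb (g, p # w) \<psi> :: 'k::field)"
proof (cases "p < m")
  case True
  have "snd (enc (g, w)) \<inter> {..<p} = set (filter (\<lambda>b. b < p) w)" using True by (auto simp: enc_def)
  moreover have "filter (\<lambda>b. b < p) w = filter (\<lambda>b. b < p) (filter (\<lambda>b. b < m) w)"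
    using True by (auto intro: filter_cong)
  then have "distinct (filter (\<lambda>b. b < p) w)" by (metis assms distinct_filter)
  ultimately have "sgn_below p (snd (enc (g, w))) = ((-1) ^ length (filter (\<lambda>b. b < p) w) :: 'k)"
    using distinct_card[of "filter (\<lambda>b. b < p) w"] by (simp add: sgn_below_def)
  moreover have "p \<in> snd (enc (g, w)) \<longleftrightarrow> p \<in> set w" using True by (auto simp: enc_def)
  moreover have "enc (g, p # w) = (fst (enc (g, w)), insert p (snd (enc (g, w))))"
    using True by (auto simp: enc_def fun_eq_iff)
  ultimately show ?thesis
    using fcr_ket[of p "fst (enc (g, w))" "snd (enc (g, w))", where 'k='k] True by (simp add: ec_def front_sign_def)
next
  case False
  have "card (snd (enc (g, w)) \<inter> {..<m}) = length (filter (\<lambda>b. b < m) w)"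
    using distinct_card[OF assms] by (simp add: enc_below)
  moreover have "enc (g, p # w) = ((fst (enc (g, w))) (p := Suc (fst (enc (g, w)) p)), snd (enc (g, w)))"
    using False by (auto simp: enc_def fun_eq_iff)
  ultimately show ?thesis using False
    fpar_ket[of "{..<m}" "fst (enc (g, w))" "snd (enc (g, w))", where 'k='k]
    cr_ket[of p "fst (enc (g, w))" "snd (enc (g, w))", where 'k='k]
    by (simp add: ec_def front_sign_def eps_def app_scale)
qed

definition ewd :: "nat list \<Rightarrow> (fock, 'k::field) linop" where "ewd w = prod_list (map ec w)"

lemma ewd_simps [simp]: "ewd [] = (1 :: (fock, 'k::field) linop)"
  "ewd (p # w) = ec p * (ewd w :: (fock, 'k::field) linop)"
  by (simp_all add: ewd_def)

text \<open>Creating the letters one after another from the state without e*'s produces exactly the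
  sign of sorting, which ties the combinatorial \<open>osign\<close> to the commutation
  relations.\<close>

lemma ewd_kb: "app (ewd w) (kb (g, [])) = (\<lambda>\<psi>. of_int (osign m w) * kb (g, w) \<psi> :: 'k::field)"
proof (induction w)
  case (Cons p w)
  show ?case
  proof (cases "distinct (filter (\<lambda>p. p < m) w)")
    case True
    then show ?thesis by (simp add: Cons app_scale ec_kb osign_Cons mult.commute mult.left_commute)
  next
    case False
    then show ?thesis by (simp add: Cons osign_def app_zero)
  qed
qed (simp add: osign_def inv_pairs_def)

lemma ym_kb:
  assumes "distinct S"
  shows "app (ym s) (kb ((a, S), w)) = (\<lambda>\<psi>. of_int (if s \<in> set S then 0 else (-1) ^ length (filter (\<lambda>b. b < s) S)) * kb ((a, s # S), w) \<psi> :: 'k::field)"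
proof -
  let ?F = "snd (enc ((a, S), w))" and ?\<beta> = "fst (enc ((a, S), w))"
  have "?F \<inter> {..<m+s} = {p \<in> set w. p < m} \<union> (+) m ` set (filter (\<lambda>b. b < s) S)" by (auto simp: enc_def)
  then have "card (?F \<inter> {..<m+s}) = card {p \<in> set w. p < m} + card ((+) m ` set (filter (\<lambda>b. b < s) S))"
    by (simp only:) (intro card_Un_disjoint; auto)
  also have "card ((+) m ` set (filter (\<lambda>b. b < s) S)) = length (filter (\<lambda>b. b < s) S)"
    using distinct_card[of "filter (\<lambda>b. b < s) S"] assms by (simp add: card_image)
  finally have sgn: "(-1) ^ card (?F \<inter> {..<m}) * (sgn_below (m + s) ?F * x) = (-1) ^ length (filter (\<lambda>b. b < s) S) * x" for x :: 'k
    by (simp add: sgn_below_def enc_below power_add flip: mult.assoc)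
  have "m + s \<in> ?F \<longleftrightarrow> s \<in> set S" by (auto simp: enc_def)
  moreover have "enc ((a, s # S), w) = (?\<beta>, insert (m + s) ?F)" by (auto simp: enc_def)
  ultimately show ?thesis
    using fcr_ket[of "m + s" ?\<beta> ?F, where 'k='k] fpar_ket[of "{..<m}" ?\<beta> ?F, where 'k='k]
    by (simp add: ym_def eps_def app_scale sgn)
qed

lemma ywd_kb: "app (ywd S) (kb ((a, []), w)) = (\<lambda>\<psi>. of_int (ysign S) * kb ((a, S), w) \<psi> :: 'k::field)"
proof (induction S)
  case (Cons s S)
  show ?case
  proof (cases "distinct S")
    case True
    show ?thesis by (simp add: Cons app_scale ym_kb[OF True] ysign_Cons mult.commute mult.left_commute)
  next
    case False
    then show ?thesis by (simp add: Cons ysign_def app_zero)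
  qed
qed (simp add: ysign_def inv_pairs_def)

lemma ywd_append: "ywd (S @ T) = ywd S * (ywd T :: (fock, 'k::field) linop)"
  by (simp add: ywd_def)

text \<open>The y's of \<open>g\<close> are first created from a state without y's, so
  multiplication by \<open>f\<close> concatenates two words and its sign is the \<open>ysign\<close>
  of the concatenation.\<close>

lemma mul_kb:
  assumes "valid_rmon m n f" "valid_rmon m n g"
  shows "app (mul f) (kb (g, w)) = (\<lambda>\<psi>. of_int (fst (rmul f g)) * kb (snd (rmul f g), w) \<psi> :: 'k::field)"
proof -
  obtain a T where g: "g = (a, T)" by fastforce
  obtain c S where f: "f = (c, S)" by fastforce
  have "ysign T = 1" using assms(2) by (intro ysign_sorted) (simp add: valid_rmon_def g)
  then have kb: "kb (g, w) = app (ywd T) (kb ((a, []), w) :: fock \<Rightarrow> 'k)"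
    by (simp add: ywd_kb g)
  have "app (mul f) (kb (g, w)) = app (shift_up c) (app (ywd (S @ T)) (kb ((a, []), w) :: fock \<Rightarrow> 'k))"
    unfolding kb by (simp add: mul_def f ywd_append)
  also have "\<dots> = (\<lambda>\<psi>. of_int (ysign (S @ T)) * app (shift_up c) (kb ((a, S @ T), w)) \<psi>)"
    by (simp add: ywd_kb app_scale)
  also have "app (shift_up c) (kb ((a, S @ T), w) :: fock \<Rightarrow> 'k) = kb ((\<lambda>i. c i + a i, S @ T), w)"
  proof -
    have "enc ((\<lambda>i. c i + a i, S @ T), w) = (\<lambda>i. c i + fst (enc ((a, S @ T), w)) i, snd (enc ((a, S @ T), w)))"
      using assms(1) by (auto simp: enc_def f valid_rmon_def fun_eq_iff)
    then show ?thesis using shift_up_ket[of c "fst (enc ((a, S @ T), w))" "snd (enc ((a, S @ T), w))", where 'k='k] by simp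
  qed
  finally show ?thesis by (simp add: rmul_def f g enc_sort)
qed

lemma an_kb: "i < m \<Longrightarrow> app (an i) (kb (g, w)) = (\<lambda>\<psi>. of_int (fst (rdx i g)) * kb (snd (rdx i g), w) \<psi> :: 'k::field)"
proof -
  assume i: "i < m"
  then have "enc (snd (rdx i g), w) = ((fst (enc (g, w))) (i := fst (enc (g, w)) i - 1), snd (enc (g, w)))"
    "fst (enc (g, w)) i = fst g i"
    by (auto simp: enc_def rdx_def fun_eq_iff)
  then show ?thesis using an_ket[of i "fst (enc (g, w))" "snd (enc (g, w))", where 'k='k]
    by (simp add: rdx_def)
qed

text \<open>The derivative is pushed through the word of y's until it meets a state without y's,
  which it annihilates.\<close>

lemma yd_kb:
  assumes "valid_rmon m n g"
  shows "app (yd j) (kb (g, w)) = (\<lambda>\<psi>. of_int (fst (rdy j g)) * kb (snd (rdy j g), w) \<psi> :: 'k::field)"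
proof -
  obtain a T where g: "g = (a, T)" by fastforce
  have T: "sorted_wrt (<) T" using assms by (simp add: valid_rmon_def g)
  then have T': "distinct T" "sorted_wrt (<) (remove1 j T)" by (auto simp: strict_sorted_iff sorted_remove1)
  have kb: "kb (g, w) = app (ywd T) (kb ((a, []), w) :: fock \<Rightarrow> 'k)"
    by (simp add: ywd_kb g ysign_sorted[OF T])
  have "app (yd j) (kb ((a, []), w)) = (\<lambda>\<psi>. 0 :: 'k)"
  proof -
    have "m + j \<notin> snd (enc ((a, []), w))" by (auto simp: enc_def)
    then show ?thesis
      using fan_ket[of "m + j" "fst (enc ((a, []), w))" "snd (enc ((a, []), w))", where 'k='k]
        fpar_ket[of "{..<m}" "fst (enc ((a, []), w))" "snd (enc ((a, []), w))", where 'k='k]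
      by (simp add: yd_def eps_def app_scale)
  qed
  then have "app (yd j * ywd T) (kb ((a, []), w)) = (\<lambda>\<psi>. of_int (fst (rdy j g)) * app (ywd (remove1 j T)) (kb ((a, []), w)) \<psi> :: 'k)"
    unfolding yd_ywd[OF T'(1), of j a] by (auto simp: g app_zero)
  then show ?thesis unfolding kb by (simp add: ywd_kb ysign_sorted[OF T'(2)]) (simp add: g rdy_def)
qed

lemma yp_kb:
  assumes "valid_rmon m n g"
  shows "app yp (kb (g, w)) = (\<lambda>\<psi>. (-1) ^ length (snd g) * kb (g, w) \<psi> :: 'k::field)"
proof -
  have "snd (enc (g, w)) \<inter> {m..<m+n} = (+) m ` set (snd g)" using assms by (auto simp: enc_def valid_rmon_def)
  moreover have "distinct (snd g)" using assms by (auto simp: valid_rmon_def strict_sorted_iff)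
  ultimately have "card (snd (enc (g, w)) \<inter> {m..<m+n}) = length (snd g)" by (simp add: card_image distinct_card)
  then show ?thesis using fpar_ket[of "{m..<m+n}" "fst (enc (g, w))" "snd (enc (g, w))", where 'k='k]
    by (simp add: yp_def)
qed

lemma ec_ec: "r < m + n \<Longrightarrow> p < m + n \<Longrightarrow> ec r * ec p = - (sig r p * (ec p * (ec r :: (fock, 'k::field) linop)))"
  by (cases "r < m"; cases "p < m") (simp_all add: ec_def sig_def normal cr_cr[of r p] fcr_fcr[of r p] commute_left[OF cr_cr[of r p]])

lemma io_vacuum: "app (io k) (kb (g, [])) = (\<lambda>\<psi>. 0 :: 'k::field)"
proof (cases "k < m")
  case True
  then have "k \<notin> snd (enc (g, []))" by (auto simp: enc_def)
  then show ?thesis using True fan_ket[of k "fst (enc (g, []))" "snd (enc (g, []))", where 'k='k] by (simp add: io_def)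
next
  case False
  then have "fst (enc (g, [])) k = 0" by (auto simp: enc_def)
  then show ?thesis using False an_ket[of k "fst (enc (g, []))" "snd (enc (g, []))", where 'k='k]
    fpar_ket[of "{..<m}" "fst (enc (g, []))" "snd (enc (g, []))", where 'k='k] by (simp add: io_def eps_def app_scale)
qed

definition odd_count :: "nat list \<Rightarrow> nat" where "odd_count w = length (filter (\<lambda>p. m \<le> p) w)"

text \<open>\<open>ec l * io k\<close> acts on words as a superderivation sending e*_k to e*_l. The
  induction moves it past the first letter, and the signs collect the odd letters that were
  passed.\<close>

lemma ec_io_ewd:
  assumes "k < m + n" "l < m + n" "\<forall>p\<in>set w. p < m + n"
  shows "app (ec l * io k * ewd w) (kb (g, [])) = (\<lambda>\<psi>. \<Sum>r<length w. if w ! r = k then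
     of_int ((-1) ^ ((ipar m k + ipar m l) * odd_count (take r w))) * app (ewd (w[r := l])) (kb (g, [])) \<psi> else 0 :: 'k::field)"
  using assms(3)
proof (induction w)
  case Nil
  then show ?case by (simp add: io_vacuum app_zero)
next
  case (Cons b w)
  have b: "b < m + n" using Cons.prems by simp
  let ?s = "(-1) ^ ((ipar m k + ipar m l) * ipar m b) :: (fock, 'k) linop"
  \<comment> \<open>Passing \<open>b\<close> costs the product of the super signs of
    \<open>b\<close> with \<open>k\<close> and with \<open>l\<close>, that is, the sign for the
    parity of the pair.\<close>
  have ss: "sig k b * (sig l b * z) = ?s * z" for z
    by (simp add: sig_def ipar_def)
  have "ec l * io k * (ec b * ewd w) = ec l * (io k * ec b) * (ewd w :: (fock, 'k) linop)" by (simp add: mult.assoc)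
  also have "\<dots> = (if k = b then ec l * ewd w else 0) - sig k b * (ec l * ec b * io k * ewd w)"
    by (simp add: io_ec[OF assms(1) b] algebra_simps sig_def)
  also have "sig k b * (ec l * ec b * io k * ewd w) = - (?s * (ec b * (ec l * io k * (ewd w :: (fock, 'k) linop))))"
    unfolding ec_ec[OF assms(2) b] ss[symmetric] by (simp add: mult.assoc)
  finally have "ec l * io k * ewd (b # w) = (if k = b then ewd (l # w) else 0) + ?s * (ec b * (ec l * io k * (ewd w :: (fock, 'k) linop)))"
    by simp
  note this [THEN arg_cong[where f = "\<lambda>T. app T (kb (g, []))"]]
  moreover have "app (ec b * (ec l * io k * ewd w)) (kb (g, [])) = (\<lambda>\<psi>. \<Sum>r<length w. if w ! r = k then
     of_int ((-1) ^ ((ipar m k + ipar m l) * odd_count (take r w))) * app (ewd (b # w[r := l])) (kb (g, [])) \<psi> else 0 :: 'k)"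
  proof -
    have "app (ec b) (\<lambda>\<psi>. if c then x * u \<psi> else 0) = (\<lambda>\<psi>. if c then x * app (ec b) u \<psi> else (0 :: 'k))" for c x u
      by (cases c) (simp_all add: app_scale app_zero)
    then show ?thesis using Cons by (simp add: app_sum cong: if_cong)
  qed
  moreover have "odd_count (b # u) = ipar m b + odd_count u" for u by (simp add: odd_count_def ipar_def)
  ultimately show ?case
    by (auto simp: fun_eq_iff sum.lessThan_Suc_shift sum_distrib_left power_add distrib_left
        odd_count_def[of "[]"] simp del: sum.lessThan_Suc intro!: sum.cong)
qed

end

section \<open>The action in terms of operators\<close>

lemma valid_rmon_rdx: "valid_rmon m n f \<Longrightarrow> valid_rmon m n (snd (rdx j f))"
  by (auto simp: valid_rmon_def rdx_def)

lemma valid_rmon_rdy: "valid_rmon m n f \<Longrightarrow> valid_rmon m n (snd (rdy j f))"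
  by (auto simp: valid_rmon_def rdy_def strict_sorted_iff sorted_remove1 dest: notin_set_remove1)

text \<open>A repeated y makes the coefficient zero, and then the sorted word is not strictly
  increasing; hence the condition on the coefficient.\<close>

lemma valid_rmon_rmul: "valid_rmon m n f \<Longrightarrow> valid_rmon m n g \<Longrightarrow> fst (rmul f g) \<noteq> 0 \<Longrightarrow> valid_rmon m n (snd (rmul f g))"
  by (auto simp: valid_rmon_def rmul_def ysign_def strict_sorted_iff split: if_splits)

lemma count_list_distinct_filter:
  assumes "distinct (filter P w)" "P p"
  shows "count_list w p = (if p \<in> set w then 1 else 0)"
proof -
  have "count (mset (filter P w)) p = (if p \<in> set (filter P w) then 1 else 0)"
    using assms(1) distinct_count_atmost_1 by metis
  then show ?thesis using assms(2) by (simp flip: count_mset)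
qed

context witt
begin

definition vb_ok :: "vbas \<Rightarrow> bool" where
  "vb_ok b \<longleftrightarrow> valid_rmon m n (fst b) \<and> valid_omon m n (length (snd b)) (snd b)"

text \<open>The exponents and the set of y's are read off directly. The word \<open>w\<close> is
  recovered from its multiplicities because it is sorted; for even letters the multiplicity is
  membership.\<close>

lemma inj_enc: "inj_on enc {b. vb_ok b}"
proof (rule inj_onI; simp)
  fix b b' assume b: "vb_ok b" and b': "vb_ok b'" and eq: "enc b = enc b'"
  obtain a S w where b_eq: "b = ((a, S), w)" by (metis prod.exhaust)
  obtain a' S' w' where b'_eq: "b' = ((a', S'), w')" by (metis prod.exhaust)
  note v = b[unfolded b_eq vb_ok_def valid_rmon_def valid_omon_def, simplified]
  note v' = b'[unfolded b'_eq vb_ok_def valid_rmon_def valid_omon_def, simplified]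
  have fst_eq: "(if p < m then a p else count_list w p) = (if p < m then a' p else count_list w' p)" for p
    using arg_cong[OF eq, of "\<lambda>x. fst x p"] by (auto simp: enc_def b_eq b'_eq split: if_splits)
  have snd_eq: "{p \<in> set w. p < m} \<union> (+) m ` set S = {p \<in> set w'. p < m} \<union> (+) m ` set S'"
    using eq by (simp add: enc_def b_eq b'_eq)
  have "a p = a' p" for p using fst_eq[of p] v v' by (cases "p < m") auto
  then have 1: "a = a'" by auto
  have "s \<in> set S \<longleftrightarrow> s \<in> set S'" for s
    using arg_cong[OF snd_eq, of "\<lambda>X. m + s \<in> X"] by auto
  then have 2: "S = S'" using v v' by (intro sorted_distinct_set_unique) (auto simp: strict_sorted_iff)
  have "count_list w p = count_list w' p" for p
  proof (cases "p < m")
    case True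
    have "p \<in> set w \<longleftrightarrow> p \<in> set w'" using arg_cong[OF snd_eq, of "\<lambda>X. p \<in> X"] True by auto
    then show ?thesis using count_list_distinct_filter[of "\<lambda>p. p < m"] v v' True by auto
  next
    case False
    then show ?thesis using fst_eq[of p] by simp
  qed
  then have "mset w = mset w'" by (intro multiset_eqI) (simp add: count_mset)
  then have 3: "w = w'" using v v' by (metis properties_for_sort)
  show "b = b'" using 1 2 3 by (simp add: b_eq b'_eq)
qed

text \<open>Reading coefficients along \<open>enc\<close>. \<open>Psi\<close> and \<open>Phi\<close>
  are total, and inverse to each other between \<open>Vq m n q\<close> and
  \<open>fock_space (int q)\<close>.\<close>

definition Psi :: "(fock \<Rightarrow> 'k::field) \<Rightarrow> vbas \<Rightarrow> 'k" where
  "Psi u b = (if vb_ok b then u (enc b) else 0)"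

definition Phi :: "(vbas \<Rightarrow> 'k::field) \<Rightarrow> fock \<Rightarrow> 'k" where
  "Phi v \<phi> = (if \<phi> \<in> enc ` {b. vb_ok b} then v (inv_into {b. vb_ok b} enc \<phi>) else 0)"

lemma Psi_kb: "vb_ok b' \<Longrightarrow> Psi (kb b') b = (if b = b' then 1 else 0 :: 'k::field)"
  by (auto simp: Psi_def ket_def dest: inj_onD[OF inj_enc])

lemma Phi_enc: "vb_ok b \<Longrightarrow> Phi v (enc b) = v b"
  using inj_enc by (auto simp: Phi_def inv_into_f_f)

lemma Phi_outside: "\<phi> \<notin> enc ` {b. vb_ok b} \<Longrightarrow> Phi v \<phi> = 0"
  by (simp add: Phi_def)

text \<open>The coefficients \<open>xi\<close> paired with a test function \<open>h\<close> on
  words: indicator functions give back \<open>xi\<close>, and basis states give the action of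
  \<open>xio\<close>.\<close>

definition xi_sum :: "nat \<Rightarrow> nat \<Rightarrow> nat list \<Rightarrow> (nat list \<Rightarrow> 'k::field) \<Rightarrow> 'k" where
  "xi_sum k l w h = (\<Sum>r<length w. if w ! r = k then
        of_int ((-1) ^ ((ipar m k + ipar m l) * odd_count (take r w))
                * (- ((-1) ^ ((ipar m k + ipar m l) * ipar m k)))
                * osign m (w[r := l])) * h (sort (w[r := l])) else 0)
     + (if k = l then (if k < m then 1 else -1) * h w else 0)"

lemma xi_eq_xi_sum: "xi m k l w w' = xi_sum k l w (\<lambda>u. if w' = u then 1 else 0)"
  by (auto simp: xi_def xi_sum_def odd_count_def intro!: arg_cong2[of _ _ _ _ "(+)"] sum.cong)

lemma xi_sum_scale: "xi_sum k l w (\<lambda>u. c * h u) = c * xi_sum k l w h"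
proof -
  have "(if P then x * (c * y) else 0) = c * (if P then x * y else 0)" for P x y by auto
  then show ?thesis by (simp add: xi_sum_def distrib_left sum_distrib_left)
qed

lemma app_xi_sum: "app T (\<lambda>\<psi>. xi_sum k l w (\<lambda>u. h u \<psi>)) = (\<lambda>\<psi>. xi_sum k l w (\<lambda>u. app T (h u) \<psi>))"
proof -
  have *: "app T (\<lambda>\<psi>. if P then x * v \<psi> else 0) = (\<lambda>\<psi>. if P then x * app T v \<psi> else 0)" for P x v
    by (cases P) (simp_all add: app_scale app_zero)
  show ?thesis unfolding xi_sum_def app_add app_sum * by simp
qed

text \<open>An even letter that gets repeated has sign zero, so \<open>h\<close> matters only on
  valid words of the same length.\<close>

lemma xi_sum_cong:
  assumes w: "valid_omon m n (length w) w" and "k < m + n" "l < m + n"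
    and h: "\<And>u. valid_omon m n (length w) u \<Longrightarrow> h u = h' u"
  shows "xi_sum k l w h = xi_sum k l w h'"
proof -
  have "osign m (w[r := l]) = 0 \<or> h (sort (w[r := l])) = h' (sort (w[r := l]))" if "r < length w" for r
  proof (cases "distinct (filter (\<lambda>p. p < m) (w[r := l]))")
    case True
    have "set (w[r := l]) \<subseteq> insert l (set w)" by (rule set_update_subset_insert)
    moreover have "distinct (filter (\<lambda>p. p < m) (sort (w[r := l])))"
      using True by (simp add: filter_sort)
    ultimately show ?thesis using w assms(3) by (intro disjI2 h) (auto simp: valid_omon_def)
  qed (simp add: osign_def)
  then have eq: "of_int (c * osign m (w[r := l])) * h (sort (w[r := l])) = of_int (c * osign m (w[r := l])) * h' (sort (w[r := l]))"
    if "r < length w" for r c using that by fastforce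
  show ?thesis unfolding xi_sum_def
    by (intro arg_cong2[of _ _ _ _ "(+)"] sum.cong) (auto simp: h[OF w] eq simp del: of_int_mult)
qed

lemma kb_ewd:
  assumes "valid_omon m n (length w) w"
  shows "kb (g, w) = app (ewd w) (kb (g, []) :: fock \<Rightarrow> 'k::field)"
  using assms by (simp add: ewd_kb osign_sorted valid_omon_def)

lemma xio_kb:
  assumes w: "valid_omon m n (length w) w" and kl: "k < m + n" "l < m + n"
  shows "app (xio k l) (kb (g, w)) = (\<lambda>\<psi>. xi_sum k l w (\<lambda>u. kb (g, u) \<psi>) :: 'k::field)"
proof -
  have "\<forall>p\<in>set w. p < m + n" using w by (simp add: valid_omon_def)
  note E = ec_io_ewd[OF kl this, of g, where 'k='k, unfolded ewd_kb enc_sort(2)[of _ "_[_ := _]", symmetric]]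
  let ?s = "(- ((-1) ^ ((ipar m k + ipar m l) * ipar m k))) :: int"
  show ?thesis
  proof
    fix \<psi>
    have "app (xio k l) (kb (g, w)) \<psi> = of_int ?s * app (ec l * io k * ewd w) (kb (g, [])) \<psi>
       + (if k = l then (if k < m then 1 else -1) * kb (g, w) \<psi> else (0 :: 'k))"
      by (simp add: xio_def kb_ewd[OF w, symmetric])
    also have "of_int ?s * app (ec l * io k * ewd w) (kb (g, [])) \<psi> = (\<Sum>r<length w. if w ! r = k then
        of_int ((-1) ^ ((ipar m k + ipar m l) * odd_count (take r w)) * ?s
                * osign m (w[r := l])) * kb (g, sort (w[r := l])) \<psi> else (0 :: 'k))"
      unfolding E sum_distrib_left by (intro sum.cong) auto
    finally show "app (xio k l) (kb (g, w)) \<psi> = (xi_sum k l w (\<lambda>u. kb (g, u) \<psi>) :: 'k)" unfolding xi_sum_def .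
  qed
qed

lemma Psi_xi_sum:
  assumes w: "valid_omon m n (length w) w" and kl: "k < m + n" "l < m + n" and g: "valid_rmon m n g"
  shows "Psi (\<lambda>\<psi>. xi_sum k l w (\<lambda>u. kb (g, u) \<psi>)) b = (if fst b = g then xi m k l w (snd b) else 0 :: 'k::field)"
proof -
  have Psi_h: "Psi (\<lambda>\<psi>. xi_sum k l w (\<lambda>u. h u \<psi>)) b = xi_sum k l w (\<lambda>u. Psi (h u) b)" for h :: "nat list \<Rightarrow> fock \<Rightarrow> 'k"
    by (cases "vb_ok b") (simp_all add: Psi_def xi_sum_def cong: if_cong)
  have "valid_omon m n (length w) u \<Longrightarrow> vb_ok (g, u)" for u using g by (auto simp: vb_ok_def valid_omon_def)
  then have "xi_sum k l w (\<lambda>u. Psi (kb (g, u)) b) = xi_sum k l w (\<lambda>u. if b = (g, u) then 1 else 0 :: 'k)"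
    by (intro xi_sum_cong[OF w kl]) (simp add: Psi_kb)
  also have "\<dots> = xi_sum k l w (\<lambda>u. (if fst b = g then 1 else 0) * (if snd b = u then 1 else 0 :: 'k))"
    by (intro xi_sum_cong[OF w kl]) (auto simp: prod_eq_iff)
  finally show ?thesis unfolding Psi_h xi_sum_scale xi_eq_xi_sum by simp
qed

lemma mon_ok_valid: "valid_rmon m n f \<Longrightarrow> mon_ok f"
  by (auto simp: valid_rmon_def mon_ok_def strict_sorted_iff)

text \<open>The three parts of \<open>act_basis\<close> are matched one by one with those of
  \<open>witt_op\<close>: \<open>first\<close> is multiplication after differentiation, and
  \<open>sec\<close> treats both correction sums.\<close>

lemma act_basis_eq:
  assumes f: "valid_rmon m n f" and i: "i < m + n" and v: "vb_ok v"
  shows "act_basis m n (f, i) v b = (Psi (app (witt_op f i) (kb v)) b :: 'k::field)"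
proof -
  obtain g w where v_eq: "v = (g, w)" by fastforce
  have g: "valid_rmon m n g" and w: "valid_omon m n (length w) w" using v by (auto simp: v_eq vb_ok_def)
  define dg where "dg = (if i < m then rdx i g else rdy (i - m) g)"
  have dg: "valid_rmon m n (snd dg)" using g by (simp add: dg_def valid_rmon_rdx valid_rmon_rdy)
  let ?s2 = "if i < m then 1 else (-1) ^ length (snd g) :: int"
  let ?s3 = "if i < m then (-1) ^ (length (snd f) + length (snd g) + 1) else (-1) ^ (length (snd f) + 1) :: int"
  have first: "app (mul f * (if i < m then an i else yd (i - m))) (kb (g, w)) =
      (\<lambda>\<psi>. of_int (fst dg * fst (rmul f (snd dg))) * kb (snd (rmul f (snd dg)), w) \<psi> :: 'k)"
    by (simp add: an_kb yd_kb[OF g] app_scale mul_kb[OF f] valid_rmon_rdx[OF g] valid_rmon_rdy[OF g] dg_def mult.assoc)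
  have sec: "app (of_int c * (mul h * ((if P then yp else 1) * xio k i))) (kb (g, w)) =
      (\<lambda>\<psi>. of_int (c * (if P then (-1) ^ length (snd g) else 1) * fst (rmul h g)) * xi_sum k i w (\<lambda>u. kb (snd (rmul h g), u) \<psi>) :: 'k)"
    if h: "valid_rmon m n h" and k: "k < m + n" for c h P k
  proof -
    have "app (mul h * (if P then yp else 1)) (kb (g, u)) = (\<lambda>\<psi>. of_int ((if P then (-1) ^ length (snd g) else 1) * fst (rmul h g)) * kb (snd (rmul h g), u) \<psi> :: 'k)" for u
      by (simp add: yp_kb[OF g] mul_kb[OF h g] app_scale mult.assoc)
    then have "app (mul h * (if P then yp else 1)) (app (xio k i) (kb (g, w))) =
       (\<lambda>\<psi>. of_int ((if P then (-1) ^ length (snd g) else 1) * fst (rmul h g)) * xi_sum k i w (\<lambda>u. kb (snd (rmul h g), u) \<psi>) :: 'k)"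
      unfolding xio_kb[OF w k i] app_xi_sum by (simp only: xi_sum_scale)
    moreover have "of_int c * (mul h * ((if P then yp else 1) * xio k i)) = of_int c * ((mul h * (if P then yp else 1)) * (xio k i :: (fock, 'k) linop))"
      by (simp add: mult.assoc)
    ultimately show ?thesis by (simp only: app_simps(6)) (simp add: fun_eq_iff mult.assoc)
  qed
  \<comment> \<open>If the product of monomials vanishes, its sorted word is not valid and
    \<open>Psi\<close> gives no information; the scalar \<open>c\<close> contains the sign of the
    product and makes both sides zero.\<close>
  have Psi_lin: "Psi (\<lambda>\<psi>. c * xi_sum k i w (\<lambda>u. kb (snd (rmul h g), u) \<psi>)) b = c * (if fst b = snd (rmul h g) then xi m k i w (snd b) else 0)"
    if "k < m + n" "valid_rmon m n h" "c = of_int (x * fst (rmul h g))" for c :: 'k and k h x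
  proof (cases "fst (rmul h g) = 0")
    case False
    have "Psi (\<lambda>\<psi>. c * u \<psi>) b = c * Psi u b" for u by (simp add: Psi_def)
    then show ?thesis using Psi_xi_sum[OF w that(1) i valid_rmon_rmul[OF that(2) g False], where 'k='k] by simp
  qed (simp add: that(3) Psi_def)
  have A: "Psi (\<lambda>\<psi>. of_int (fst dg * fst (rmul f (snd dg))) * kb (snd (rmul f (snd dg)), w) \<psi>) b
      = (of_int (fst dg * fst (rmul f (snd dg))) * (if b = (snd (rmul f (snd dg)), w) then 1 else 0) :: 'k)"
  proof (cases "fst (rmul f (snd dg)) = 0")
    case False
    have "vb_ok (snd (rmul f (snd dg)), w)" using valid_rmon_rmul[OF f dg False] w by (simp add: vb_ok_def)
    from Psi_kb[OF this, of b, where 'k='k] show ?thesis by (auto simp: Psi_def split: if_splits)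
  qed (simp add: Psi_def)
  have Psi_add: "Psi (\<lambda>\<psi>. x \<psi> + y \<psi>) b = Psi x b + Psi y b" for x y :: "fock \<Rightarrow> 'k" by (simp add: Psi_def)
  have Psi_sum: "Psi (\<lambda>\<psi>. \<Sum>j\<in>J. x j \<psi>) b = (\<Sum>j\<in>J. Psi (x j) b)" for J :: "nat set" and x :: "nat \<Rightarrow> fock \<Rightarrow> 'k" by (simp add: Psi_def)
  have if_swap: "(if i < m then 1 else yp) = (if \<not> i < m then yp else (1 :: (fock, 'k) linop))" by simp
  have witt_op_kb: "app (witt_op f i) (kb v :: fock \<Rightarrow> 'k) = (\<lambda>\<psi>. app (mul f * (if i < m then an i else yd (i - m))) (kb (g, w)) \<psi>
    + (\<Sum>j<m. app (of_int (fst (rdx j f)) * (mul (snd (rdx j f)) * ((if \<not> i < m then yp else 1) * xio j i))) (kb (g, w)) \<psi>)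
    + (\<Sum>j<n. app (of_int ((-1) ^ (length (snd f) + 1) * fst (rdy j f)) * (mul (snd (rdy j f)) * ((if i < m then yp else 1) * xio (m + j) i))) (kb (g, w)) \<psi>))"
    unfolding witt_op_def v_eq if_swap by (simp only: app_simps app_sum_left fun_eq_iff) simp
  have "Psi (app (witt_op f i) (kb v :: fock \<Rightarrow> 'k)) b =
     of_int (fst dg * fst (rmul f (snd dg))) * (if b = (snd (rmul f (snd dg)), w) then 1 else 0)
     + (\<Sum>j<m. of_int (?s2 * fst (rdx j f) * fst (rmul (snd (rdx j f)) g))
            * (if fst b = snd (rmul (snd (rdx j f)) g) then xi m j i w (snd b) else 0))
       + (\<Sum>j<n. of_int (?s3 * fst (rdy j f) * fst (rmul (snd (rdy j f)) g))
            * (if fst b = snd (rmul (snd (rdy j f)) g) then xi m (m + j) i w (snd b) else 0))"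
    unfolding witt_op_kb Psi_add Psi_sum first A
  proof (intro arg_cong2[of _ _ _ _ "(+)"] refl sum.cong)
    fix j assume "j \<in> {..<m}"
    then have j: "j < m + n" by simp
    show "Psi (app (of_int (fst (rdx j f)) * (mul (snd (rdx j f)) * ((if \<not> i < m then yp else 1) * xio j i))) (kb (g, w))) b
       = (of_int :: int \<Rightarrow> 'k) (?s2 * fst (rdx j f) * fst (rmul (snd (rdx j f)) g)) * (if fst b = snd (rmul (snd (rdx j f)) g) then xi m j i w (snd b) else 0)"
      unfolding sec[OF valid_rmon_rdx[OF f] j]
      by (subst Psi_lin[OF j valid_rmon_rdx[OF f] refl]) (simp add: mult.commute)
  next
    fix j assume "j \<in> {..<n}"
    then have j: "m + j < m + n" by simp
    show "Psi (app (of_int ((-1) ^ (length (snd f) + 1) * fst (rdy j f)) * (mul (snd (rdy j f)) * ((if i < m then yp else 1) * xio (m + j) i))) (kb (g, w))) b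
       = (of_int :: int \<Rightarrow> 'k) (?s3 * fst (rdy j f) * fst (rmul (snd (rdy j f)) g)) * (if fst b = snd (rmul (snd (rdy j f)) g) then xi m (m + j) i w (snd b) else 0)"
      unfolding sec[OF valid_rmon_rdy[OF f] j]
      by (subst Psi_lin[OF j valid_rmon_rdy[OF f] refl]) (simp add: power_add mult.commute mult.left_commute)
  qed
  then show ?thesis by (simp only: act_basis_def v_eq dg_def Let_def fst_conv snd_conv)
qed

end

lemma ket_expansion: "finite {\<phi>. u \<phi> \<noteq> 0} \<Longrightarrow> u = (\<lambda>\<psi>. \<Sum>\<phi>\<in>{\<phi>. u \<phi> \<noteq> 0}. u \<phi> * ket \<phi> \<psi>)"
proof
  fix \<psi> assume "finite {\<phi>. u \<phi> \<noteq> 0}"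
  moreover have "(\<Sum>\<phi>\<in>{\<phi>. u \<phi> \<noteq> 0}. u \<phi> * ket \<phi> \<psi>) = (\<Sum>\<phi>\<in>{\<phi>. u \<phi> \<noteq> 0}. if \<phi> = \<psi> then u \<phi> else 0)"
    by (intro sum.cong) (auto simp: ket_def)
  ultimately show "u \<psi> = (\<Sum>\<phi>\<in>{\<phi>. u \<phi> \<noteq> 0}. u \<phi> * ket \<phi> \<psi>)" by simp
qed

declare split_paired_All [simp del] split_paired_Ex [simp del]

section \<open>Degree of a state and operators that shift it\<close>

context witt
begin

definition fock_states :: "fock set" where "fock_states = {\<phi>. (\<forall>p\<ge>m+n. fst \<phi> p = 0) \<and> snd \<phi> \<subseteq> {..<m+n}}"

definition deg :: "fock \<Rightarrow> int" where
  "deg \<phi> = int (card (snd \<phi> \<inter> {..<m}) + sum (fst \<phi>) {m..<m+n})"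

lemma enc_fock_states: "vb_ok b \<Longrightarrow> enc b \<in> fock_states"
  by (auto simp: fock_states_def enc_def vb_ok_def valid_rmon_def valid_omon_def count_list_0_iff)

lemma deg_enc:
  assumes "vb_ok b" shows "deg (enc b) = int (length (snd b))"
proof -
  obtain g w where b: "b = (g, w)" by fastforce
  have w: "distinct (filter (\<lambda>p. p < m) w)" "set w \<subseteq> {..<m+n}" using assms by (auto simp: b vb_ok_def valid_omon_def)
  have "length w = (\<Sum>p<m+n. count_list w p)" using sum_count_set[OF w(2)] by simp
  also have "\<dots> = (\<Sum>p<m. count_list w p) + (\<Sum>p\<in>{m..<m+n}. count_list w p)"
    by (metis atLeast0LessThan le_add1 sum.atLeastLessThan_concat zero_le)
  also have "(\<Sum>p<m. count_list w p) = (\<Sum>p<m. if p \<in> set w then 1 else 0)"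
    using count_list_distinct_filter[OF w(1)] by (intro sum.cong) auto
  also have "\<dots> = card {p \<in> set w. p < m}"
    by (simp add: sum.If_cases) (rule arg_cong[of _ _ card], auto)
  finally show ?thesis unfolding deg_def b enc_below by (simp add: enc_def)
qed

text \<open>Surjectivity of the encoding: the occupation numbers determine the set of y's and the
  multiset of e*'s, and sorting them gives a valid pair.\<close>

lemma fock_states_enc: "\<phi> \<in> fock_states \<Longrightarrow> \<exists>b. vb_ok b \<and> enc b = \<phi>"
proof -
  assume \<phi>: "\<phi> \<in> fock_states"
  obtain \<beta> F where \<phi>_eq: "\<phi> = (\<beta>, F)" by fastforce
  have \<beta>: "\<And>p. m + n \<le> p \<Longrightarrow> \<beta> p = 0" and F: "F \<subseteq> {..<m+n}" using \<phi> by (auto simp: fock_states_def \<phi>_eq)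
  define S where "S = sorted_list_of_set {s. m + s \<in> F}"
  have "{s. m + s \<in> F} \<subseteq> {..<n}" using F by auto
  then have S: "set S = {s. m + s \<in> F}" "sorted_wrt (<) S" by (simp_all add: S_def finite_subset)
  define M where "M = mset_set (F \<inter> {..<m}) + (\<Sum>p\<in>{m..<m+n}. replicate_mset (\<beta> p) p)"
  define w where "w = sorted_list_of_multiset M"
  have "count (\<Sum>p\<in>{m..<m+n}. replicate_mset (\<beta> p) p) p = (if m \<le> p \<and> p < m + n then \<beta> p else 0)" for p
    by (simp add: count_sum)
  then have cM: "count M p = (if p < m then if p \<in> F then 1 else 0 else \<beta> p)" for p
    by (auto simp: M_def count_mset_set' \<beta>)
  have cw: "count_list w p = (if p < m then if p \<in> F then 1 else 0 else \<beta> p)" for p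
    using cM[of p] by (simp add: w_def flip: count_mset)
  have sw: "p \<in> set w \<longleftrightarrow> count_list w p \<noteq> 0" for p by (simp add: count_list_0_iff)
  have "count (mset (filter (\<lambda>p. p < m) w)) p = (if p \<in> set (filter (\<lambda>p. p < m) w) then 1 else 0)" for p
    using cw[of p] sw[of p] by (auto simp flip: count_mset split: if_splits)
  then have "distinct (filter (\<lambda>p. p < m) w)" using distinct_count_atmost_1 by metis
  moreover have "p < m + n" if "p \<in> set w" for p using that \<beta>[of p] cw[of p] sw[of p] by (cases "p < m + n") auto
  moreover have "sorted w" by (simp add: w_def)
  ultimately have "vb_ok ((\<lambda>i. if i < m then \<beta> i else 0, S), w)"
    using S F by (auto simp: vb_ok_def valid_rmon_def valid_omon_def)
  moreover have "enc ((\<lambda>i. if i < m then \<beta> i else 0, S), w) = \<phi>"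
  proof -
    have "{p \<in> set w. p < m} \<union> (+) m ` set S = F"
    proof (intro set_eqI iffI)
      fix p assume "p \<in> F"
      then show "p \<in> {p \<in> set w. p < m} \<union> (+) m ` set S"
      proof (cases "p < m")
        case False
        then have "p = m + (p - m)" by simp
        then show ?thesis using \<open>p \<in> F\<close> S(1) by (metis UnCI image_eqI mem_Collect_eq)
      qed (use \<open>p \<in> F\<close> in \<open>simp add: sw cw\<close>)
    qed (auto simp: S(1) sw cw split: if_splits)
    then show ?thesis by (auto simp: enc_def \<phi>_eq cw fun_eq_iff)
  qed
  ultimately show ?thesis by blast
qed

text \<open>The degree is an integer, so that lowering degree 0 is covered; negative degrees give
  the zero space.\<close>

definition fock_space :: "int \<Rightarrow> (fock \<Rightarrow> 'k::field) set" where
  "fock_space d = {u. finite {\<phi>. u \<phi> \<noteq> 0} \<and> (\<forall>\<phi>. u \<phi> \<noteq> 0 \<longrightarrow> \<phi> \<in> fock_states \<and> deg \<phi> = d)}"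

lemma fock_space_add: "u \<in> fock_space d \<Longrightarrow> v \<in> fock_space d \<Longrightarrow> (\<lambda>\<phi>. u \<phi> + v \<phi>) \<in> fock_space d"
proof -
  assume *: "u \<in> fock_space d" "v \<in> fock_space d"
  then have "finite ({\<phi>. u \<phi> \<noteq> 0} \<union> {\<phi>. v \<phi> \<noteq> 0})" by (simp add: fock_space_def)
  then have "finite {\<phi>. u \<phi> + v \<phi> \<noteq> 0}" by (rule rev_finite_subset) auto
  moreover have "\<phi> \<in> fock_states \<and> deg \<phi> = d" if "u \<phi> + v \<phi> \<noteq> 0" for \<phi>
  proof -
    have "u \<phi> \<noteq> 0 \<or> v \<phi> \<noteq> 0" using that by auto
    then show ?thesis using * unfolding fock_space_def by blast
  qed
  ultimately show ?thesis by (simp add: fock_space_def)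
qed

text \<open>The factor may depend on the state, which allows division by the eigenvalues of a
  diagonal operator.\<close>

lemma fock_space_scale: "u \<in> fock_space d \<Longrightarrow> (\<lambda>\<phi>. c \<phi> * u \<phi>) \<in> fock_space d"
proof -
  assume u: "u \<in> fock_space d"
  have "{\<phi>. c \<phi> * u \<phi> \<noteq> 0} \<subseteq> {\<phi>. u \<phi> \<noteq> 0}" by auto
  then show ?thesis using u unfolding fock_space_def by (auto intro: finite_subset)
qed

lemma fock_space_zero: "(\<lambda>\<phi>. 0) \<in> fock_space d" by (simp add: fock_space_def)

lemma fock_space_sum: "(\<And>i. i \<in> I \<Longrightarrow> u i \<in> fock_space d) \<Longrightarrow> (\<lambda>\<phi>. \<Sum>i\<in>I. u i \<phi>) \<in> fock_space d"
  by (induction I rule: infinite_finite_induct) (simp_all add: fock_space_zero fock_space_add)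

lemma fock_space_ket: "\<phi> \<in> fock_states \<Longrightarrow> ket \<phi> \<in> fock_space (deg \<phi>)"
  by (auto simp: fock_space_def ket_def)

lemma fock_space_neg: "u \<in> fock_space d \<Longrightarrow> d < 0 \<Longrightarrow> u = (\<lambda>_. 0)"
proof
  fix \<phi> assume "u \<in> fock_space d" "d < 0"
  moreover have "0 \<le> deg \<phi>" by (simp add: deg_def del: of_nat_sum of_nat_add)
  ultimately show "u \<phi> = 0" unfolding fock_space_def by force
qed

lemma Psi_fock_space:
  assumes "u \<in> fock_space (int q)" shows "Psi u \<in> Vq m n q"
proof -
  have "enc ` {b. Psi u b \<noteq> 0} \<subseteq> {\<phi>. u \<phi> \<noteq> 0}" by (auto simp: Psi_def)
  then have "finite (enc ` {b. Psi u b \<noteq> 0})" using assms by (auto simp: fock_space_def intro: finite_subset)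
  moreover have "inj_on enc {b. Psi u b \<noteq> 0}"
    by (rule inj_on_subset[OF inj_enc]) (auto simp: Psi_def)
  ultimately have "finite {b. Psi u b \<noteq> 0}" by (rule finite_imageD)
  moreover have "valid_rmon m n (fst b) \<and> valid_omon m n q (snd b)" if "Psi u b \<noteq> 0" for b
  proof -
    have b: "vb_ok b" "u (enc b) \<noteq> 0" using that by (auto simp: Psi_def split: if_splits)
    then have "length (snd b) = q" using assms deg_enc[OF b(1)] by (simp add: fock_space_def)
    then show ?thesis using b by (auto simp: vb_ok_def)
  qed
  ultimately show ?thesis by (auto simp: Vq_def)
qed

lemma Vq_ok: "v \<in> Vq m n q \<Longrightarrow> v b \<noteq> 0 \<Longrightarrow> vb_ok b \<and> length (snd b) = q"
  by (auto simp: Vq_def vb_ok_def valid_omon_def)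

lemma Phi_nonzero: "Phi v \<phi> \<noteq> 0 \<Longrightarrow> \<exists>b. vb_ok b \<and> \<phi> = enc b"
  unfolding Phi_def by (meson imageE mem_Collect_eq)

lemma Phi_fock_space:
  assumes "v \<in> Vq m n q" shows "Phi v \<in> fock_space (int q)"
proof -
  have "\<phi> \<in> enc ` {b. v b \<noteq> 0}" if nz: "Phi v \<phi> \<noteq> 0" for \<phi>
  proof -
    obtain b where "vb_ok b" "\<phi> = enc b" using Phi_nonzero[OF nz] by blast
    then show ?thesis using nz by (auto simp: Phi_enc)
  qed
  then have "{\<phi>. Phi v \<phi> \<noteq> 0} \<subseteq> enc ` {b. v b \<noteq> 0}" by auto
  moreover have "finite {b. v b \<noteq> 0}" using assms by (simp add: Vq_def)
  ultimately have "finite {\<phi>. Phi v \<phi> \<noteq> 0}" by (meson finite_imageI finite_subset)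
  moreover have "\<phi> \<in> fock_states \<and> deg \<phi> = int q" if nz: "Phi v \<phi> \<noteq> 0" for \<phi>
  proof -
    obtain b where b: "vb_ok b" "\<phi> = enc b" using Phi_nonzero[OF nz] by blast
    then have "v b \<noteq> 0" using nz by (simp add: Phi_enc)
    then show ?thesis using Vq_ok[OF assms] b enc_fock_states deg_enc by auto
  qed
  ultimately show ?thesis by (auto simp: fock_space_def)
qed

lemma Psi_Phi: "v \<in> Vq m n q \<Longrightarrow> Psi (Phi v) = v"
proof
  fix b assume "v \<in> Vq m n q"
  then show "Psi (Phi v) b = v b" using Vq_ok[of v q b] by (auto simp: Psi_def Phi_enc)
qed

lemma Phi_Psi:
  assumes "u \<in> fock_space d" shows "Phi (Psi u) = u"
proof
  fix \<phi>
  show "Phi (Psi u) \<phi> = u \<phi>"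
  proof (cases "\<phi> \<in> fock_states")
    case True
    then obtain b where "vb_ok b" "enc b = \<phi>" using fock_states_enc by blast
    then show ?thesis using Phi_enc[of b "Psi u"] by (auto simp: Psi_def)
  next
    case False
    then have "\<phi> \<notin> enc ` {b. vb_ok b}" using enc_fock_states by auto
    then show ?thesis using False assms by (auto simp: Phi_outside fock_space_def)
  qed
qed

lemma Phi_lin: "Phi (\<lambda>b. u b + v b) = (\<lambda>\<phi>. Phi u \<phi> + Phi v \<phi>)" "Phi (\<lambda>b. c * u b) = (\<lambda>\<phi>. c * Phi u \<phi>)"
  by (auto simp: Phi_def fun_eq_iff)

lemma Psi_lin: "Psi (\<lambda>\<phi>. u \<phi> + v \<phi>) = (\<lambda>b. Psi u b + Psi v b)" "Psi (\<lambda>\<phi>. c * u \<phi>) = (\<lambda>b. c * Psi u b)"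
  by (auto simp: Psi_def fun_eq_iff)

lemma Phi_single: "vb_ok b \<Longrightarrow> Phi (single b) = kb b"
proof
  fix \<phi> assume b: "vb_ok b"
  show "Phi (single b) \<phi> = (kb b \<phi> :: 'k::field)"
  proof (cases "\<phi> \<in> enc ` {b. vb_ok b}")
    case True
    then obtain c where c: "vb_ok c" "\<phi> = enc c" by blast
    then have "enc c = enc b \<longleftrightarrow> c = b" using b by (intro inj_on_eq_iff[OF inj_enc]) auto
    then show ?thesis using c by (simp add: Phi_enc single_def ket_def)
  qed (use b in \<open>auto simp: Phi_outside ket_def\<close>)
qed

definition shifts :: "(fock, 'k::field) linop \<Rightarrow> int \<Rightarrow> bool" where
  "shifts T k \<longleftrightarrow> (\<forall>d. \<forall>u\<in>fock_space d. app T u \<in> fock_space (d + k))"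

text \<open>Vectors of \<open>fock_space\<close> have finite support, so it is enough to look at
  basis states.\<close>

lemma shifts_ketI:
  assumes "\<And>\<beta> F. (\<beta>, F) \<in> fock_states \<Longrightarrow> \<exists>c \<phi>. app T (ket (\<beta>, F)) = (\<lambda>\<psi>. c * ket \<phi> \<psi>) \<and> (c \<noteq> 0 \<longrightarrow> \<phi> \<in> fock_states \<and> deg \<phi> = deg (\<beta>, F) + k)"
  shows "shifts T k"
  unfolding shifts_def
proof (intro allI ballI)
  fix d and u :: "fock \<Rightarrow> 'a" assume u: "u \<in> fock_space d"
  have "app T (ket \<phi>) \<in> fock_space (d + k)" if "u \<phi> \<noteq> 0" for \<phi>
  proof -
    have \<phi>: "\<phi> \<in> fock_states" "deg \<phi> = d" using u that by (auto simp: fock_space_def)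
    obtain c \<phi>' where c: "app T (ket \<phi>) = (\<lambda>\<psi>. c * ket \<phi>' \<psi>)" "c \<noteq> 0 \<longrightarrow> \<phi>' \<in> fock_states \<and> deg \<phi>' = d + k"
      using assms[of "fst \<phi>" "snd \<phi>"] \<phi> by auto
    show ?thesis
    proof (cases "c = 0")
      case False
      then show ?thesis using c fock_space_scale[OF fock_space_ket[of \<phi>'], of "\<lambda>_. c"] by auto
    qed (simp add: c fock_space_zero)
  qed
  then have "(\<lambda>\<psi>. \<Sum>\<phi>\<in>{\<phi>. u \<phi> \<noteq> 0}. u \<phi> * app T (ket \<phi>) \<psi>) \<in> fock_space (d + k)"
    by (intro fock_space_sum fock_space_scale) simp
  moreover have "app T u = (\<lambda>\<psi>. \<Sum>\<phi>\<in>{\<phi>. u \<phi> \<noteq> 0}. u \<phi> * app T (ket \<phi>) \<psi>)"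
    by (subst ket_expansion[of u]) (use u in \<open>simp_all add: fock_space_def app_sum app_scale\<close>)
  ultimately show "app T u \<in> fock_space (d + k)" by simp
qed

lemma shifts_times: "shifts S k \<Longrightarrow> shifts T l \<Longrightarrow> j = k + l \<Longrightarrow> shifts (S * T) j"
proof -
  assume "shifts S k" "shifts T l" "j = k + l"
  then have "app S (app T u) \<in> fock_space (d + l + k)" if "u \<in> fock_space d" for u d
    using that by (simp add: shifts_def)
  moreover have "d + l + k = d + j" for d using \<open>j = k + l\<close> by simp
  ultimately show ?thesis by (simp add: shifts_def)
qed

lemma shifts_times_right: "shifts S k \<Longrightarrow> shifts T 0 \<Longrightarrow> shifts (S * T) k"
  using shifts_times[of S k T 0 k] by simp

lemma shifts_add: "shifts S k \<Longrightarrow> shifts T k \<Longrightarrow> shifts (S + T) k"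
proof -
  assume *: "shifts S k" "shifts T k"
  have "app (S + T) u = (\<lambda>\<phi>. app S u \<phi> + app T u \<phi>)" for u by auto
  then show ?thesis using * fock_space_add unfolding shifts_def by fastforce
qed

lemma shifts_one: "shifts 1 0" by (simp add: shifts_def)

lemma shifts_uminus: "shifts T k \<Longrightarrow> shifts (- T) k"
proof -
  assume *: "shifts T k"
  have "app (- T) u = (\<lambda>\<phi>. - 1 * app T u \<phi>)" for u by auto
  then show ?thesis using * unfolding shifts_def by (simp only:) (blast intro: fock_space_scale[of _ _ "\<lambda>_. - 1"])
qed

lemma shifts_of_int: "shifts (of_int c) 0"
proof -
  have "app (of_int c) u = (\<lambda>\<phi>. of_int c * u \<phi>)" for u :: "fock \<Rightarrow> 'a" by auto
  then show ?thesis unfolding shifts_def by (simp only: add_0_right) (blast intro: fock_space_scale[of _ _ "\<lambda>_. of_int c"])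
qed

lemma shifts_zero: "shifts 0 k"
proof -
  have "app 0 u = (\<lambda>_. 0)" for u :: "fock \<Rightarrow> 'a" by auto
  then show ?thesis by (simp add: shifts_def fock_space_zero)
qed

lemma shifts_sum: "(\<And>i. i \<in> I \<Longrightarrow> shifts (T i) k) \<Longrightarrow> shifts (\<Sum>i\<in>I. T i) k"
  by (induction I rule: infinite_finite_induct) (simp_all add: shifts_zero shifts_add)

lemma sum_upd: "finite J \<Longrightarrow> int (sum (\<beta>(p := x)) J) = int (sum \<beta> J) + (if p \<in> J then int x - int (\<beta> p) else 0)"
  by (cases "p \<in> J") (simp_all add: sum_fun_upd_notin sum.remove[of J p] fun_upd_same del: fun_upd_apply of_nat_sum)

lemma shifts_an: "p < m + n \<Longrightarrow> shifts (an p) (if p < m then 0 else - 1)"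
proof (rule shifts_ketI, intro exI conjI, rule an_ket, intro impI)
  fix \<beta> F assume *: "p < m + n" "(\<beta>, F) \<in> fock_states" "of_nat (\<beta> p) \<noteq> (0 :: 'a)"
  then have "\<beta> p \<noteq> 0" by (metis of_nat_0)
  then show "(\<beta>(p := \<beta> p - 1), F) \<in> fock_states \<and> deg (\<beta>(p := \<beta> p - 1), F) = deg (\<beta>, F) + (if p < m then 0 else - 1)"
    using * by (auto simp: fock_states_def) (auto simp: deg_def sum_upd simp del: of_nat_sum fun_upd_apply)
qed

lemma shifts_cr: "p < m + n \<Longrightarrow> shifts (cr p) (if p < m then 0 else 1)"
proof (rule shifts_ketI)
  fix \<beta> F assume *: "p < m + n" "(\<beta>, F) \<in> fock_states"
  then show "\<exists>c \<phi>. app (cr p) (ket (\<beta>, F)) = (\<lambda>\<psi>. c * ket \<phi> \<psi> :: 'a) \<and> (c \<noteq> 0 \<longrightarrow> \<phi> \<in> fock_states \<and> deg \<phi> = deg (\<beta>, F) + (if p < m then 0 else 1))"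
    by (intro exI[of _ 1] exI[of _ "(\<beta>(p := Suc (\<beta> p)), F)"]) (auto simp: cr_ket fock_states_def, auto simp: deg_def sum_upd simp del: of_nat_sum fun_upd_apply)
qed

lemma shifts_fan: "p < m + n \<Longrightarrow> shifts (fan p) (if p < m then - 1 else 0)"
proof (rule shifts_ketI, intro exI conjI, rule fan_ket, intro impI)
  fix \<beta> F assume *: "p < m + n" "(\<beta>, F) \<in> fock_states" "(if p \<in> F then sgn_below p F else 0) \<noteq> (0 :: 'a)"
  then have p: "p \<in> F" by (auto split: if_splits)
  have "card ((F - {p}) \<inter> {..<m}) + (if p < m then 1 else 0) = card (F \<inter> {..<m})"
  proof (cases "p < m")
    case True
    have "card (F \<inter> {..<m}) = Suc (card (F \<inter> {..<m} - {p}))" using True p by (intro card.remove) auto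
    moreover have "F \<inter> {..<m} - {p} = (F - {p}) \<inter> {..<m}" by auto
    ultimately show ?thesis using True by simp
  next
    case False
    then have "(F - {p}) \<inter> {..<m} = F \<inter> {..<m}" by auto
    then show ?thesis using False by simp
  qed
  then show "(\<beta>, F - {p}) \<in> fock_states \<and> deg (\<beta>, F - {p}) = deg (\<beta>, F) + (if p < m then - 1 else 0)"
    using * by (auto simp: fock_states_def deg_def simp del: of_nat_sum)
qed

lemma shifts_fcr: "p < m + n \<Longrightarrow> shifts (fcr p) (if p < m then 1 else 0)"
proof (rule shifts_ketI, intro exI conjI, rule fcr_ket, intro impI)
  fix \<beta> F assume *: "p < m + n" "(\<beta>, F) \<in> fock_states" "(if p \<in> F then 0 else sgn_below p F) \<noteq> (0 :: 'a)"
  then have p: "p \<notin> F" by (auto split: if_splits)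
  then have "card (insert p F \<inter> {..<m}) = card (F \<inter> {..<m}) + (if p < m then 1 else 0)"
    by (auto simp: Int_insert_left)
  then show "(\<beta>, insert p F) \<in> fock_states \<and> deg (\<beta>, insert p F) = deg (\<beta>, F) + (if p < m then 1 else 0)"
    using * by (auto simp: fock_states_def deg_def simp del: of_nat_sum)
qed

lemma shifts_par: "shifts eps 0" "shifts yp 0"
  unfolding eps_def yp_def by (rule shifts_ketI, intro exI conjI, rule fpar_ket, simp)+

lemma shifts_ops:
  assumes "p < m + n"
  shows "shifts (dl p) 0" "shifts (hp p) 0" "shifts (io p) (-1)" "shifts (ec p) 1"
proof -
  note an = shifts_an[OF assms] and cr = shifts_cr[OF assms] and fan = shifts_fan[OF assms] and fcr = shifts_fcr[OF assms]
  show "shifts (dl p) 0" using an fan by (cases "p < m") (auto simp: dl_def intro!: shifts_times_right shifts_par)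
  show "shifts (hp p) 0" using cr fcr by (cases "p < m") (auto simp: hp_def intro!: shifts_times_right shifts_par shifts_uminus)
  show "shifts (io p) (-1)" using an fan by (cases "p < m") (auto simp: io_def intro!: shifts_times_right shifts_par)
  show "shifts (ec p) 1" using cr fcr by (cases "p < m") (auto simp: ec_def intro!: shifts_times_right shifts_par)
qed

lemma shifts_diff: "shifts diff (-1)" and shifts_hom: "shifts hom 1"
  unfolding diff_def hom_def
  by (auto intro!: shifts_sum intro: shifts_times[OF shifts_ops(1) shifts_ops(3)] shifts_times[OF shifts_ops(2) shifts_ops(4)])

lemma shifts_mul: "mon_ok f \<Longrightarrow> shifts (mul f) 0"
proof -
  assume f: "mon_ok f"
  have "shifts (shift_up (fst f) :: (fock, 'a) linop) 0"
  proof (rule shifts_ketI)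
    fix \<beta> F assume "(\<beta>, F) \<in> fock_states"
    then show "\<exists>c \<phi>. app (shift_up (fst f)) (ket (\<beta>, F)) = (\<lambda>\<psi>. c * ket \<phi> \<psi> :: 'a) \<and> (c \<noteq> 0 \<longrightarrow> \<phi> \<in> fock_states \<and> deg \<phi> = deg (\<beta>, F) + 0)"
      using f by (intro exI[of _ 1] exI[of _ "(\<lambda>i. fst f i + \<beta> i, F)"]) (auto simp: shift_up_ket fock_states_def deg_def mon_ok_def)
  qed
  moreover have "\<forall>s\<in>set S. s < n \<Longrightarrow> shifts (ywd S :: (fock, 'a) linop) 0" for S
  proof (induction S)
    case (Cons s S)
    then have "shifts (fcr (m + s) :: (fock, 'a) linop) 0" using shifts_fcr[of "m + s"] by simp
    then have "shifts (ym s :: (fock, 'a) linop) 0" unfolding ym_def by (intro shifts_times_right shifts_par)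
    then show ?case using Cons by (auto intro!: shifts_times_right)
  qed (simp add: shifts_one)
  ultimately show ?thesis using f unfolding mul_def by (intro shifts_times[where k = 0 and l = 0]) (auto simp: mon_ok_def)
qed

lemma shifts_xio: "k < m + n \<Longrightarrow> l < m + n \<Longrightarrow> shifts (xio k l) 0"
  unfolding xio_def
  by (intro shifts_add shifts_times[OF shifts_of_int] shifts_times[OF shifts_ops(4) shifts_ops(3)])
    (auto simp: shifts_one shifts_zero intro!: shifts_uminus)

lemma shifts_witt_op:
  assumes f: "valid_rmon m n f" and i: "i < m + n"
  shows "shifts (witt_op f i) 0"
proof -
  have D: "shifts (if i < m then an i else yd (i - m) :: (fock, 'a) linop) 0"
    using shifts_an[OF i] shifts_fan[OF i] i by (auto simp: yd_def intro!: shifts_times_right shifts_par)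
  have xi: "shifts (of_int c * (mul h * (T * xio k i))) 0"
    if "valid_rmon m n h" "k < m + n" "shifts T 0" for c h k and T :: "(fock, 'a) linop"
    using that i by (intro shifts_times_right shifts_of_int shifts_mul shifts_xio mon_ok_valid)
  show ?thesis unfolding witt_op_def
    by (intro shifts_add shifts_sum shifts_times_right shifts_mul mon_ok_valid f D xi valid_rmon_rdx valid_rmon_rdy)
      (auto intro: shifts_one shifts_par)
qed

section \<open>The action of the whole Lie superalgebra\<close>

definition gact :: "(gbas \<Rightarrow> 'k::field) \<Rightarrow> (fock \<Rightarrow> 'k) \<Rightarrow> fock \<Rightarrow> 'k" where
  "gact X u = (\<lambda>\<psi>. \<Sum>gb\<in>{gb. X gb \<noteq> 0}. X gb * app (witt_op (fst gb) (snd gb)) u \<psi>)"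

lemma Gcar_ok: "X \<in> Gcar m n \<Longrightarrow> X gb \<noteq> 0 \<Longrightarrow> valid_rmon m n (fst gb) \<and> snd gb < m + n"
  by (simp add: Gcar_def)

lemma gact_fock_space: "X \<in> Gcar m n \<Longrightarrow> u \<in> fock_space d \<Longrightarrow> gact X u \<in> fock_space d"
proof -
  assume X: "X \<in> Gcar m n" and u: "u \<in> fock_space d"
  have "app (witt_op (fst gb) (snd gb)) u \<in> fock_space d" if "X gb \<noteq> 0" for gb
    using shifts_witt_op[of "fst gb" "snd gb"] Gcar_ok[OF X that] u unfolding shifts_def by force
  then show ?thesis unfolding gact_def by (intro fock_space_sum fock_space_scale) simp
qed

text \<open>The bilinear extension of \<open>act_basis_eq\<close>, after \<open>Phi v\<close> is
  expanded over the finite support of \<open>v\<close>.\<close>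

lemma act_eq:
  assumes X: "X \<in> Gcar m n" and v: "v \<in> Vq m n q"
  shows "act m n X v = Psi (gact X (Phi v))"
proof
  fix b
  have fin: "finite {b. v b \<noteq> 0}" using v by (simp add: Vq_def)
  have Phi_v: "Phi v = (\<lambda>\<psi>. \<Sum>b\<in>{b. v b \<noteq> 0}. v b * kb b \<psi>)"
  proof
    fix \<psi>
    show "Phi v \<psi> = (\<Sum>b\<in>{b. v b \<noteq> 0}. v b * kb b \<psi>)"
    proof (cases "\<psi> \<in> enc ` {b. vb_ok b}")
      case True
      then obtain c where c: "vb_ok c" "\<psi> = enc c" by auto
      have "(\<Sum>b\<in>{b. v b \<noteq> 0}. v b * kb b \<psi>) = (\<Sum>b\<in>{b. v b \<noteq> 0}. if b = c then v b else 0)"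
        using Vq_ok[OF v] c inj_onD[OF inj_enc] by (intro sum.cong) (auto simp: ket_def)
      then show ?thesis using fin c by (simp add: Phi_enc)
    next
      case False
      then have "kb b \<psi> = (0 :: 'a)" if "v b \<noteq> 0" for b using Vq_ok[OF v that] by (auto simp: ket_def)
      then show ?thesis using False by (simp add: Phi_outside)
    qed
  qed
  have "act m n X v b = (\<Sum>gb\<in>{gb. X gb \<noteq> 0}. \<Sum>vb\<in>{vb. v vb \<noteq> 0}. X gb * (v vb * Psi (app (witt_op (fst gb) (snd gb)) (kb vb)) b))"
    unfolding act_def
  proof (intro sum.cong refl)
    fix gb vb assume "gb \<in> {gb. X gb \<noteq> 0}" "vb \<in> {vb. v vb \<noteq> 0}"
    then show "X gb * v vb * act_basis m n gb vb b = X gb * (v vb * Psi (app (witt_op (fst gb) (snd gb)) (kb vb)) b)"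
      using Gcar_ok[OF X, of gb] Vq_ok[OF v, of vb] act_basis_eq[of "fst gb" "snd gb" vb b] by simp
  qed
  also have "\<dots> = Psi (gact X (Phi v)) b"
    by (cases "vb_ok b") (simp_all add: Psi_def gact_def Phi_v app_sum app_scale sum_distrib_left)
  finally show "act m n X v b = Psi (gact X (Phi v)) b" .
qed

lemma act_Vq: "X \<in> Gcar m n \<Longrightarrow> v \<in> Vq m n q \<Longrightarrow> act m n X v \<in> Vq m n q"
  by (simp add: act_eq Psi_fock_space gact_fock_space Phi_fock_space)

lemma Phi_act: "X \<in> Gcar m n \<Longrightarrow> v \<in> Vq m n q \<Longrightarrow> Phi (act m n X v) = gact X (Phi v)"
  by (simp add: act_eq Phi_Psi[OF gact_fock_space[OF _ Phi_fock_space]])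

lemma diff_gact: "X \<in> Gcar m n \<Longrightarrow> app diff (gact X u) = gact X (app diff (u :: fock \<Rightarrow> 'k::field_char_0))"
proof -
  assume X: "X \<in> Gcar m n"
  have "app diff (app (witt_op (fst gb) (snd gb)) u) = app (witt_op (fst gb) (snd gb)) (app diff u)" if "X gb \<noteq> 0" for gb
    using diff_witt_op[of "fst gb" "snd gb", where 'k='k] Gcar_ok[OF X that] mon_ok_valid by (metis app_simps(6))
  then show ?thesis by (simp add: gact_def app_sum app_scale)
qed

end

lemma app_uminus: "app T (\<lambda>b. - u b) = (\<lambda>b. - app T u b)"
  using app_scale[of T "- 1" u] by simp

section \<open>The generating vector\<close>

lemma count_list_eq_length: "count_list w p = length w \<Longrightarrow> w = replicate (length w) p"
proof (induction w)
  case (Cons a w)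
  then show ?case using count_le_length[of w p] by (auto split: if_splits)
qed simp

lemma count_list_replicate: "count_list (replicate k p) r = (if r = p then k else 0)"
  by (induction k) auto

lemma strict_sorted_max_last:
  assumes "sorted_wrt (<) S" "\<forall>s\<in>set S. s < n" "n - 1 \<in> set S"
  obtains S' where "S = S' @ [n - 1 :: nat]"
proof -
  have "S \<noteq> []" using assms(3) by auto
  then have S: "S = butlast S @ [last S]" by simp
  then have "\<forall>s\<in>set (butlast S). s < last S" using assms(1) by (metis list.set_intros(1) sorted_wrt_append)
  moreover have "last S < n" using assms(2) \<open>S \<noteq> []\<close> by simp
  ultimately have "n - 1 \<notin> set (butlast S)" by auto
  then have "last S = n - 1" using assms(3) S by (metis Un_iff empty_iff empty_set set_ConsD set_append)
  then show ?thesis using S that by metis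
qed

declare One_nat_def [simp del]

section \<open>The normalised differential\<close>

context witt
begin

definition dq :: "nat \<Rightarrow> (vbas \<Rightarrow> 'k::field_char_0) \<Rightarrow> vbas \<Rightarrow> 'k" where
  "dq q v = (if q = 0 then vzero else Psi (\<lambda>\<phi>. (- 1 / of_nat q) * app diff (Phi v) \<phi>))"

lemma diff_fock_space: "u \<in> fock_space (int q) \<Longrightarrow> 1 \<le> q \<Longrightarrow> app diff u \<in> fock_space (int (q - 1))"
  using shifts_diff by (force simp: shifts_def of_nat_diff)

lemma dq_Vq: "1 \<le> q \<Longrightarrow> v \<in> Vq m n q \<Longrightarrow> dq q v \<in> Vq m n (q - 1)"
  unfolding dq_def using Psi_fock_space[OF fock_space_scale[OF diff_fock_space[OF Phi_fock_space]], of v q "\<lambda>_. - 1 / of_nat q"] by simp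

lemma Phi_dq: "1 \<le> q \<Longrightarrow> v \<in> Vq m n q \<Longrightarrow> Phi (dq q v) = (\<lambda>\<phi>. (- 1 / of_nat q) * app diff (Phi v) \<phi>)"
  unfolding dq_def using Phi_Psi[OF fock_space_scale[OF diff_fock_space[OF Phi_fock_space]], of v q "\<lambda>_. - 1 / of_nat q"] by simp

lemma gact_scale: "gact X (\<lambda>\<phi>. c * u \<phi>) = (\<lambda>\<phi>. c * gact X u \<phi>)"
  by (simp add: gact_def app_scale sum_distrib_left mult.left_commute)

lemma dq_gmap: "1 \<le> q \<Longrightarrow> gmap m n (Vq m n q) (Vq m n (q - 1)) (dq q)"
  unfolding gmap_def
proof (intro conjI ballI allI)
  assume q: "1 \<le> q"
  fix u v :: "vbas \<Rightarrow> 'a" assume u: "u \<in> Vq m n q"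
  show "dq q u \<in> Vq m n (q - 1)" using q u by (rule dq_Vq)
  show "dq q (\<lambda>b. u b + v b) = (\<lambda>b. dq q u b + dq q v b)"
    using q by (simp add: dq_def Phi_lin app_add distrib_left Psi_lin(1)[symmetric])
  show "dq q (\<lambda>b. c * u b) = (\<lambda>b. c * dq q u b)" for c
    using q by (simp add: dq_def Phi_lin app_scale Psi_lin(2)[symmetric] mult.left_commute)
  fix X :: "gbas \<Rightarrow> 'a" assume X: "X \<in> Gcar m n"
  have "act m n X (dq q u) = Psi (gact X (\<lambda>\<phi>. (- 1 / of_nat q) * app diff (Phi u) \<phi>))"
    using act_eq[OF X dq_Vq[OF q u]] by (simp add: Phi_dq[OF q u])
  also have "\<dots> = Psi (\<lambda>\<phi>. (- 1 / of_nat q) * app diff (gact X (Phi u)) \<phi>)"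
    unfolding gact_scale diff_gact[OF X] ..
  also have "\<dots> = dq q (act m n X u)" using q by (simp add: dq_def Phi_act[OF X u])
  finally show "dq q (act m n X u) = act m n X (dq q u)" ..
qed

definition lst :: nat where "lst = m + n - 1"

lemma lst: "1 \<le> n \<Longrightarrow> m \<le> lst \<and> \<not> lst < m \<and> lst < m + n \<and> lst - m = n - 1 \<and> m + (n - 1) = lst"
  by (auto simp: lst_def)

lemma vb_ok_power: "1 \<le> n \<Longrightarrow> valid_rmon m n g \<Longrightarrow> vb_ok (g, replicate q lst)"
  using lst by (auto simp: vb_ok_def valid_omon_def filter_replicate)

lemma io_power:
  assumes "1 \<le> n"
  shows "app (io k) (kb (g, replicate q lst)) = (\<lambda>\<psi>. (if k = lst then of_nat q else 0) * kb (g, replicate (q - 1) lst) \<psi> :: 'k::field)"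
proof (cases "k < m")
  case True
  then have "k \<notin> snd (enc (g, replicate q lst))" using lst[OF assms] by (auto simp: enc_def)
  then show ?thesis using True lst[OF assms] fan_ket[of k "fst (enc (g, replicate q lst))" "snd (enc (g, replicate q lst))", where 'k='k]
    by (auto simp: io_def)
next
  case False
  have "snd (enc (g, replicate q lst)) \<inter> {..<m} = {}" using lst[OF assms] by (auto simp: enc_below)
  moreover have "fst (enc (g, replicate q lst)) k = (if k = lst then q else 0)"
    using False by (auto simp: enc_def count_list_replicate)
  moreover have "k = lst \<Longrightarrow> ((fst (enc (g, replicate q lst))) (k := fst (enc (g, replicate q lst)) k - 1), snd (enc (g, replicate q lst))) = enc (g, replicate (q - 1) lst)"
    using lst[OF assms] by (auto simp: enc_def fun_eq_iff count_list_replicate)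
  ultimately show ?thesis using False
    an_ket[of k "fst (enc (g, replicate q lst))" "snd (enc (g, replicate q lst))", where 'k='k]
    fpar_ket[of "{..<m}" "fst (enc (g, replicate q lst))" "snd (enc (g, replicate q lst))", where 'k='k]
    by (auto simp: io_def eps_def)
qed

text \<open>Only the index \<open>lst\<close> contributes: contraction gives the factor
  \<open>q\<close>, and \<open>yp\<close> gives -1 on the single y. The normalisation -1/q in
  \<open>dq\<close> is chosen to cancel both.\<close>

lemma dq_gen:
  assumes n: "1 \<le> n" and q: "1 \<le> q"
  shows "dq q (gen_vec m n q) = (gen_img m n q :: vbas \<Rightarrow> 'k::field_char_0)"
proof -
  let ?g = "(\<lambda>_. 0, [n - 1]) :: rmon" and ?w = "replicate q lst" and ?w' = "replicate (q - 1) lst"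
  have g: "valid_rmon m n ?g" "valid_rmon m n (\<lambda>_. 0, [])" using n by (auto simp: valid_rmon_def)
  have Phi: "Phi (gen_vec m n q) = (kb (?g, ?w) :: fock \<Rightarrow> 'k)"
    unfolding gen_vec_def lst_def[symmetric] by (rule Phi_single[OF vb_ok_power[OF n g(1)]])
  have "app (dl p * io p) (kb (?g, ?w)) = (\<lambda>\<psi>. if p = lst then - of_nat q * kb ((\<lambda>_. 0, []), ?w') \<psi> else (0 :: 'k))" for p
  proof (cases "p = lst")
    case True
    have "dl lst = yd (n - 1) * (yp :: (fock, 'k) linop)" using lst[OF n] by (simp add: dl_def yd_def)
    moreover have "rdy (n - 1) ?g = (1, (\<lambda>_. 0, []))" by (simp add: rdy_def)
    ultimately show ?thesis using True by (simp add: io_power[OF n] app_scale app_uminus yp_kb[OF g(1)] yd_kb[OF g(1)])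
  next
    case False
    then show ?thesis by (simp add: io_power[OF n] app_zero)
  qed
  then have "app diff (kb (?g, ?w)) = (\<lambda>\<psi>. - of_nat q * kb ((\<lambda>_. 0, []), ?w') \<psi> :: 'k)"
    using lst[OF n] by (auto simp: diff_def fun_eq_iff simp del: app_simps(6))
  then have "dq q (gen_vec m n q) = Psi (kb ((\<lambda>_. 0, []), ?w') :: fock \<Rightarrow> 'k)"
    using q by (simp add: dq_def Phi)
  also have "\<dots> = gen_img m n q"
    using Psi_kb[OF vb_ok_power[OF n g(2)], of "q - 1", where 'k='k] by (auto simp: gen_img_def single_def fun_eq_iff lst_def)
  finally show ?thesis .
qed

text \<open>The derivative of y_n is 1, which gives the first term. Of the operators
  \<open>xio k lst\<close> only \<open>k = lst\<close> acts on a pure power, by -(q + 1): -q from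
  the derivation and -1 from the weight.\<close>

lemma witt_op_last_power:
  assumes n: "1 \<le> n" and q: "1 \<le> q" and f: "valid_rmon m n f"
  shows "app (witt_op f lst) (kb ((\<lambda>_. 0, [n - 1]), replicate q lst)) =
    (\<lambda>\<psi>. kb (f, replicate q lst) \<psi> + of_int ((-1) ^ length (snd f) * fst (rdy (n - 1) f)) * of_nat (q + 1) *
       app (mul (snd (rdy (n - 1) f))) (kb ((\<lambda>_. 0, [n - 1]), replicate q lst)) \<psi> :: 'k::field)"
proof -
  let ?g = "(\<lambda>_. 0, [n - 1]) :: rmon" and ?w = "replicate q lst"
  have g: "valid_rmon m n ?g" "valid_rmon m n (\<lambda>_. 0, [])" using n by (auto simp: valid_rmon_def)
  have last: "\<not> lst < m" "lst - m = n - 1" using lst[OF n] by auto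
  have "front_sign m lst (replicate (q - 1) lst) = 1" using last by (simp add: front_sign_def)
  moreover have "lst # replicate (q - 1) lst = ?w" using q by (cases q) auto
  moreover have "distinct (filter (\<lambda>p. p < m) (replicate (q - 1) lst))" using last by (simp add: filter_replicate)
  ultimately have ec: "app (ec lst) (kb (?g, replicate (q - 1) lst)) = (kb (?g, ?w) :: fock \<Rightarrow> 'k)"
    using ec_kb[of "replicate (q - 1) lst" lst ?g, where 'k='k] by simp
  have xio: "app (xio k lst) (kb (?g, ?w)) = (\<lambda>\<psi>. (if k = lst then - of_nat (q + 1) else 0) * kb (?g, ?w) \<psi> :: 'k)" for k
    using last by (auto simp: fun_eq_iff xio_def io_power[OF n] app_scale ec app_zero ipar_def algebra_simps)
  have first: "app (mul f * yd (n - 1)) (kb (?g, ?w)) = (kb (f, ?w) :: fock \<Rightarrow> 'k)"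
  proof -
    have "rdy (n - 1) ?g = (1, (\<lambda>_. 0, []))" by (simp add: rdy_def)
    moreover have "rmul f (\<lambda>_. 0, []) = (1, f)" using f
      by (simp add: rmul_def ysign_sorted valid_rmon_def strict_sorted_iff sorted_sort_id)
    ultimately show ?thesis by (simp add: yd_kb[OF g(1)] mul_kb[OF f g(2)])
  qed
  have zero: "app (of_int c * (mul h * (T * xio k lst))) (kb (?g, ?w)) = (\<lambda>\<psi>. 0 :: 'k)" if "k \<noteq> lst" for c h T k
    using that by (simp add: xio app_zero fun_eq_iff)
  have "j < n \<Longrightarrow> m + j = lst \<longleftrightarrow> j = n - 1" for j using n by (auto simp: lst_def)
  then have third: "app (of_int c * (mul h * (1 * xio (m + j) lst))) (kb (?g, ?w)) =
     (\<lambda>\<psi>. if j = n - 1 then - of_int c * of_nat (q + 1) * app (mul h) (kb (?g, ?w)) \<psi> else 0 :: 'k)" if "j < n" for c h j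
    using that by (auto simp: xio app_zero app_scale fun_eq_iff algebra_simps)
  have "app (witt_op f lst) (kb (?g, ?w)) = (\<lambda>\<psi>. app (mul f * yd (n - 1)) (kb (?g, ?w)) \<psi>
    + (\<Sum>j<m. app (of_int (fst (rdx j f)) * (mul (snd (rdx j f)) * (yp * xio j lst))) (kb (?g, ?w)) \<psi>)
    + (\<Sum>j<n. app (of_int ((-1) ^ (length (snd f) + 1) * fst (rdy j f)) * (mul (snd (rdy j f)) * (1 * xio (m + j) lst))) (kb (?g, ?w)) \<psi>) :: 'k)"
    unfolding witt_op_def using last by (simp only: app_simps app_sum_left fun_eq_iff if_False) simp
  moreover have "(\<Sum>j<m. app (of_int (fst (rdx j f)) * (mul (snd (rdx j f)) * (yp * xio j lst))) (kb (?g, ?w)) \<psi>) = (0 :: 'k)" for \<psi>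
  proof (intro sum.neutral ballI)
    fix j assume "j \<in> {..<m}"
    then have "j \<noteq> lst" using last by auto
    from fun_cong[OF zero[OF this]]
    show "app (of_int (fst (rdx j f)) * (mul (snd (rdx j f)) * (yp * xio j lst))) (kb (?g, ?w)) \<psi> = (0 :: 'k)" .
  qed
  moreover have "(\<Sum>j<n. app (of_int ((-1) ^ (length (snd f) + 1) * fst (rdy j f)) * (mul (snd (rdy j f)) * (1 * xio (m + j) lst))) (kb (?g, ?w)) \<psi>)
    = (\<Sum>j<n. if j = n - 1 then - of_int ((-1) ^ (length (snd f) + 1) * fst (rdy j f)) * of_nat (q + 1) * app (mul (snd (rdy j f))) (kb (?g, ?w)) \<psi> else (0 :: 'k))" for \<psi>
    by (intro sum.cong refl) (simp only: third lessThan_iff)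
  ultimately show ?thesis unfolding first using n by (simp add: fun_eq_iff power_add)
qed

end

context witt
begin

lemma shift_up_zero: "shift_up (\<lambda>_. 0) = (1 :: (fock, 'k::field) linop)"
  by (rule linop_eqI) (auto simp: shift_up_def)

text \<open>The only nonzero derivative of y_n is D_n(y_n) = 1, so a single \<xi>-term
  remains.\<close>

lemma witt_op_y_last:
  assumes n: "1 \<le> n" and l: "l \<noteq> lst"
  shows "witt_op (\<lambda>_. 0, [n - 1]) l = ym (n - 1) * (if l < m then an l else yd (l - m))
     + (if l < m then yp else 1) * (xio lst l :: (fock, 'k::field) linop)"
proof -
  have rdy: "rdy j (\<lambda>_. 0, [n - 1]) = (if j = n - 1 then 1 else 0, (\<lambda>_. 0, if j = n - 1 then [] else [n - 1]))" for j
    by (auto simp: rdy_def)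
  have "(\<Sum>j<n. of_int ((-1) ^ 2 * (if j = n - 1 then 1 else 0)) * (mul (\<lambda>_. 0, if j = n - 1 then [] else [n - 1]) * ((if l < m then yp else 1) * xio (m + j) l)))
     = (\<Sum>j<n. if j = n - 1 then (if l < m then yp else 1) * xio (m + j) l else (0 :: (fock, 'k) linop))"
    by (intro sum.cong) (auto simp: mul_def shift_up_zero)
  also have "\<dots> = (if l < m then yp else 1) * xio lst l" using n lst[OF n] by simp
  finally show ?thesis
    by (simp add: witt_op_def rdy rdx_def) (simp add: mul_def shift_up_zero)
qed

text \<open>The state \<open>(\<beta>', F')\<close> is \<open>(\<beta>, F)\<close> with one factor
  e*_l turned back into the last e*. The \<xi>-term undoes this up to a coefficient that is nonzero
  in characteristic 0.\<close>

lemma replace_last_ket: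
  assumes n: "1 \<le> n" and l: "l \<noteq> lst" "l < m \<and> l \<in> F \<or> m \<le> l \<and> \<beta> l \<noteq> 0"
    and \<beta>': "\<beta>' = (if l < m then \<beta> else \<beta>(l := \<beta> l - 1))(lst := Suc (\<beta> lst))" and F': "F' = (if l < m then F - {l} else F)"
  obtains c :: "'k::field_char_0" where "c \<noteq> 0"
    "app ((if l < m then yp else 1) * xio lst l) (ket (\<beta>', F')) = (\<lambda>\<psi>. c * ket (\<beta>, F) \<psi>)"
proof -
  let ?s = "of_int (- ((-1) ^ ((ipar m lst + ipar m l) * ipar m lst))) :: 'k"
  have xio: "app (xio lst l) v = (\<lambda>\<psi>. ?s * app (ec l) (app (io lst) v) \<psi>)" for v
    using l(1) by (auto simp: xio_def fun_eq_iff)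
  have \<beta>'_last: "\<beta>'(lst := \<beta>' lst - 1) = (if l < m then \<beta> else \<beta>(l := \<beta> l - 1))" using l by (auto simp: \<beta>' fun_eq_iff)
  have io: "app (io lst) (ket (\<beta>', F')) = (\<lambda>\<psi>. ((-1) ^ card (F' \<inter> {..<m}) * of_nat (Suc (\<beta> lst))) * ket (if l < m then \<beta> else \<beta>(l := \<beta> l - 1), F') \<psi> :: 'k)"
    unfolding \<beta>'_last[symmetric] using lst[OF n]
    by (simp add: io_def eps_def fpar_ket an_ket app_scale mult.assoc) (simp add: \<beta>')
  have "\<exists>e. e \<noteq> 0 \<and> app (ec l) (ket (if l < m then \<beta> else \<beta>(l := \<beta> l - 1), F')) = (\<lambda>\<psi>. e * ket (\<beta>, F) \<psi> :: 'k)"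
  proof (cases "l < m")
    case True
    then have "insert l F' = F" "l \<notin> F'" using l by (auto simp: F')
    then show ?thesis using True by (intro exI[of _ "sgn_below l F'"]) (auto simp: ec_def fcr_ket sgn_below_def)
  next
    case False
    then have "(\<beta>(l := \<beta> l - 1))(l := Suc ((\<beta>(l := \<beta> l - 1)) l)) = \<beta>" using l by (auto simp: fun_eq_iff)
    then show ?thesis using False
      by (intro exI[of _ "(-1) ^ card (F' \<inter> {..<m})"]) (simp add: ec_def eps_def fpar_ket cr_ket app_scale F' del: fun_upd_apply)
  qed
  then obtain e where e: "e \<noteq> 0" "app (ec l) (ket (if l < m then \<beta> else \<beta>(l := \<beta> l - 1), F')) = (\<lambda>\<psi>. e * ket (\<beta>, F) \<psi> :: 'k)" by blast
  let ?c = "(if l < m then (-1) ^ card (F \<inter> {m..<m+n}) else 1) * (?s * ((-1) ^ card (F' \<inter> {..<m}) * of_nat (Suc (\<beta> lst)) * e))"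
  show ?thesis
  proof (rule that[of ?c])
    have "?s \<noteq> 0" by simp
    moreover have "of_nat (Suc (\<beta> lst)) \<noteq> (0 :: 'k)" using of_nat_eq_0_iff by blast
    ultimately show "?c \<noteq> 0" using e(1) by (simp del: of_nat_Suc)
    show "app ((if l < m then yp else 1) * xio lst l) (ket (\<beta>', F')) = (\<lambda>\<psi>. ?c * ket (\<beta>, F) \<psi>)"
      by (simp add: xio io app_scale app_uminus e(2) yp_def fpar_ket mult.assoc mult.left_commute)
  qed
qed

text \<open>The derivative term changes only the ring part, so the number of last e*'s is preserved
  and the result belongs to the states that an induction on this number has already reached.\<close>

lemma y_partial_ket:
  assumes n: "1 \<le> n" and l: "l \<noteq> lst"
  obtains c :: "'k::field_char_0" and \<phi> where "fst \<phi> lst = \<beta> lst"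
    "app (ym (n - 1) * (if l < m then an l else yd (l - m))) (ket (\<beta>, F)) = (\<lambda>\<psi>. c * ket \<phi> \<psi>)"
proof (cases "l < m")
  case True
  then show ?thesis using l
    by (intro that[rotated]) (auto simp: ym_def eps_def app_scale an_ket fpar_ket fcr_ket mult.assoc[symmetric])
next
  case False
  then show ?thesis using l
    by (intro that[rotated]) (auto simp: ym_def yd_def eps_def app_scale fan_ket fpar_ket fcr_ket mult.assoc[symmetric])
qed

lemma fock_space_ketD:
  assumes "(\<lambda>\<psi>. c * ket \<phi> \<psi>) \<in> fock_space d" "c \<noteq> (0 :: 'k::field)"
  shows "\<phi> \<in> fock_states \<and> deg \<phi> = d"
proof -
  have "c * ket \<phi> \<phi> \<noteq> 0" using assms(2) by (simp add: ket_def)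
  then show ?thesis using assms(1) unfolding fock_space_def by blast
qed

lemma gen_vec_generates:
  assumes n: "1 \<le> n" and q: "1 \<le> q" and W: "submodule m n q (W :: (vbas \<Rightarrow> 'k::field_char_0) set)" and gen: "gen_vec m n q \<in> W"
  shows "W = Vq m n q"
proof
  show "W \<subseteq> Vq m n q" using W by (simp add: submodule_def)
  \<comment> \<open>The submodule transported to Fock space, where the operators
    \<open>witt_op\<close> act.\<close>
  define W' where "W' = {u \<in> fock_space (int q). Psi u \<in> W}"
  have W'_add: "(\<lambda>\<phi>. u \<phi> + v \<phi>) \<in> W'" if "u \<in> W'" "v \<in> W'" for u v
    using that W by (simp add: W'_def fock_space_add Psi_lin submodule_def)
  have W'_scale: "(\<lambda>\<phi>. c * u \<phi>) \<in> W'" if "u \<in> W'" for u c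
    using that W fock_space_scale[of u _ "\<lambda>_. c"] by (simp add: W'_def Psi_lin submodule_def)
  have W'_zero: "(\<lambda>_. 0) \<in> W'"
  proof -
    have "Psi (\<lambda>_. 0) = (vzero :: vbas \<Rightarrow> 'k)" by (auto simp: Psi_def vzero_def)
    then show ?thesis using W by (simp add: W'_def fock_space_zero submodule_def)
  qed
  have W'_ket: "ket \<phi> \<in> W'" if "(\<lambda>\<psi>. u \<psi> + c * ket \<phi> \<psi>) \<in> W'" "u \<in> W'" "c \<noteq> 0" for u c \<phi>
  proof -
    have "(\<lambda>\<psi>. inverse c * ((u \<psi> + c * ket \<phi> \<psi>) + - 1 * u \<psi>)) \<in> W'"
      by (rule W'_scale[OF W'_add[OF that(1) W'_scale[OF that(2), of "- 1"]]])
    moreover have "(\<lambda>\<psi>. inverse c * ((u \<psi> + c * ket \<phi> \<psi>) + - 1 * u \<psi>)) = ket \<phi>"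
      using that(3) by (simp add: fun_eq_iff)
    ultimately show ?thesis by simp
  qed
  have W'_sum: "(\<lambda>\<psi>. \<Sum>i\<in>I. u i \<psi>) \<in> W'" if "\<And>i. i \<in> I \<Longrightarrow> u i \<in> W'" for I and u :: "fock \<Rightarrow> fock \<Rightarrow> 'k"
    using that by (induction I rule: infinite_finite_induct) (simp_all add: W'_zero W'_add)
  have W'_witt_op: "app (witt_op f i) u \<in> W'" if u: "u \<in> W'" and f: "valid_rmon m n f" and i: "i < m + n" for u f i
  proof -
    define X :: "gbas \<Rightarrow> 'k" where "X = (\<lambda>g. if g = (f, i) then 1 else 0)"
    have supp: "{g. X g \<noteq> 0} = {(f, i)}" by (auto simp: X_def)
    then have X: "X \<in> Gcar m n" using f i by (auto simp: Gcar_def X_def)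
    have gact: "gact X v = app (witt_op f i) v" for v by (auto simp: gact_def supp X_def)
    have "act m n X (Psi u) \<in> W" using u W X by (simp add: W'_def submodule_def)
    also have "act m n X (Psi u) = Psi (app (witt_op f i) u)"
      using act_eq[OF X, of "Psi u" q] u by (simp add: W'_def Psi_fock_space Phi_Psi[of u "int q"] gact)
    finally show ?thesis using shifts_witt_op[OF f i] u unfolding W'_def shifts_def by fastforce
  qed
  let ?g = "(\<lambda>_. 0, [n - 1]) :: rmon"
  have g: "valid_rmon m n ?g" using n by (auto simp: valid_rmon_def)
  have kb_W': "(kb b \<in> W') = (single b \<in> W)" if "vb_ok b" "length (snd b) = q" for b
  proof -
    have "(kb b :: fock \<Rightarrow> 'k) \<in> fock_space (int q)" using fock_space_ket[OF enc_fock_states[OF that(1)]] deg_enc[OF that(1)] that(2) by simp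
    moreover have "Psi (kb b) = (single b :: vbas \<Rightarrow> 'k)" by (rule ext) (simp add: single_def Psi_kb[OF that(1)])
    ultimately show ?thesis by (simp add: W'_def)
  qed
  have gen': "kb (?g, replicate q lst) \<in> W'"
    using gen kb_W'[OF vb_ok_power[OF n g]] by (simp add: gen_vec_def lst_def)
  have power: "kb (f, replicate q lst) \<in> W'" if f: "valid_rmon m n f" for f
  proof -
    have step: "app (witt_op f lst) (kb (?g, replicate q lst)) \<in> W'" using W'_witt_op[OF gen' f] lst[OF n] by simp
    show ?thesis
    proof (cases "n - 1 \<in> set (snd f)")
      case False
      then have "fst (rdy (n - 1) f) = 0" by (simp add: rdy_def)
      then show ?thesis using step by (simp add: witt_op_last_power[OF n q f])
    next
      case True
      obtain a S where fS: "f = (a, S)" by fastforce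
      obtain S' where S': "S = S' @ [n - 1]"
        using strict_sorted_max_last[of S n] f True by (auto simp: fS valid_rmon_def)
      have sorted: "n - 1 \<notin> set S'" "sorted_wrt (<) S" using f by (auto simp: fS valid_rmon_def S' sorted_wrt_append)
      from sorted(1) have "takeWhile (\<lambda>s. s \<noteq> n - 1) (S' @ [n - 1]) = S'" by (subst takeWhile_append2) auto
      then have rdy: "rdy (n - 1) f = ((-1) ^ length S', (a, S'))"
        using sorted(1) by (auto simp: rdy_def fS S' remove1_append)
      have "valid_rmon m n (a, S')" using f by (auto simp: fS valid_rmon_def S' sorted_wrt_append)
      then have "app (mul (a, S')) (kb (?g, replicate q lst)) = (\<lambda>\<psi>. of_int (fst (rmul (a, S') ?g)) * kb (snd (rmul (a, S') ?g), replicate q lst) \<psi> :: 'k)"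
        using g by (rule mul_kb)
      also have "rmul (a, S') ?g = (1, f)" using sorted(2)
        by (simp add: rmul_def fS S'[symmetric] ysign_sorted strict_sorted_iff sorted_sort_id)
      \<comment> \<open>With y_n in \<open>f\<close> the second term is -(q + 1) times the first, so
        the total coefficient is -q, nonzero since \<open>q \<ge> 1\<close>.\<close>
      finally have "app (witt_op f lst) (kb (?g, replicate q lst)) = (\<lambda>\<psi>. - of_nat q * kb (f, replicate q lst) \<psi> :: 'k)"
        unfolding witt_op_last_power[OF n q f] rdy by (simp add: fS S' fun_eq_iff algebra_simps flip: power_add mult_2)
      then have "(\<lambda>\<psi>. 0 + (- of_nat q) * kb (f, replicate q lst) \<psi>) \<in> W'" using step by simp
      moreover have "- of_nat q \<noteq> (0 :: 'k)" using q by simp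
      ultimately show ?thesis by (rule W'_ket[OF _ W'_zero])
    qed
  qed
  \<comment> \<open>\<open>k\<close> counts the e*'s other than the last one; \<open>k = 0\<close>
    is the case of pure powers.\<close>
  have ket_W': "ket (\<beta>, F) \<in> W'" if "(\<beta>, F) \<in> fock_states" "deg (\<beta>, F) = int q" "\<beta> lst + k = q" for k \<beta> F
    using that
  proof (induction k arbitrary: \<beta> F)
    case 0
    obtain b where b: "vb_ok b" "enc b = (\<beta>, F)" using fock_states_enc[OF 0(1)] by blast
    have len: "length (snd b) = q" using deg_enc[OF b(1)] 0 b by simp
    moreover have "count_list (snd b) lst = q" using 0 b lst[OF n] by (auto simp: enc_def)
    ultimately have "snd b = replicate q lst" using count_list_eq_length by metis
    then have "b = (fst b, replicate q lst)" by (simp add: prod_eq_iff)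
    moreover have "valid_rmon m n (fst b)" using b by (simp add: vb_ok_def)
    ultimately show ?case using power b by metis
  next
    case (Suc k)
    note fock_states = Suc.prems(1) and deg = Suc.prems(2)
    \<comment> \<open>Otherwise the degree \<open>q\<close> would equal \<open>\<beta> lst\<close>,
      contrary to \<open>k\<close> being a successor.\<close>
    have "\<exists>l<m+n. l \<noteq> lst \<and> (l < m \<and> l \<in> F \<or> m \<le> l \<and> \<beta> l \<noteq> 0)"
    proof (rule ccontr)
      assume "\<not> ?thesis"
      then have none: "l \<noteq> lst \<Longrightarrow> l < m + n \<Longrightarrow> \<not> (l < m \<and> l \<in> F) \<and> \<not> (m \<le> l \<and> \<beta> l \<noteq> 0)" for l by blast
      have "F \<inter> {..<m} = {}" using none lst[OF n] by fastforce
      moreover have "sum \<beta> {m..<m+n} = \<beta> lst"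
      proof -
        have "sum \<beta> {m..<m+n} = \<beta> lst + sum \<beta> ({m..<m+n} - {lst})" using lst[OF n] by (intro sum.remove) auto
        also have "sum \<beta> ({m..<m+n} - {lst}) = 0" using none by (intro sum.neutral) auto
        finally show ?thesis by simp
      qed
      ultimately show False using deg Suc.prems(3) by (simp add: deg_def del: of_nat_sum)
    qed
    then obtain l where l: "l < m + n" "l \<noteq> lst" "l < m \<and> l \<in> F \<or> m \<le> l \<and> \<beta> l \<noteq> 0" by blast
    define \<beta>' where "\<beta>' = (if l < m then \<beta> else \<beta>(l := \<beta> l - 1))(lst := Suc (\<beta> lst))"
    define F' where "F' = (if l < m then F - {l} else F)"
    obtain c :: 'k where c: "c \<noteq> 0" "app ((if l < m then yp else 1) * xio lst l) (ket (\<beta>', F')) = (\<lambda>\<psi>. c * ket (\<beta>, F) \<psi>)"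
      using replace_last_ket[OF n l(2,3) \<beta>'_def F'_def] by metis
    have fock_states': "(\<beta>', F') \<in> fock_states" using fock_states l lst[OF n] by (auto simp: fock_states_def \<beta>'_def F'_def)
    have deg': "deg (\<beta>', F') = int q"
    proof (cases "l < m")
      case True
      have "card (F \<inter> {..<m}) = Suc (card (F \<inter> {..<m} - {l}))" using True l by (intro card.remove) auto
      moreover have "F \<inter> {..<m} - {l} = (F - {l}) \<inter> {..<m}" by auto
      ultimately show ?thesis using True deg lst[OF n]
        by (simp add: deg_def \<beta>'_def F'_def sum_upd del: of_nat_sum fun_upd_apply)
    next
      case False
      then show ?thesis using deg lst[OF n] l
        by (simp add: deg_def \<beta>'_def F'_def sum_upd fun_upd_other del: of_nat_sum fun_upd_apply)
    qed
    have \<beta>'_lst: "\<beta>' lst = Suc (\<beta> lst)" by (simp add: \<beta>'_def)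
    have IH: "ket (\<gamma>, G) \<in> W'" if "(\<gamma>, G) \<in> fock_states" "deg (\<gamma>, G) = int q" "\<gamma> lst = Suc (\<beta> lst)" for \<gamma> G
      using Suc.IH[of \<gamma> G] that Suc.prems(3) by simp
    have ket': "ket (\<beta>', F') \<in> W'" using IH fock_states' deg' \<beta>'_lst by blast
    define T :: "(fock, 'k) linop" where "T = ym (n - 1) * (if l < m then an l else yd (l - m))"
    have T_W': "app T (ket (\<beta>', F')) \<in> W'"
    proof -
      obtain e \<phi> where e: "fst \<phi> lst = \<beta>' lst" "app T (ket (\<beta>', F')) = (\<lambda>\<psi>. e * ket \<phi> \<psi>)"
        unfolding T_def using y_partial_ket[OF n l(2)] by metis
      have "shifts T 0"
        unfolding T_def ym_def using shifts_fcr[of "m + (n - 1)"] shifts_an[OF l(1)] shifts_fan[OF l(1)] n l(1) lst[OF n]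
        by (intro shifts_times_right) (auto simp: yd_def intro!: shifts_times_right shifts_par)
      moreover have "(ket (\<beta>', F') :: fock \<Rightarrow> 'k) \<in> fock_space (int q)" using ket' by (simp add: W'_def)
      ultimately have "app T (ket (\<beta>', F')) \<in> fock_space (int q)" unfolding shifts_def by force
      then have "e \<noteq> 0 \<Longrightarrow> ket \<phi> \<in> W'" using fock_space_ketD[of e \<phi> "int q"] e \<beta>'_lst IH[of "fst \<phi>" "snd \<phi>"] by auto
      then show ?thesis using W'_scale W'_zero by (cases "e = 0") (auto simp: e(2))
    qed
    \<comment> \<open>The induction hypothesis puts both the state acted on and the derivative term
      into \<open>W'\<close>; subtracting the latter leaves a nonzero multiple of the wanted
      state.\<close>
    have "app (witt_op ?g l) (ket (\<beta>', F')) \<in> W'" by (rule W'_witt_op[OF ket' g l(1)])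
    also have "app (witt_op ?g l) (ket (\<beta>', F')) = (\<lambda>\<psi>. app T (ket (\<beta>', F')) \<psi> + c * ket (\<beta>, F) \<psi>)"
      unfolding witt_op_y_last[OF n l(2)] T_def[symmetric] using c(2) by (simp add: fun_eq_iff)
    finally show ?case using T_W' c(1) by (rule W'_ket)
  qed
  show "Vq m n q \<subseteq> W"
  proof
    fix v :: "vbas \<Rightarrow> 'k" assume v: "v \<in> Vq m n q"
    have "ket \<phi> \<in> W'" if "Phi v \<phi> \<noteq> 0" for \<phi>
    proof -
      have \<phi>: "\<phi> \<in> fock_states" "deg \<phi> = int q" using Phi_fock_space[OF v] that unfolding fock_space_def by auto
      have "fst \<phi> lst \<le> sum (fst \<phi>) {m..<m+n}" using lst[OF n] by (intro member_le_sum) auto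
      then have "fst \<phi> lst \<le> q" using \<phi>(2) unfolding deg_def by linarith
      then show ?thesis using ket_W'[of "fst \<phi>" "snd \<phi>" "q - fst \<phi> lst"] \<phi> by simp
    qed
    then have "(\<lambda>\<psi>. \<Sum>\<phi>\<in>{\<phi>. Phi v \<phi> \<noteq> 0}. Phi v \<phi> * ket \<phi> \<psi>) \<in> W'"
      by (intro W'_sum W'_scale) simp
    then have "Phi v \<in> W'" using ket_expansion[of "Phi v"] Phi_fock_space[OF v] by (simp add: fock_space_def)
    then show "v \<in> W" using Psi_Phi[OF v] by (simp add: W'_def)
  qed
qed

end

section \<open>Cohomology of the differential\<close>

context witt
begin

definition top_fock :: fock where "top_fock = (\<lambda>_. 0, {..<m+n})"

definition top_bas :: vbas where "top_bas = ((\<lambda>_. 0, [0..<n]), [0..<m])"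

lemma vb_ok_top: "vb_ok top_bas"
  by (auto simp: vb_ok_def top_bas_def valid_rmon_def valid_omon_def strict_sorted_iff)

lemma enc_top: "enc top_bas = top_fock"
proof -
  have "p \<in> {p \<in> set [0..<m]. p < m} \<union> (+) m ` set [0..<n] \<longleftrightarrow> p < m + n" for p
  proof (cases "p < m")
    case False
    then have "p = m + (p - m)" by simp
    then show ?thesis using False by (auto intro: image_eqI[of _ _ "p - m"])
  qed auto
  then have "{p \<in> set [0..<m]. p < m} \<union> (+) m ` set [0..<n] = {..<m+n}" by blast
  then show ?thesis by (auto simp: enc_def top_bas_def top_fock_def fun_eq_iff count_list_0_iff)
qed

lemma deg_top: "deg top_fock = int m"
  using deg_enc[OF vb_ok_top] by (simp add: enc_top) (simp add: top_bas_def)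

lemma fan_top: "p < m + n \<Longrightarrow> app (fan p) v top_fock = (0 :: 'k::field)"
  by (simp add: fan_def top_fock_def)

text \<open>Every summand of \<open>diff\<close> removes a fermion, so no image has a component at
  the state in which all fermions are present.\<close>

lemma diff_top: "app diff v top_fock = (0 :: 'k::field)"
proof -
  have "app (dl p * io p) v top_fock = (0 :: 'k)" if "p < m + n" for p
    using that fan_top[OF that, where 'k='k] by (auto simp: dl_def io_def mult.assoc) (simp add: an_def fan_def top_fock_def)
  then show ?thesis by (simp add: diff_def del: app_simps(6))
qed

lemma io_ket_top: "m \<le> p \<Longrightarrow> app (io p) (ket top_fock) = (\<lambda>_. 0 :: 'k::field)"
  by (simp add: io_def top_fock_def eps_def fpar_ket an_ket app_scale)

lemma ec_ket_top: "p < m \<Longrightarrow> app (ec p) (ket top_fock) = (\<lambda>_. 0 :: 'k::field)"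
  by (simp add: ec_def top_fock_def fcr_ket)

text \<open>Every summand of \<open>diff\<close> also removes a boson, and this state has
  none.\<close>

lemma diff_ket_top: "app diff (ket top_fock) = (\<lambda>_. 0 :: 'k::field)"
proof
  fix \<psi>
  have "app (dl p) (app (io p) (ket top_fock)) = (\<lambda>_. 0 :: 'k)" if "p < m + n" for p
  proof (cases "p < m")
    case True
    then show ?thesis by (simp add: dl_def io_def top_fock_def fan_ket an_ket app_scale)
  next
    case False
    then show ?thesis by (simp add: io_ket_top app_zero)
  qed
  then show "app diff (ket top_fock) \<psi> = (0 :: 'k)" by (simp add: diff_def)
qed

definition num :: "fock \<Rightarrow> nat" where
  "num \<phi> = (\<Sum>p<m+n. fst \<phi> p + (if p \<in> snd \<phi> then 0 else 1))"

lemma app_numop: "app numop v \<phi> = (of_nat (num \<phi>) * v \<phi> :: 'k::field)"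
  by (cases \<phi>) (auto simp: numop_def num_def intro!: arg_cong[where f = "\<lambda>x. x * v _"] sum.cong)

lemma num_eq_0: "\<phi> \<in> fock_states \<Longrightarrow> num \<phi> = 0 \<longleftrightarrow> \<phi> = top_fock"
proof
  assume \<phi>: "\<phi> \<in> fock_states" "num \<phi> = 0"
  then have *: "p < m + n \<Longrightarrow> fst \<phi> p = 0 \<and> p \<in> snd \<phi>" for p by (auto simp: num_def split: if_splits)
  then have "fst \<phi> p = 0" for p using \<phi>(1) by (cases "p < m + n") (auto simp: fock_states_def)
  moreover have "snd \<phi> = {..<m+n}" using * \<phi>(1) by (auto simp: fock_states_def)
  ultimately show "\<phi> = top_fock" by (auto simp: top_fock_def prod_eq_iff)
qed (simp add: num_def top_fock_def)

lemma numop_diff: "numop * diff = diff * (numop :: (fock, 'k::field_char_0) linop)"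
proof -
  have "numop * diff = diff * hom * diff + hom * (diff * (diff :: (fock, 'k) linop))"
    by (simp add: homotopy[symmetric] distrib_right mult.assoc)
  moreover have "diff * numop = diff * diff * hom + diff * hom * (diff :: (fock, 'k) linop)"
    by (simp add: homotopy[symmetric] distrib_left mult.assoc)
  ultimately show ?thesis by (simp add: diff_diff)
qed

text \<open>Let \<open>u'\<close> be \<open>u\<close> without its top component, divided by the
  eigenvalues of \<open>numop\<close>, which are nonzero there in characteristic 0. Since
  \<open>numop\<close> commutes with \<open>diff\<close>, \<open>u'\<close> is closed too, and the
  homotopy formula exhibits \<open>numop\<close> applied to \<open>u'\<close> as the boundary of
  \<open>hom\<close> applied to \<open>u'\<close>.\<close>

lemma poincare:
  fixes u :: "fock \<Rightarrow> 'k::field_char_0"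
  assumes u: "u \<in> fock_space d" and closed: "app diff u = (\<lambda>_. 0)"
  obtains z where "z \<in> fock_space (d + 1)" "u = (\<lambda>\<phi>. app diff z \<phi> + u top_fock * ket top_fock \<phi>)"
proof -
  \<comment> \<open>At \<open>top_fock\<close> the eigenvalue is 0, and \<open>inverse 0 = 0\<close>
    discards exactly this component.\<close>
  define u' where "u' = (\<lambda>\<phi>. inverse (of_nat (num \<phi>)) * u \<phi>)"
  have u': "u' \<in> fock_space d" unfolding u'_def by (rule fock_space_scale[OF u])
  have num_u': "app numop u' = (\<lambda>\<phi>. u \<phi> + - u top_fock * ket top_fock \<phi>)"
  proof
    fix \<phi>
    show "app numop u' \<phi> = u \<phi> + - u top_fock * ket top_fock \<phi>"
    proof (cases "\<phi> \<in> fock_states")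
      case True
      then show ?thesis using num_eq_0[OF True] by (auto simp: app_numop u'_def ket_def)
    next
      case False
      then have "u \<phi> = 0" using u unfolding fock_space_def by blast
      moreover have "top_fock \<in> fock_states" by (simp add: fock_states_def top_fock_def)
      then have "\<phi> \<noteq> top_fock" using False by auto
      ultimately show ?thesis by (simp add: app_numop u'_def ket_def)
    qed
  qed
  have "app diff (app numop u') = (\<lambda>\<phi>. app diff u \<phi> + - u top_fock * app diff (ket top_fock) \<phi>)"
    unfolding num_u' app_add app_scale ..
  then have "app numop (app diff u') = (\<lambda>_. 0)"
    using numop_diff[where 'k='k] by (metis (no_types, lifting) app_simps(6) closed diff_ket_top add.right_neutral mult_zero_right)
  then have num_z: "of_nat (num \<phi>) * app diff u' \<phi> = 0" for \<phi> using app_numop by metis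
  have "app diff u' \<in> fock_space (d + -1)" using shifts_diff u' unfolding shifts_def by blast
  then have supp: "app diff u' \<phi> \<noteq> 0 \<Longrightarrow> \<phi> \<in> fock_states" for \<phi> unfolding fock_space_def by blast
  \<comment> \<open>Where the eigenvalue is nonzero it can be cancelled in \<open>num_z\<close>; at
    \<open>top_fock\<close> the coefficient vanishes by \<open>diff_top\<close>.\<close>
  have "app diff u' \<phi> = 0" for \<phi>
  proof (rule ccontr)
    assume nz: "app diff u' \<phi> \<noteq> 0"
    then have "num \<phi> = 0" using num_z[of \<phi>] by simp
    then have "\<phi> = top_fock" using num_eq_0 supp[OF nz] by blast
    then show False using nz diff_top by blast
  qed
  then have closed': "app diff u' = (\<lambda>_. 0)" by auto
  have "app numop u' \<phi> = app diff (app hom u') \<phi>" for \<phi>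
    unfolding homotopy[symmetric] by (simp add: closed' app_zero)
  then have "app diff (app hom u') \<phi> = u \<phi> + - u top_fock * ket top_fock \<phi>" for \<phi>
    unfolding num_u' by simp
  then have "u = (\<lambda>\<phi>. app diff (app hom u') \<phi> + u top_fock * ket top_fock \<phi>)" by (simp add: fun_eq_iff)
  moreover have "app hom u' \<in> fock_space (d + 1)" using shifts_hom u' unfolding shifts_def by blast
  ultimately show ?thesis using that by blast
qed

lemma Psi_ket_top: "Psi (ket top_fock) = (single top_bas :: vbas \<Rightarrow> 'k::field)"
  by (rule ext) (simp add: single_def Psi_kb[OF vb_ok_top] flip: enc_top)

lemma dq_exact:
  fixes v :: "vbas \<Rightarrow> 'k::field_char_0"
  assumes v: "v \<in> Vq m n q" and closed: "dq q v = vzero"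
  obtains y where "y \<in> Vq m n (q + 1)" "v = (\<lambda>b. dq (q + 1) y b + v top_bas * single top_bas b)"
proof -
  have "app diff (Phi v) = (\<lambda>_. 0)"
  proof (cases "q = 0")
    case True
    \<comment> \<open>In degree 0 the hypothesis on \<open>dq\<close> is void, but
      \<open>diff\<close> lands in degree -1, which is zero.\<close>
    have "app diff (Phi v) \<in> fock_space (int q + -1)" using shifts_diff Phi_fock_space[OF v] unfolding shifts_def by blast
    then have "app diff (Phi v) \<in> fock_space (-1)" using True by simp
    then show ?thesis by (rule fock_space_neg) simp
  next
    case False
    then have q: "1 \<le> q" by simp
    have "Phi (dq q v) = (\<lambda>_. 0)" unfolding closed by (auto simp: Phi_def vzero_def)
    then show ?thesis using Phi_dq[OF q v] q by (simp add: fun_eq_iff)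
  qed
  from poincare[OF Phi_fock_space[OF v] this] obtain z where
    z: "z \<in> fock_space (int q + 1)" "Phi v = (\<lambda>\<phi>. app diff z \<phi> + Phi v top_fock * ket top_fock \<phi>)" by blast
  \<comment> \<open>The factor -(q + 1) cancels the normalisation -1/(q + 1) of the next
    differential.\<close>
  define z' where "z' = (\<lambda>\<phi>. - of_nat (q + 1) * z \<phi>)"
  have z': "z' \<in> fock_space (int (q + 1))" unfolding z'_def using fock_space_scale[OF z(1), of "\<lambda>_. - of_nat (q + 1)"] by simp
  have "Phi v top_fock = v top_bas" using Phi_enc[OF vb_ok_top] by (simp add: enc_top)
  moreover have "(- 1 / of_nat (q + 1)) * app diff z' \<phi> = app diff z \<phi>" for \<phi>
    unfolding z'_def app_scale by (simp add: field_simps del: of_nat_add of_nat_Suc)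
  then have "dq (q + 1) (Psi z') = Psi (app diff z)"
    unfolding dq_def Phi_Psi[OF z'] by simp
  moreover have "v = Psi (\<lambda>\<phi>. app diff z \<phi> + Phi v top_fock * ket top_fock \<phi>)"
    unfolding z(2)[symmetric] using Psi_Phi[OF v] ..
  ultimately have "v = (\<lambda>b. dq (q + 1) (Psi z') b + v top_bas * single top_bas b)"
    by (simp only: Psi_lin Psi_ket_top)
  then show ?thesis using that Psi_fock_space[OF z'] by blast
qed

lemma dq_dq:
  assumes v: "v \<in> Vq m n (q + 1)" shows "dq q (dq (q + 1) v) = (vzero :: vbas \<Rightarrow> 'k::field_char_0)"
proof -
  have dd: "app diff (app diff u) = (\<lambda>_. 0 :: 'k)" for u
    using diff_diff[where 'k='k] by (metis app_simps(1,6) ext)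
  have Phi_dq: "Phi (dq (q + 1) v) = (\<lambda>\<phi>. (- 1 / of_nat (q + 1)) * app diff (Phi v) \<phi>)"
    by (rule Phi_dq[OF _ v]) simp
  have closed: "app diff (Phi (dq (q + 1) v)) = (\<lambda>_. 0)" unfolding Phi_dq app_scale dd by simp
  show ?thesis unfolding dq_def[of q] closed by (auto simp: Psi_def vzero_def)
qed

lemma dq_top: "dq q v top_bas = (0 :: 'k::field_char_0)"
  by (simp add: dq_def vzero_def Psi_def enc_top diff_top)

text \<open>The top class is invariant modulo states other than the top one. For
  \<open>i < m\<close>, \<delta>_i kills the top state and the sum reduces to its term at
  \<open>p = i\<close>, which cancels the K_i term. For \<open>i \<ge> m\<close>, the first and last
  summands combine to \<delta>_i times something, whose image lacks a fermion. In the sum, the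
  contractions with \<open>p \<ge> m\<close> kill the top state, and for \<open>p < m\<close> the
  factor \<open>ec i\<close> can be moved to the front, where it leaves a boson.\<close>

lemma witt_op_top:
  assumes f: "valid_rmon m n f" and i: "i < m + n"
  shows "app (witt_op f i) (ket top_fock) top_fock = (0 :: 'k::field)"
proof -
  note f' = mon_ok_valid[OF f]
  define Q :: "(fock, 'k) linop" where "Q = (if i < m then 1 else yp * tau)"
  have Q: "Q * Q = 1" by (simp add: Q_def normal)
  have tau: "app tau (ket top_fock) = (ket top_fock :: fock \<Rightarrow> 'k)"
    by (simp add: tau_def top_fock_def bpar_ket)
  then have tau_at: "app (tau_at i) (ket top_fock) = (ket top_fock :: fock \<Rightarrow> 'k)" by (simp add: tau_at_def)
  have "\<exists>s. app Q (ket top_fock) = (\<lambda>\<psi>. s * ket top_fock \<psi>)"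
    using tau by (auto simp: Q_def yp_def top_fock_def fpar_ket intro: exI[of _ 1])
  then obtain s where s: "app Q (ket top_fock) = (\<lambda>\<psi>. s * ket top_fock \<psi>)" by blast
  define N :: "(fock, 'k) linop" where
    "N = mul f * dl i * tau_at i - (\<Sum>p<m+n. dmul f p * (ec i * tau_at i * io p)) + dmul f i * tau_at i"
  have N: "witt_op f i * Q = N" unfolding Q_def N_def by (rule witt_op_normal_form[OF f' i])
  have "app (witt_op f i) (ket top_fock) = app (witt_op f i * Q) (app Q (ket top_fock))"
    using Q by (metis app_simps(2,6) mult.assoc mult.right_neutral)
  then have witt_op: "app (witt_op f i) (ket top_fock) = (\<lambda>\<psi>. s * app N (ket top_fock) \<psi>)"
    unfolding N s app_scale .
  have "app N (ket top_fock) top_fock = 0"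
  proof (cases "i < m")
    case True
    have "app (dl i) (ket top_fock) = (\<lambda>_. 0 :: 'k)" using True by (simp add: dl_def top_fock_def an_ket)
    moreover have "app (ec i) (app (io p) (ket top_fock)) = (\<lambda>\<psi>. if p = i then ket top_fock \<psi> else (0 :: 'k))" if "p < m + n" for p
    proof -
      have "ec i * io p = (if p = i then 1 else 0) - io p * (ec i :: (fock, 'k) linop)"
        using io_ec[OF that i, where 'k='k] True by (auto simp: sig_def)
      then have "app (ec i * io p) (ket top_fock) = app ((if p = i then 1 else 0) - io p * (ec i :: (fock, 'k) linop)) (ket top_fock)" by simp
      then show ?thesis using True by (auto simp: fun_eq_iff ec_ket_top app_zero)
    qed
    then have "(\<Sum>p<m+n. app (dmul f p) (app (ec i) (app (io p) (ket top_fock))) top_fock) = (\<Sum>p<m+n. if p = i then app (dmul f i) (ket top_fock) top_fock else (0 :: 'k))"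
      by (intro sum.cong) (auto simp: app_zero)
    ultimately show ?thesis using True i by (simp add: N_def tau_at_def app_zero)
  next
    case False
    have "N = dl i * (mul f * tau_at i) - (\<Sum>p<m+n. dmul f p * (ec i * tau_at i * io p))"
      unfolding N_def by (simp add: dl_mul[OF f' i] distrib_right flip: mult.assoc)
    moreover have "app (dl i) x top_fock = (0 :: 'k)" for x
      using False i fan_top[OF i, where 'k='k] by (simp add: dl_def mult.assoc)
    moreover have "app (dmul f p) (app (ec i) (app (tau_at i) (app (io p) (ket top_fock)))) top_fock = (0 :: 'k)" if "p < m + n" for p
    proof (cases "p < m")
      case True
      have "dmul f p * ec i = ec i * (dmul f p :: (fock, 'k) linop)"
        using True mul_commute(2)[OF mon_ok_valid[OF valid_rmon_rdx[OF f]] i, where 'k='k]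
        by (simp add: dmul_def mult.assoc of_int_left)
      then have "app (dmul f p) (app (ec i) x) top_fock = app (ec i) (app (dmul f p) x) top_fock" for x :: "fock \<Rightarrow> 'k"
        by (metis app_simps(6))
      then show ?thesis using False by (simp add: ec_def cr_def top_fock_def)
    next
      case False
      then show ?thesis by (simp add: io_ket_top app_zero)
    qed
    ultimately show ?thesis by (simp add: app_zero)
  qed
  then show ?thesis by (simp add: witt_op)
qed

lemma gact_add: "gact X (\<lambda>\<phi>. u \<phi> + v \<phi>) = (\<lambda>\<phi>. gact X u \<phi> + gact X v \<phi>)"
  by (simp add: gact_def app_add distrib_left sum.distrib)

text \<open>A closed vector is a boundary plus a multiple of the top vector. The action sends
  boundaries to boundaries, which have no top component, and the top vector is covered by
  \<open>witt_op_top\<close>.\<close>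

lemma act_closed_top:
  fixes v :: "vbas \<Rightarrow> 'k::field_char_0"
  assumes X: "X \<in> Gcar m n" and v: "v \<in> Vq m n q" and closed: "dq q v = vzero"
  shows "act m n X v top_bas = 0"
proof -
  obtain y where y: "y \<in> Vq m n (q + 1)" "v = (\<lambda>b. dq (q + 1) y b + v top_bas * single top_bas b)"
    using dq_exact[OF v closed] by blast
  have "Phi v = (\<lambda>\<phi>. (- 1 / of_nat (q + 1)) * app diff (Phi y) \<phi> + v top_bas * ket top_fock \<phi>)"
    by (subst y(2)) (simp add: Phi_lin Phi_dq[OF _ y(1)] Phi_single[OF vb_ok_top] enc_top del: of_nat_add)
  then have "gact X (Phi v) top_fock = (- 1 / of_nat (q + 1)) * app diff (gact X (Phi y)) top_fock + v top_bas * gact X (ket top_fock) top_fock"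
    by (simp only: gact_add gact_scale diff_gact[OF X])
  moreover have "gact X (ket top_fock) top_fock = 0"
    unfolding gact_def
  proof (intro sum.neutral ballI)
    fix gb assume "gb \<in> {gb. X gb \<noteq> 0}"
    then show "X gb * app (witt_op (fst gb) (snd gb)) (ket top_fock) top_fock = 0"
      using witt_op_top[of "fst gb" "snd gb", where 'k='k] Gcar_ok[OF X, of gb] by simp
  qed
  ultimately show ?thesis by (simp add: act_eq[OF X v] Psi_def vb_ok_top enc_top diff_top)
qed


section \<open>Submodules, uniqueness of the differential, and its image\<close>

lemma submodule_Vq: "submodule m n q (Vq m n q :: (vbas \<Rightarrow> 'k::field_char_0) set)"
  unfolding submodule_def
proof (intro conjI ballI allI impI subset_refl)
  show "vzero \<in> Vq m n q" by (simp add: Vq_def vzero_def)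
  fix u v :: "vbas \<Rightarrow> 'k" and c assume u: "u \<in> Vq m n q"
  show "(\<lambda>b. c * u b) \<in> Vq m n q"
    using Psi_fock_space[OF fock_space_scale[OF Phi_fock_space[OF u], of "\<lambda>_. c"]] by (simp add: Psi_lin Psi_Phi[OF u])
  show "act m n X u \<in> Vq m n q" if "X \<in> Gcar m n" for X using that u by (rule act_Vq)
  assume v: "v \<in> Vq m n q"
  show "(\<lambda>b. u b + v b) \<in> Vq m n q"
    using Psi_fock_space[OF fock_space_add[OF Phi_fock_space[OF u] Phi_fock_space[OF v]]] by (simp add: Psi_lin Psi_Phi[OF u] Psi_Phi[OF v])
qed

lemma submodule_add: "submodule m n q W \<Longrightarrow> u \<in> W \<Longrightarrow> v \<in> W \<Longrightarrow> (\<lambda>b. u b + v b) \<in> W"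
  and submodule_scale: "submodule m n q W \<Longrightarrow> u \<in> W \<Longrightarrow> (\<lambda>b. c * u b) \<in> W"
  by (simp_all add: submodule_def)

lemma gmap_zero: "gmap m n (Vq m n q) B \<theta> \<Longrightarrow> \<theta> vzero = (vzero :: vbas \<Rightarrow> 'k::field_char_0)"
proof -
  assume "gmap m n (Vq m n q) B \<theta>"
  moreover have "vzero \<in> (Vq m n q :: (vbas \<Rightarrow> 'k) set)" using submodule_Vq[of q, where 'k='k] by (simp add: submodule_def)
  ultimately have "\<theta> (\<lambda>b. 0 * vzero b) = (\<lambda>b. 0 * \<theta> vzero b)" unfolding gmap_def by blast
  then show ?thesis by (simp add: vzero_def)
qed

lemma act_zero: "X \<in> Gcar m n \<Longrightarrow> act m n X vzero = (vzero :: vbas \<Rightarrow> 'k::field_char_0)"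
  by (auto simp: act_def vzero_def)

lemma submodule_image:
  fixes \<theta> :: "(vbas \<Rightarrow> 'k::field_char_0) \<Rightarrow> vbas \<Rightarrow> 'k"
  assumes g: "gmap m n (Vq m n q) (Vq m n r) \<theta>"
  shows "submodule m n r (\<theta> ` Vq m n q)"
proof -
  note V = submodule_Vq[of q, where 'k='k, unfolded submodule_def]
  show ?thesis unfolding submodule_def
  proof (intro conjI ballI allI impI)
    show "\<theta> ` Vq m n q \<subseteq> Vq m n r" using g by (auto simp: gmap_def)
    show "vzero \<in> \<theta> ` Vq m n q" using gmap_zero[OF g] V by (metis imageI)
    fix u v X and c :: 'k assume "u \<in> \<theta> ` Vq m n q"
    then obtain u' where u': "u' \<in> Vq m n q" "u = \<theta> u'" by blast
    show "(\<lambda>b. c * u b) \<in> \<theta> ` Vq m n q"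
      by (rule image_eqI[of _ _ "\<lambda>b. c * u' b"]) (use g V u' in \<open>auto simp: gmap_def\<close>)
    show "act m n X u \<in> \<theta> ` Vq m n q" if "X \<in> Gcar m n"
      by (rule image_eqI[of _ _ "act m n X u'"]) (use g V u' that in \<open>auto simp: gmap_def\<close>)
    assume "v \<in> \<theta> ` Vq m n q"
    then obtain v' where v': "v' \<in> Vq m n q" "v = \<theta> v'" by blast
    show "(\<lambda>b. u b + v b) \<in> \<theta> ` Vq m n q"
      by (rule image_eqI[of _ _ "\<lambda>b. u' b + v' b"]) (use g V u' v' in \<open>auto simp: gmap_def\<close>)
  qed
qed

lemma submodule_preimage:
  fixes \<theta> :: "(vbas \<Rightarrow> 'k::field_char_0) \<Rightarrow> vbas \<Rightarrow> 'k"
  assumes g: "gmap m n (Vq m n q) (Vq m n r) \<theta>" and W: "submodule m n r W"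
  shows "submodule m n q {v \<in> Vq m n q. \<theta> v \<in> W}"
  using submodule_Vq[of q, where 'k='k] g W gmap_zero[OF g] unfolding submodule_def gmap_def by auto

lemma submodule_equalizer:
  fixes \<theta> \<eta> :: "(vbas \<Rightarrow> 'k::field_char_0) \<Rightarrow> vbas \<Rightarrow> 'k"
  assumes g: "gmap m n (Vq m n q) (Vq m n r) \<theta>" and h: "gmap m n (Vq m n q) (Vq m n r) \<eta>"
  shows "submodule m n q {v \<in> Vq m n q. \<theta> v = \<eta> v}"
  using submodule_Vq[of q, where 'k='k] g h gmap_zero[OF g] gmap_zero[OF h] unfolding submodule_def gmap_def by auto

lemma gen_vec_Vq: "1 \<le> n \<Longrightarrow> gen_vec m n q \<in> (Vq m n q :: (vbas \<Rightarrow> 'k::field) set)"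
  by (auto simp: gen_vec_def single_def Vq_def valid_rmon_def valid_omon_def filter_replicate split: if_splits)

text \<open>The vectors on which \<open>d q\<close> and \<open>dq q\<close> agree form a submodule
  containing the generator.\<close>

lemma dprops_unique:
  assumes n: "1 \<le> n" and d: "dprops m n d" and v: "v \<in> Vq m n q"
  shows "d q v = dq q (v :: vbas \<Rightarrow> 'k::field_char_0)"
proof (cases "q = 0")
  case True
  then show ?thesis using d by (simp add: dprops_def dq_def)
next
  case False
  then have q: "1 \<le> q" by simp
  have g: "gmap m n (Vq m n q) (Vq m n (q - 1)) (d q)" and "d q (gen_vec m n q) = gen_img m n q"
    using d q by (auto simp: dprops_def)
  moreover have "gen_vec m n q \<in> (Vq m n q :: (vbas \<Rightarrow> 'k) set)"
    by (rule gen_vec_Vq[OF n])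
  ultimately have "gen_vec m n q \<in> {v \<in> Vq m n q. d q v = dq q v}" using dq_gen[OF n q, where 'k='k] by simp
  then have "{v \<in> Vq m n q. d q v = dq q v} = Vq m n q"
    by (intro gen_vec_generates[OF n q] submodule_equalizer[OF g dq_gmap[OF q]])
  then show ?thesis using v by blast
qed

lemma dprops_dq: "1 \<le> n \<Longrightarrow> dprops m n (dq :: nat \<Rightarrow> (vbas \<Rightarrow> 'k::field_char_0) \<Rightarrow> _)"
  unfolding dprops_def using dq_gmap dq_gen by (auto simp: dq_def[of 0])

lemma gen_img_nonzero: "gen_img m n q \<noteq> (vzero :: vbas \<Rightarrow> 'k::field)"
  by (auto simp: gen_img_def single_def vzero_def fun_eq_iff)

text \<open>The vectors 1 \<otimes> w are closed, having nothing to differentiate, and have no top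
  component, so they lie in the image, which is a submodule. Conversely, the preimage of a submodule
  containing them contains the generator and so is everything.\<close>

lemma Lmod_eq_image:
  assumes n: "1 \<le> n"
  shows "Lmod m n q = dq (q + 1) ` (Vq m n (q + 1) :: (vbas \<Rightarrow> 'k::field_char_0) set)" (is "_ = ?I")
proof
  have g: "gmap m n (Vq m n (q + 1)) (Vq m n q) (dq (q + 1) :: (vbas \<Rightarrow> 'k) \<Rightarrow> _)"
    using dq_gmap[of "q + 1", where 'a='k] by simp
  have "single ((\<lambda>_. 0, []), w) \<in> ?I" if w: "valid_omon m n q w" for w
  proof -
    let ?b = "((\<lambda>_. 0, []), w) :: vbas"
    have b: "vb_ok ?b" "length w = q" using w by (auto simp: vb_ok_def valid_rmon_def valid_omon_def)
    have v: "single ?b \<in> (Vq m n q :: (vbas \<Rightarrow> 'k) set)"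
      using w by (auto simp: Vq_def single_def valid_rmon_def split: if_splits)
    have "app (dl p * io p) (kb ?b) = (\<lambda>_. 0 :: 'k)" if p: "p < m + n" for p
    proof -
      have "app (dl p) (kb ?b) = (\<lambda>_. 0 :: 'k)"
      proof (cases "p < m")
        case True
        then show ?thesis by (simp add: dl_def an_kb rdx_def)
      next
        case False
        then have "dl p = yd (p - m) * (yp :: (fock, 'k) linop)" by (simp add: dl_def yd_def)
        moreover have "valid_rmon m n (\<lambda>_. 0, [])" by (simp add: valid_rmon_def)
        ultimately show ?thesis by (simp add: yp_kb yd_kb rdy_def)
      qed
      then show ?thesis using io_dl[OF p p, where 'k='k] by (metis app_simps(6) app_zero)
    qed
    then have "app diff (kb ?b) = (\<lambda>_. 0 :: 'k)" by (simp add: diff_def fun_eq_iff del: app_simps(6))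
    then have "dq q (single ?b) = (vzero :: vbas \<Rightarrow> 'k)"
      by (auto simp: dq_def Phi_single[OF b(1)] Psi_def vzero_def)
    then obtain y where "y \<in> Vq m n (q + 1)" "single ?b = (\<lambda>b. dq (q + 1) y b + single ?b top_bas * single top_bas b :: 'k)"
      using dq_exact[OF v] by blast
    \<comment> \<open>Since \<open>n \<ge> 1\<close>, the top monomial contains a y and
      \<open>?b\<close> does not.\<close>
    moreover have "single ?b top_bas = (0 :: 'k)" using n by (auto simp: single_def top_bas_def)
    ultimately show ?thesis by auto
  qed
  then show "Lmod m n q \<subseteq> ?I" unfolding Lmod_def using submodule_image[OF g] by blast
  show "?I \<subseteq> Lmod m n q" unfolding Lmod_def
  proof (intro Inter_greatest)
    fix W :: "(vbas \<Rightarrow> 'k) set"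
    assume "W \<in> {W. submodule m n q W \<and> (\<forall>w. valid_omon m n q w \<longrightarrow> single ((\<lambda>_. 0, []), w) \<in> W)}"
    then have W: "submodule m n q W" "\<And>w. valid_omon m n q w \<Longrightarrow> single ((\<lambda>_. 0, []), w) \<in> W" by auto
    have "valid_omon m n q (replicate q (m + n - 1))" using n by (auto simp: valid_omon_def filter_replicate)
    from W(2)[OF this] have "gen_img m n (q + 1) \<in> W" by (simp add: gen_img_def)
    moreover have "gen_vec m n (q + 1) \<in> (Vq m n (q + 1) :: (vbas \<Rightarrow> 'k) set)"
      by (rule gen_vec_Vq[OF n])
    ultimately have "gen_vec m n (q + 1) \<in> {v \<in> Vq m n (q + 1). dq (q + 1) v \<in> W}"
      using dq_gen[OF n, of "q + 1", where 'k='k] by simp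
    then have "{v \<in> Vq m n (q + 1). dq (q + 1) v \<in> W} = Vq m n (q + 1)"
      by (intro gen_vec_generates[OF n] submodule_preimage[OF g W(1)]) simp_all
    then show "?I \<subseteq> W" by blast
  qed
qed

end

section \<open>Transfer of the results from \<open>dq\<close> to an arbitrary admissible
  \<open>d\<close>\<close>

theorem mainTheorem11:
  fixes m n :: nat
  assumes "1 \<le> m" and "1 \<le> n" and "alg_closed TYPE('k::field_char_0)"
  shows "(\<exists>d :: nat \<Rightarrow> (vbas \<Rightarrow> 'k) \<Rightarrow> (vbas \<Rightarrow> 'k). dprops m n d)
    \<and> (\<forall>d :: nat \<Rightarrow> (vbas \<Rightarrow> 'k) \<Rightarrow> (vbas \<Rightarrow> 'k). dprops m n d \<longrightarrow>
         (\<forall>q. \<forall>v\<in>Vq m n (q + 1). d q (d (q + 1) v) = vzero)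
       \<and> (\<forall>q\<ge>1. \<exists>W :: (vbas \<Rightarrow> 'k) set. submodule m n q W \<and> W \<noteq> {vzero} \<and> W \<noteq> Vq m n q)
       \<and> (\<forall>q. gmod_iso m n (d (q + 1) ` Vq m n (q + 1)) (Lmod m n q))
       \<and> (\<forall>q. q \<noteq> m \<longrightarrow> {v \<in> Vq m n q. d q v = vzero} = d (q + 1) ` Vq m n (q + 1))
       \<and> (let K = {v \<in> Vq m n m. d m v = vzero};
              I = d (m + 1) ` Vq m n (m + 1);
              w0 = single ((\<lambda>_. 0, [0..<n]), [0..<m]) :: vbas \<Rightarrow> 'k
          in w0 \<in> K \<and> w0 \<notin> I
           \<and> K = {(\<lambda>b. u b + c * w0 b) | u c. u \<in> I}
           \<and> (\<forall>X\<in>Gcar m n. \<forall>v\<in>K. act m n X v \<in> I)))"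
proof -
  interpret witt m n .
  note n = \<open>1 \<le> n\<close>
  have gd: "gmap m n (Vq m n (q + 1)) (Vq m n q) (dq (q + 1) :: (vbas \<Rightarrow> 'k) \<Rightarrow> _)" for q
    using dq_gmap[of "q + 1", where 'a='k] by simp
  let ?I = "\<lambda>q. dq (q + 1) ` Vq m n (q + 1) :: (vbas \<Rightarrow> 'k) set"
  let ?K = "\<lambda>q. {v \<in> Vq m n q. dq q v = vzero} :: (vbas \<Rightarrow> 'k) set"
  have I_V: "?I q \<subseteq> Vq m n q" for q using gd[of q] by (auto simp: gmap_def)
  have I_K: "?I q \<subseteq> ?K q" for q
  proof
    fix u assume u: "u \<in> ?I q"
    then obtain v where "v \<in> Vq m n (q + 1)" "u = dq (q + 1) v" by blast
    then show "u \<in> ?K q" using dq_dq[of v q] I_V[of q] u by blast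
  qed
  have exact: "\<exists>u\<in>?I q. v = (\<lambda>b. u b + v top_bas * single top_bas b)" if "v \<in> ?K q" for q v
  proof -
    have v: "v \<in> Vq m n q" "dq q v = vzero" using that by auto
    show ?thesis using dq_exact[OF v] by blast
  qed
  have exact0: "v \<in> ?I q" if v: "v \<in> ?K q" "v top_bas = 0" for q v
    using exact[OF v(1)] v(2) by auto
  \<comment> \<open>The top monomial has degree \<open>m\<close>, so exactness can fail in that
    degree only.\<close>
  have top_V: "v top_bas = 0" if "v \<in> Vq m n q" "q \<noteq> m" for v :: "vbas \<Rightarrow> 'k" and q
    using Vq_ok[OF that(1), of top_bas] that(2) by (auto simp: top_bas_def)
  have top_K: "single top_bas \<in> ?K m"
  proof -
    have "single top_bas \<in> (Vq m n m :: (vbas \<Rightarrow> 'k) set)"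
      using Psi_fock_space[of "ket top_fock :: fock \<Rightarrow> 'k" m] fock_space_ket[of top_fock, where 'a='k] enc_fock_states[OF vb_ok_top]
      by (simp add: Psi_ket_top deg_top enc_top)
    moreover have "dq m (single top_bas) = (vzero :: vbas \<Rightarrow> 'k)"
      by (auto simp: dq_def Phi_single[OF vb_ok_top] enc_top diff_ket_top Psi_def vzero_def)
    ultimately show ?thesis by simp
  qed
  \<comment> \<open>The witness is the image of the next differential. It contains the nonzero
    vector \<open>gen_img m n (q + 1)\<close>, and it lies in the kernel of \<open>dq q\<close>,
    unlike the generator.\<close>
  have part2: "\<exists>W :: (vbas \<Rightarrow> 'k) set. submodule m n q W \<and> W \<noteq> {vzero} \<and> W \<noteq> Vq m n q" if q: "1 \<le> q" for q
  proof (intro exI conjI)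
    have gen: "gen_vec m n r \<in> (Vq m n r :: (vbas \<Rightarrow> 'k) set)" for r
      by (rule gen_vec_Vq[OF n])
    show "submodule m n q (?I q)" by (rule submodule_image[OF gd])
    have "gen_img m n (q + 1) \<in> ?I q" using dq_gen[OF n, of "q + 1", where 'k='k] gen[of "q + 1"] by (metis image_eqI le_add2)
    then show "?I q \<noteq> {vzero}" using gen_img_nonzero[where 'k='k] by blast
    have "dq q (gen_vec m n q) \<noteq> (vzero :: vbas \<Rightarrow> 'k)" using dq_gen[OF n q, where 'k='k] gen_img_nonzero[where 'k='k] by simp
    then show "?I q \<noteq> Vq m n q" using I_K[of q] gen[of q] by blast
  qed
  \<comment> \<open>The two modules are equal as sets, so the identity is an isomorphism.\<close>
  have part3: "gmod_iso m n (?I q) (Lmod m n q)" for q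
    unfolding gmod_iso_def Lmod_eq_image[OF n] by (rule exI[of _ "\<lambda>v. v"]) (auto simp: gmap_def bij_betw_def)
  have part4: "?K q = ?I q" if "q \<noteq> m" for q
    using I_K[of q] exact0[of _ q] top_V[OF _ that] by blast
  have part5: "single top_bas \<in> ?K m \<and> single top_bas \<notin> ?I m
     \<and> ?K m = {(\<lambda>b. u b + c * single top_bas b) | u c. u \<in> ?I m}
     \<and> (\<forall>X\<in>Gcar m n. \<forall>v\<in>?K m. act m n X v \<in> ?I m)"
  proof (intro conjI ballI)
    show "single top_bas \<in> ?K m" by (rule top_K)
    show "single top_bas \<notin> ?I m"
    proof
      assume "single top_bas \<in> ?I m"
      then obtain y where "single top_bas = (dq (m + 1) y :: vbas \<Rightarrow> 'k)" by blast
      then have "single top_bas top_bas = (0 :: 'k)" by (simp add: dq_top)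
      then show False by (simp add: single_def)
    qed
    have sum: "(\<lambda>b. u b + c * single top_bas b) \<in> ?K m" if "u \<in> ?I m" for u c
    proof -
      have K: "submodule m n m (?K m)"
      proof -
        have "gmap m n (Vq m n m) (Vq m n (m - 1)) (dq m :: (vbas \<Rightarrow> 'k) \<Rightarrow> _)" using dq_gmap assms(1) by blast
        moreover have "submodule m n (m - 1) ({vzero} :: (vbas \<Rightarrow> 'k) set)"
          using submodule_Vq[of "m - 1", where 'k='k] act_zero by (auto simp: submodule_def) (auto simp: vzero_def)
        ultimately have "submodule m n m {v \<in> Vq m n m. dq m v \<in> ({vzero} :: (vbas \<Rightarrow> 'k) set)}" by (rule submodule_preimage)
        then show ?thesis by simp
      qed
      have "u \<in> ?K m" using that I_K by blast
      then show ?thesis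
        by (rule submodule_add[OF K _ submodule_scale[OF K top_K]])
    qed
    show "?K m = {(\<lambda>b. u b + c * single top_bas b) | u c. u \<in> ?I m}"
    proof (intro equalityI subsetI)
      fix v assume "v \<in> ?K m"
      from exact[OF this] show "v \<in> {(\<lambda>b. u b + c * single top_bas b) | u c. u \<in> ?I m}" by blast
    next
      fix v assume "v \<in> {(\<lambda>b. u b + c * single top_bas b) | u c. u \<in> ?I m}"
      then obtain u c where "u \<in> ?I m" "v = (\<lambda>b. u b + c * single top_bas b)" by blast
      then show "v \<in> ?K m" using sum[of u c] by simp
    qed
    fix X :: "gbas \<Rightarrow> 'k" and v assume X: "X \<in> Gcar m n" and v: "v \<in> ?K m"
    \<comment> \<open>The kernel is stable under the action, and by \<open>act_closed_top\<close>
      the result has no top component, so it is a boundary.\<close>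
    have "dq m (act m n X v) = act m n X (dq m v)" using dq_gmap[OF assms(1), where 'a='k] X v unfolding gmap_def by blast
    then have "act m n X v \<in> ?K m" using v act_Vq[OF X] act_zero[OF X] by simp
    then show "act m n X v \<in> ?I m" using act_closed_top[OF X] v by (intro exact0) auto
  qed
  show ?thesis
  proof (intro conjI allI impI)
    show "\<exists>d :: nat \<Rightarrow> (vbas \<Rightarrow> 'k) \<Rightarrow> (vbas \<Rightarrow> 'k). dprops m n d" using dprops_dq[OF n] by blast
    fix d :: "nat \<Rightarrow> (vbas \<Rightarrow> 'k) \<Rightarrow> (vbas \<Rightarrow> 'k)" assume d: "dprops m n d"
    note eq = dprops_unique[OF n d]
    have img: "d (q + 1) ` Vq m n (q + 1) = ?I q" for q by (intro image_cong refl eq)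
    have ker: "{v \<in> Vq m n q. d q v = vzero} = ?K q" for q using eq by auto
    show "\<forall>v\<in>Vq m n (q + 1). d q (d (q + 1) v) = vzero" for q
    proof
      fix v :: "vbas \<Rightarrow> 'k" assume v: "v \<in> Vq m n (q + 1)"
      then have "dq (q + 1) v \<in> Vq m n q" using I_V[of q] by blast
      then show "d q (d (q + 1) v) = vzero" using eq v dq_dq[OF v] by simp
    qed
    show "\<exists>W :: (vbas \<Rightarrow> 'k) set. submodule m n q W \<and> W \<noteq> {vzero} \<and> W \<noteq> Vq m n q" if "1 \<le> q" for q
      using part2[OF that] .
    show "gmod_iso m n (d (q + 1) ` Vq m n (q + 1)) (Lmod m n q)" for q unfolding img by (rule part3)
    show "{v \<in> Vq m n q. d q v = vzero} = d (q + 1) ` Vq m n (q + 1)" if "q \<noteq> m" for q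
      unfolding img ker using that by (rule part4)
    show "let K = {v \<in> Vq m n m. d m v = vzero};
              I = d (m + 1) ` Vq m n (m + 1);
              w0 = single ((\<lambda>_. 0, [0..<n]), [0..<m]) :: vbas \<Rightarrow> 'k
          in w0 \<in> K \<and> w0 \<notin> I
           \<and> K = {(\<lambda>b. u b + c * w0 b) | u c. u \<in> I}
           \<and> (\<forall>X\<in>Gcar m n. \<forall>v\<in>K. act m n X v \<in> I)"
      unfolding Let_def img ker top_bas_def[symmetric] by (rule part5)
  qed
qed

end
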